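(* Let $d\ge 1$ be an integer, let $\mathcal{C}_d$ be the algebra of covariants of the binary form of degree $d$, and put $$c_d:=d!\,\deg(\mathcal{C}_d)=\sum_{0\le j<d/2}(-1)^j\binom{d}{j}\left(\frac d2-j\right)^{d-1}.$$ Then: (i) $\displaystyle c_d=\frac{2\,(d-1)!}{\pi}\int_0^\infty\frac{\sin^d x}{x^d}\,dx$; (ii) $\deg(\mathcal{C}_d)>0$.
   Context: For an integer $n\ge 1$, $V_n$ denotes the standard $(n+1)$-dimensional irreducible complex representation of $SL_2=SL_2(\mathbb{C})$ (binary forms of degree $n$). The algebra of covariants of the binary $d$-form is $\mathcal{C}_d\cong\mathbb{C}[V_1\oplus V_d]^{SL_2}$, the algebra of $SL_2$-invariant polynomial functions on $V_1\oplus V_d$. It is graded by the degree of a covariant in the coefficients of the form, i.e. by the degree in the coordinates of $V_d$: $\mathcal{C}_d=(\mathcal{C}_d)_0+(\mathcal{C}_d)_1+\cdots$, with $(\mathcal{C}_d)_0\cong\mathbb{C}$ and every $(\mathcal{C}_d)_i$ finite-dimensional. Its Poincaré series is $\mathcal{P}(\mathcal{C}_d,z)=\sum_{i\ge 0}\dim((\mathcal{C}_d)_i)\,z^i$, a rational function. The transcendence degree over $\mathbb{C}$ of the quotient field of $\mathcal{C}_d$ equals $d$, and the degree of $\mathcal{C}_d$ is $\deg(\mathcal{C}_d):=\lim_{z\to 1}(1-z)^d\,\mathcal{P}(\mathcal{C}_d,z)$. The equality $d!\,\deg(\mathcal{C}_d)=\sum_{0\le j<d/2}(-1)^j\binom{d}{j}(\frac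 d2-j)^{d-1}$ is the paper's explicit formula for the degree. The integral is an improper Riemann integral $\lim_{b\to\infty}\int_0^b$ (conditionally convergent when $d=1$). *)

theory Defs
  imports "HOL-Analysis.Analysis" "HOL-Library.Function_Algebras"
begin

global_interpretation cfun: vector_space "\<lambda>(c::complex) (F::'a \<Rightarrow> complex) x. c * F x"
  by unfold_locales (auto simp: fun_eq_iff algebra_simps)

definition binary_form :: "nat \<Rightarrow> (nat \<Rightarrow> complex) \<Rightarrow> complex^2 \<Rightarrow> complex" where
  "binary_form n a = (\<lambda>v. \<Sum>k\<le>n. a k * (v $ 1) ^ (n - k) * (v $ 2) ^ k)"

definition V :: "nat \<Rightarrow> (complex^2 \<Rightarrow> complex) set" where
  "V n = range (binary_form n)"

definition SL2 :: "(complex^2^2) set" where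
  "SL2 = {g. det g = 1}"

definition act :: "complex^2^2 \<Rightarrow> (complex^2 \<Rightarrow> complex) \<Rightarrow> complex^2 \<Rightarrow> complex" where
  "act g f = (\<lambda>v. f (matrix_inv g *v v))"

type_synonym cform = "complex^2 \<Rightarrow> complex"
type_synonym coords = "(nat \<Rightarrow> complex) \<times> (nat \<Rightarrow> complex)"

text \<open>The monomials in the coordinates \<open>u 0, u 1\<close> of \<open>V 1\<close> and \<open>a 0, \<dots>, a d\<close> of \<open>V d\<close>
  that have degree \<open>i\<close> in the coordinates of \<open>V d\<close>; the degree in those of \<open>V 1\<close> is arbitrary.\<close>

definition monomials :: "nat \<Rightarrow> nat \<Rightarrow> (coords \<Rightarrow> complex) set" where
  "monomials d i =
     {\<lambda>(u, a). (\<Prod>k\<le>1. u k ^ e k) * (\<Prod>k\<le>d. a k ^ m k) | e m. (\<Sum>k\<le>d. m k) = i}"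

definition in_coords :: "nat \<Rightarrow> (cform \<times> cform \<Rightarrow> complex) \<Rightarrow> coords \<Rightarrow> complex" where
  "in_coords d F = (\<lambda>(u, a). F (binary_form 1 u, binary_form d a))"

text \<open>A function on \<open>V 1 \<times> V d\<close> is represented by its extension by \<open>0\<close> to the whole type, so that
  equality and linear independence of the represented functions are those of the type.\<close>

definition polyfuns :: "nat \<Rightarrow> (cform \<times> cform \<Rightarrow> complex) set" where
  "polyfuns d = {F. (\<forall>p. p \<notin> V 1 \<times> V d \<longrightarrow> F p = 0) \<and>
                    in_coords d F \<in> cfun.span (\<Union>i. monomials d i)}"

definition covariants :: "nat \<Rightarrow> (cform \<times> cform \<Rightarrow> complex) set" where
  "covariants d = {F \<in> polyfuns d.
     \<forall>g\<in>SL2. \<forall>l\<in>V 1. \<forall>f\<in>V d. F (act g l, act g f) = F (l, f)}"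

definition covariants_deg :: "nat \<Rightarrow> nat \<Rightarrow> (cform \<times> cform \<Rightarrow> complex) set" where
  "covariants_deg d i = {F \<in> covariants d. in_coords d F \<in> cfun.span (monomials d i)}"

definition poincare_series :: "nat \<Rightarrow> real \<Rightarrow> real" where
  "poincare_series d z = (\<Sum>i. real (cfun.dim (covariants_deg d i)) * z ^ i)"

text \<open>The limit is taken from the left along the reals, inside the disc of convergence; for the
  rational function represented by the series, this agrees with the limit as \<open>z\<close> tends to \<open>1\<close>.\<close>

definition degree_covariants :: "nat \<Rightarrow> real" where
  "degree_covariants d = Lim (at_left 1) (\<lambda>z. (1 - z) ^ d * poincare_series d z)"

definition improper_integral :: "(real \<Rightarrow> real) \<Rightarrow> real" where
  "improper_integral h = Lim at_top (\<lambda>b. integral {0..b} h)"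

end

theory Submission
  imports Defs "HOL-Probability.Sinc_Integral"
    "HOL-Computational_Algebra.Polynomial" "HOL-Computational_Algebra.Formal_Power_Series"
begin

text \<open>
The proof determines every coefficient of the Poincare series, then its growth, then its link
with the integral.

\<^emph>\<open>Coefficients.\<close> A covariant of degree \<open>i\<close> is a polynomial in the coordinates \<open>u 0, u 1\<close> of a linear
form and \<open>a 0, \<dots>, a d\<close> of a \<open>d\<close>-form that is invariant under \<open>SL2\<close>. That group is generated by its
two one-parameter groups of shears (\<open>SL2_induct\<close>), and invariance under such a group means
annihilation by its infinitesimal generator, a differential operator that moves one index in each
monomial up or down (\<open>raise\<close>, \<open>lower\<close>). These operators are adjoint for a Hermitian form in which
monomials are orthogonal, and their commutator is scalar on each weight space. Hence
\<open>norm_sq_raise\<close>, from which \<open>raise\<close> maps weight \<open>0\<close> onto weight \<open>2\<close> and its kernel in weight \<open>0\<close>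
consists exactly of the invariants. So the dimension is a difference of numbers of monomials; it
telescopes to the number \<open>N i\<close> of monomials of degree \<open>i\<close> in \<open>a 0, \<dots>, a d\<close> whose indices add up to
\<open>(d * i + 1) div 2\<close> (\<open>dim_covariants_deg\<close>, a form of the Cayley--Sylvester theorem).

\<^emph>\<open>Growth.\<close> \<open>N i\<close> is the middle coefficient of the Gaussian binomial coefficient \<open>i + d\<close> over \<open>d\<close>.
Expanding the numerator of the latter leaves an alternating sum of numbers of partitions into
parts of size at most \<open>d\<close>, each of which vanishes or grows like a power; the result is
\<open>middle_box_count_asymptotics\<close>. An Abelian theorem (\<open>abelian_limit\<close>) converts this growth into
the limit that defines the degree. The limit is positive, because the same telescoping sum shows that
no other coefficient exceeds the middle one (\<open>box_count_le_middle\<close>), while the \<open>d * i + 1\<close>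
coefficients together count all monomials of degree \<open>i\<close>.

\<^emph>\<open>Integral.\<close> Integrating by parts \<open>d - 1\<close> times reduces \<open>sin x ^ d / x ^ d\<close> to a combination of
Dirichlet integrals of \<open>sin (n * x) / x\<close>, whose values depend only on the sign of \<open>n\<close>
(\<open>tendsto_integral_sin_power\<close>); what remains is the same alternating sum.
\<close>

section \<open>Finite-dimensional spaces of functions\<close>

text \<open>
The ambient spaces of functions are infinite-dimensional, so finiteness is asked of the
subspace only. A basis of the kernel is extended to a basis of the subspace, and the map is
injective on the span of the new vectors.
\<close>

lemma (in vector_space_pair) rank_nullity:
  assumes f: "Vector_Spaces.linear s1 s2 f" and S: "vs1.subspace S" and W: "finite W" "S \<subseteq> vs1.span W"
  shows "vs1.dim S = vs1.dim {x \<in> S. f x = 0} + vs2.dim (f ` S)"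
proof -
  interpret f: Vector_Spaces.linear s1 s2 f by fact
  interpret p: vector_space_pair s1 s1 by unfold_locales
  let ?K = "{x \<in> S. f x = 0}"
  obtain A where A: "A \<subseteq> ?K" "vs1.independent A" "?K \<subseteq> vs1.span A"
    using vs1.maximal_independent_subset[of ?K] by metis
  obtain B where B: "A \<subseteq> B" "B \<subseteq> S" "vs1.independent B" "S \<subseteq> vs1.span B"
    using vs1.maximal_independent_subset_extend[of A S] A by auto
  have finB: "finite B"
    using vs1.independent_span_bound[OF W(1) B(3)] B(2) W(2) by auto
  define C where "C = B - A"
  have CS: "vs1.span C \<subseteq> S"
    using B(2) S unfolding C_def by (intro vs1.span_minimal) auto
  \<comment> \<open>The projection to \<open>span C\<close> along \<open>span A\<close>; it shows that the two spans meet only in \<open>0\<close>.\<close>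
  obtain g where g: "Vector_Spaces.linear s1 s1 g" "\<And>b. b \<in> B \<Longrightarrow> g b = (if b \<in> C then b else 0)"
    using p.linear_independent_extend[OF B(3), of "\<lambda>b. if b \<in> C then b else 0"] by blast
  interpret g: Vector_Spaces.linear s1 s1 g by fact
  have zero: "x = 0" if "x \<in> vs1.span C" "f x = 0" for x
  proof -
    have "x \<in> vs1.span A" using that CS A(3) by auto
    then have "g x = 0"
      by (rule g.eq_0_on_span[rotated]) (use B(1) g(2) C_def in auto)
    moreover have "g x = id x"
      by (rule p.linear_eq_on[OF g(1) vs1.linear_id that(1)]) (use g(2) C_def in auto)
    ultimately show ?thesis by simp
  qed
  have inj: "inj_on f (vs1.span C)"
    using zero f.inj_on_iff_eq_0[OF vs1.subspace_span[of C]] by blast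
  have indC: "vs1.independent C" using B(3) vs1.independent_mono C_def by blast
  have ind: "vs2.independent (f ` C)"
    by (rule f.independent_injective_image[OF indC inj])
  have "f ` S \<subseteq> vs2.span (f ` C)"
  proof -
    have "f ` S \<subseteq> vs2.span (f ` B)" using B(4) f.span_image by blast
    also have "\<dots> \<subseteq> vs2.span (f ` C)"
    proof (rule vs2.span_minimal)
      show "f ` B \<subseteq> vs2.span (f ` C)"
      proof (intro image_subsetI)
        fix b assume "b \<in> B"
        show "f b \<in> vs2.span (f ` C)"
        proof (cases "b \<in> C")
          case True then show ?thesis by (simp add: vs2.span_base)
        next
          case False
          then have "f b = 0" using \<open>b \<in> B\<close> A(1) C_def by auto
          then show ?thesis by (simp add: vs2.span_zero)
        qed
      qed
    qed (rule vs2.subspace_span)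
    finally show ?thesis .
  qed
  then have "vs2.dim (f ` S) = card (f ` C)"
    using ind CS vs1.span_superset[of C] by (intro vs2.dim_unique[of "f ` C"]) auto
  also have "\<dots> = card C"
    using inj by (intro card_image) (meson inj_on_subset vs1.span_superset)
  finally have 1: "vs2.dim (f ` S) = card C" .
  have 2: "vs1.dim ?K = card A" using A by (intro vs1.dim_unique[of A]) auto
  have 3: "vs1.dim S = card B" using B by (intro vs1.dim_unique[of B]) auto
  show ?thesis
    using 1 2 3 finB B(1) by (simp add: C_def card_Diff_subset finite_subset card_mono)
qed

lemma (in vector_space) subspace_eq_if_dim_eq:
  assumes S: "S \<subseteq> T" "subspace S" and W: "finite W" "T \<subseteq> span W" and dim: "dim T \<le> dim S"
  shows "S = T"
proof -
  obtain A where A: "A \<subseteq> S" "independent A" "S \<subseteq> span A" 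
    using maximal_independent_subset[of S] by metis
  obtain B where B: "A \<subseteq> B" "B \<subseteq> T" "independent B" "T \<subseteq> span B"
    using maximal_independent_subset_extend[of A T] A S by (metis subset_trans)
  have finB: "finite B"
    using independent_span_bound[OF W(1) B(3)] B(2) W(2) by auto
  have "card B \<le> card A" using dim A B dim_unique[of A S] dim_unique[of B T] by auto
  then have "A = B" using finB B(1) by (simp add: card_seteq)
  then have "T \<subseteq> span A" using B by simp
  then show ?thesis using A(1) S span_minimal[OF A(1) S(2)] by auto
qed

lemma sum_fun_apply: "(\<Sum>j\<in>A. f j) x = (\<Sum>j\<in>A. f j x)"
  by (induction A rule: infinite_finite_induct) auto

lemma cfun_pair:
  "vector_space_pair (\<lambda>(z::complex) (F::'a \<Rightarrow> complex) x. z * F x) (\<lambda>z (F::'b \<Rightarrow> complex) x. z * F x)"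
  by unfold_locales

lemma
  fixes A :: "'a set"
  assumes "finite A"
  shows dim_functions_on: "cfun.dim {c. \<forall>m. c m \<noteq> 0 \<longrightarrow> m \<in> A} = card A"
    and functions_on_finite_span: "\<exists>W. finite W \<and> {c. \<forall>m. c m \<noteq> 0 \<longrightarrow> m \<in> A} \<subseteq> cfun.span W"
proof -
  define \<delta> :: "'a \<Rightarrow> 'a \<Rightarrow> complex" where "\<delta> m = (\<lambda>x. if x = m then 1 else 0)" for m
  have inj: "inj_on \<delta> A" by (rule inj_onI) (auto simp: \<delta>_def fun_eq_iff split: if_splits)
  have expand: "(\<Sum>m\<in>A. (\<lambda>x. c m * \<delta> m x)) = (\<lambda>x. if x \<in> A then c x else 0)" for c
    using assms by (auto simp: fun_eq_iff sum_fun_apply \<delta>_def if_distrib cong: if_cong)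
  have span: "{c. \<forall>m. c m \<noteq> 0 \<longrightarrow> m \<in> A} \<subseteq> cfun.span (\<delta> ` A)"
  proof
    fix c :: "'a \<Rightarrow> complex" assume "c \<in> {c. \<forall>m. c m \<noteq> 0 \<longrightarrow> m \<in> A}"
    then have "c = (\<Sum>m\<in>A. (\<lambda>x. c m * \<delta> m x))" unfolding expand by (intro ext) auto
    also have "\<dots> \<in> cfun.span (\<delta> ` A)"
      by (intro cfun.span_sum cfun.span_scale cfun.span_base) auto
    finally show "c \<in> cfun.span (\<delta> ` A)" .
  qed
  have ind: "cfun.independent (\<delta> ` A)"
  proof (rule cfun.independent_if_scalars_zero)
    fix f b assume f: "(\<Sum>x\<in>\<delta> ` A. (\<lambda>y. f x * x y)) = 0" and b: "b \<in> \<delta> ` A"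
    have "(\<lambda>x. if x \<in> A then f (\<delta> x) else 0) = 0"
      using f by (simp add: sum.reindex[OF inj] flip: expand)
    from fun_cong[OF this] have "f (\<delta> m) = 0" if "m \<in> A" for m
      using that by (metis zero_fun_apply)
    then show "f b = 0" using b by blast
  qed (use assms in auto)
  show "cfun.dim {c. \<forall>m. c m \<noteq> 0 \<longrightarrow> m \<in> A} = card A"
    by (rule cfun.dim_unique[OF _ span ind card_image[OF inj]]) (auto simp: \<delta>_def split: if_splits)
  show "\<exists>W. finite W \<and> {c. \<forall>m. c m \<noteq> 0 \<longrightarrow> m \<in> A} \<subseteq> cfun.span W"
    using span assms by blast
qed

lemma dim_zero_space: "cfun.dim {0 :: 'a \<Rightarrow> complex} = 0"
  by (rule cfun.dim_unique[of "{}"]) (auto simp: cfun.dependent_def)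

section \<open>Raising and lowering operators on coefficients\<close>

text \<open>
A polynomial is represented by the function of its coefficients on exponent vectors. On that side
\<open>xder l k\<close> is the operator that differentiates by the variable of index \<open>k\<close> and multiplies by the variable
of index \<open>l\<close>, provided that \<open>k \<noteq> l\<close>.
\<close>

definition xder :: "nat \<Rightarrow> nat \<Rightarrow> ((nat \<Rightarrow> nat) \<Rightarrow> complex) \<Rightarrow> (nat \<Rightarrow> nat) \<Rightarrow> complex" where
  "xder l k c = (\<lambda>m. if m l = 0 then 0 else of_nat (m k + 1) * c (m(l := m l - 1, k := m k + 1)))"

lemma xder_add: "xder l k (\<lambda>m. c m + c' m) = (\<lambda>m. xder l k c m + xder l k c' m)"
  by (auto simp: xder_def fun_eq_iff algebra_simps)

lemma xder_scale: "xder l k (\<lambda>m. z * c m) = (\<lambda>m. z * xder l k c m)"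
  by (auto simp: xder_def fun_eq_iff algebra_simps)

lemma xder_sum: "xder l k (\<lambda>m. \<Sum>j\<in>A. c j m) m = (\<Sum>j\<in>A. xder l k (c j) m)"
  by (simp add: xder_def sum_distrib_left)

lemma xder_commute:
  assumes "b \<noteq> a" "p \<noteq> q" "a \<noteq> p" "b \<noteq> q"
  shows "xder b a (xder p q c) = xder p q (xder b a c)"
proof
  fix m
  show "xder b a (xder p q c) m = xder p q (xder b a c) m"
    using assms
    by (cases "b = p"; cases "a = q"; simp add: xder_def fun_upd_twist)
qed

lemma xder_commutator:
  assumes "k \<noteq> l"
  shows "xder k l (xder l k c) m - xder l k (xder k l c) m = (of_nat (m k) - of_nat (m l)) * c m"
proof -
  have *: "xder k l (xder l k c) m = of_nat (m k * (m l + 1)) * c m" if "k \<noteq> l" for k l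
  proof (cases "m k")
    case (Suc n)
    then have "m(k := Suc n, l := m l) = m" by auto
    then show ?thesis using that Suc by (simp add: xder_def fun_upd_twist algebra_simps)
  qed (simp add: xder_def)
  show ?thesis using assms by (simp add: * algebra_simps)
qed

text \<open>
Moving one unit of the exponent from index \<open>k\<close> to index \<open>l\<close> is a bijection between the monomials
divisible by the variable of index \<open>k\<close> and those divisible by the variable of index \<open>l\<close>. Both the adjointness
relation and the computation of derivatives reindex sums in this way.
\<close>

lemma sum_move:
  fixes h :: "(nat \<Rightarrow> nat) \<Rightarrow> (nat \<Rightarrow> nat) \<Rightarrow> 'b::comm_monoid_add"
  assumes "k \<noteq> l"
    and "\<And>m. m \<in> I \<Longrightarrow> m l > 0 \<Longrightarrow> m(l := m l - 1, k := m k + 1) \<in> I"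
    and "\<And>m. m \<in> I \<Longrightarrow> m k > 0 \<Longrightarrow> m(k := m k - 1, l := m l + 1) \<in> I"
  shows "(\<Sum>m | m \<in> I \<and> m l > 0. h m (m(l := m l - 1, k := m k + 1)))
       = (\<Sum>m | m \<in> I \<and> m k > 0. h (m(k := m k - 1, l := m l + 1)) m)"
  by (rule sum.reindex_bij_witness[of _ "\<lambda>m. m(k := m k - 1, l := m l + 1)" "\<lambda>m. m(l := m l - 1, k := m k + 1)"])
     (use assms in \<open>auto simp: fun_upd_twist\<close>)

text \<open>
All coordinates are put in one row: indices \<open>0, \<dots>, d\<close> for the coefficients of the \<open>d\<close>-form,
then \<open>d + 1, d + 2\<close> for those of the linear form. Substituting \<open>y + s * x\<close> for \<open>y\<close> in a binary form changes its
coefficient of index \<open>k\<close> at the rate \<open>k + 1\<close> times the next one. The value \<open>0\<close> at \<open>k = d\<close> keeps the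
two forms apart.
\<close>

definition raise_coef :: "nat \<Rightarrow> nat \<Rightarrow> nat" where
  "raise_coef d k = (if k < d then k + 1 else if k = d then 0 else 1)"

text \<open>
The same for the substitution of \<open>x + s * y\<close> for \<open>x\<close>: the coefficient of index \<open>k + 1\<close> changes at the rate
\<open>d - k\<close> times the one of index \<open>k\<close>, which vanishes at the border \<open>k = d\<close> of the two forms.
\<close>

definition lower_coef :: "nat \<Rightarrow> nat \<Rightarrow> nat" where
  "lower_coef d k = (if k \<le> d then d - k else 1)"

definition raise :: "nat \<Rightarrow> ((nat \<Rightarrow> nat) \<Rightarrow> complex) \<Rightarrow> (nat \<Rightarrow> nat) \<Rightarrow> complex" where
  "raise d c = (\<lambda>m. \<Sum>k<d+2. of_nat (raise_coef d k) * xder (k + 1) k c m)"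

definition lower :: "nat \<Rightarrow> ((nat \<Rightarrow> nat) \<Rightarrow> complex) \<Rightarrow> (nat \<Rightarrow> nat) \<Rightarrow> complex" where
  "lower d c = (\<lambda>m. \<Sum>k<d+2. of_nat (lower_coef d k) * xder k (k + 1) c m)"

text \<open>
The character by which the diagonal torus acts on a monomial, with the sign for which
\<open>raise\<close> increases it.
\<close>

definition weight :: "nat \<Rightarrow> (nat \<Rightarrow> nat) \<Rightarrow> int" where
  "weight d m = (\<Sum>k\<le>d. (2 * int k - int d) * int (m k)) - int (m (d + 1)) + int (m (d + 2))"

text \<open>
The bound \<open>R\<close> on the degree in the coordinates of the linear form makes this set finite. The
operators preserve that degree, and from \<open>R = d * i\<close> on no new invariants appear
(\<open>invariant_coeffs_stable\<close>).
\<close>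

definition exponents :: "nat \<Rightarrow> nat \<Rightarrow> nat \<Rightarrow> (nat \<Rightarrow> nat) set" where
  "exponents d i R = {m. (\<forall>k>d+2. m k = 0) \<and> (\<Sum>k\<le>d. m k) = i \<and> m (d + 1) + m (d + 2) \<le> R}"

definition weight_space :: "nat \<Rightarrow> nat \<Rightarrow> nat \<Rightarrow> int \<Rightarrow> ((nat \<Rightarrow> nat) \<Rightarrow> complex) set" where
  "weight_space d i R w = {c. \<forall>m. c m \<noteq> 0 \<longrightarrow> m \<in> exponents d i R \<and> weight d m = w}"

lemma linear_raise: "Vector_Spaces.linear (\<lambda>z c m. z * c m) (\<lambda>z c m. z * c m) (raise d)"
proof (unfold_locales, goal_cases)
  case (1 x y)
  have "xder a b (x + y) m = xder a b x m + xder a b y m" for a b m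
    using fun_cong[OF xder_add[of a b x y], of m] by (simp add: plus_fun_def)
  then show ?case by (simp add: raise_def fun_eq_iff distrib_left sum.distrib)
next
  case (2 z x)
  show ?case by (simp only: raise_def xder_scale sum_distrib_left mult.left_commute)
qed

lemma linear_lower: "Vector_Spaces.linear (\<lambda>z c m. z * c m) (\<lambda>z c m. z * c m) (lower d)"
proof (unfold_locales, goal_cases)
  case (1 x y)
  have "xder a b (x + y) m = xder a b x m + xder a b y m" for a b m
    using fun_cong[OF xder_add[of a b x y], of m] by (simp add: plus_fun_def)
  then show ?case by (simp add: lower_def fun_eq_iff distrib_left sum.distrib)
next
  case (2 z x)
  show ?case by (simp only: lower_def xder_scale sum_distrib_left mult.left_commute)
qed

lemma sum_by_parts:
  fixes x :: "nat \<Rightarrow> 'a :: comm_ring_1"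
  shows "(\<Sum>k<n. (of_nat k + 1) * (D - of_nat k) * (x k - x (k + 1)))
       = (\<Sum>k\<le>n. (D - 2 * of_nat k) * x k) - (of_nat n + 1) * (D - of_nat n) * x n"
  by (induction n) (simp_all add: algebra_simps)

text \<open>
Terms of the two operators that belong to different places of the row commute, so only the
diagonal remains; summation by parts turns it into the weight.
\<close>

lemma raise_lower_commutator:
  "lower d (raise d c) m - raise d (lower d c) m = - of_int (weight d m) * c m"
proof -
  let ?a = "\<lambda>k. of_nat (raise_coef d k) :: complex" and ?b = "\<lambda>k. of_nat (lower_coef d k) :: complex"
  let ?t = "\<lambda>k l. xder k (k + 1) (xder (l + 1) l c) m - xder (l + 1) l (xder k (k + 1) c) m"
  have 1: "lower d (raise d c) m = (\<Sum>k<d+2. \<Sum>l<d+2. ?b k * ?a l * xder k (k + 1) (xder (l + 1) l c) m)"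
    unfolding lower_def raise_def xder_sum xder_scale by (simp only: sum_distrib_left mult.assoc)
  have 2: "raise d (lower d c) m = (\<Sum>k<d+2. \<Sum>l<d+2. ?b k * ?a l * xder (l + 1) l (xder k (k + 1) c) m)"
    unfolding lower_def raise_def xder_sum xder_scale 
    by (subst sum.swap) (simp only: sum_distrib_left mult_ac)
  have 3: "?t k l = (if k = l then (of_nat (m k) - of_nat (m (k + 1))) * c m else 0)" for k l
    using xder_commutator[of k "k + 1" c m] xder_commute[of k "k + 1" "l + 1" l c] by auto
  have "lower d (raise d c) m - raise d (lower d c) m = (\<Sum>k<d+2. \<Sum>l<d+2. ?b k * ?a l * ?t k l)"
    unfolding 1 2 by (simp only: sum_subtractf right_diff_distrib)
  also have "\<dots> = (\<Sum>k<d+2. ?b k * ?a k * (of_nat (m k) - of_nat (m (k + 1)))) * c m"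
    unfolding 3 sum_distrib_right
    by (intro sum.cong refl) (simp add: if_distrib[of "\<lambda>x. _ * x"] sum.delta mult.assoc cong: if_cong)
  also have "(\<Sum>k<d+2. ?b k * ?a k * (of_nat (m k) - of_nat (m (k + 1)))) =
      (\<Sum>k<d. (of_nat k + 1) * (of_nat d - of_nat k) * (of_nat (m k) - of_nat (m (k + 1))))
      + of_nat (m (d + 1)) - of_nat (m (d + 2))"
    by (auto simp: numeral_2_eq_2 raise_coef_def lower_coef_def of_nat_diff mult_ac intro!: sum.cong)
  also have "\<dots> = - of_int (weight d m)"
    using sum_by_parts[of "of_nat d" "\<lambda>k. of_nat (m k) :: complex" d]
    by (simp add: weight_def sum_negf[symmetric] left_diff_distrib sum_subtractf)
  finally show ?thesis .
qed

lemma exponents_le: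
  assumes "m \<in> exponents d i R"
  shows "m k \<le> i + R"
proof -
  consider "k \<le> d" | "k = d + 1" | "k = d + 2" | "k > d + 2" by linarith
  then show ?thesis
  proof cases
    case 1
    then have "m k \<le> (\<Sum>k\<le>d. m k)" by (intro member_le_sum) auto
    then show ?thesis using assms by (simp add: exponents_def)
  qed (use assms in \<open>auto simp: exponents_def\<close>)
qed

lemma finite_exponents: "finite (exponents d i R)"
proof (rule finite_subset)
  show "exponents d i R \<subseteq> {m. \<forall>k. (k \<in> {..d+2} \<longrightarrow> m k \<in> {..i+R}) \<and> (k \<notin> {..d+2} \<longrightarrow> m k = 0)}"
    using exponents_le by (auto simp: exponents_def)
  show "finite {m. \<forall>k. (k \<in> {..d+2} \<longrightarrow> m k \<in> {..i+R}) \<and> (k \<notin> {..d+2} \<longrightarrow> m k = 0)}"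
    by (intro finite_set_of_finite_funs) auto
qed

lemma sum_fun_upd_move:
  fixes g :: "nat \<Rightarrow> int"
  assumes "finite A" "k \<noteq> l" "m k > 0"
  shows "(\<Sum>j\<in>A. g j * int ((m(k := m k - 1, l := m l + 1)) j)) =
    (\<Sum>j\<in>A. g j * int (m j)) - (if k \<in> A then g k else 0) + (if l \<in> A then g l else 0)"
proof -
  have "g j * int ((m(k := m k - 1, l := m l + 1)) j) =
      g j * int (m j) - (if j = k then g j else 0) + (if j = l then g j else 0)" for j
    using assms by (auto simp: of_nat_diff algebra_simps)
  then show ?thesis using assms(1) by (simp add: sum.distrib sum_subtractf)
qed

lemma move_up:
  assumes m: "m \<in> exponents d i R" and k: "k < d + 2" "k \<noteq> d" "m k > 0"
  defines "m' \<equiv> m(k := m k - 1, k + 1 := m (k + 1) + 1)"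
  shows "m' \<in> exponents d i R" "weight d m' = weight d m + 2"
proof -
  have s: "(\<Sum>j\<le>d. g j * int (m' j)) = 
     (\<Sum>j\<le>d. g j * int (m j)) - (if k \<le> d then g k else 0) + (if k + 1 \<le> d then g (k + 1) else 0)" for g
    unfolding m'_def using sum_fun_upd_move[of "{..d}" k "k + 1" m g] k by simp
  have "k < d \<or> k = d + 1" using k by linarith
  then show "weight d m' = weight d m + 2"
    unfolding weight_def s using k by (auto simp: m'_def of_nat_diff)
  have "int (\<Sum>j\<le>d. m' j) = int (\<Sum>j\<le>d. m j)"
    using s[of "\<lambda>_. 1"] k by auto
  then have "(\<Sum>j\<le>d. m' j) = (\<Sum>j\<le>d. m j)" by linarith
  then show "m' \<in> exponents d i R" using m k by (auto simp: exponents_def m'_def)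
qed

lemma move_down:
  assumes m: "m \<in> exponents d i R" and k: "k < d + 2" "k \<noteq> d" "m (k + 1) > 0"
  defines "m' \<equiv> m(k + 1 := m (k + 1) - 1, k := m k + 1)"
  shows "m' \<in> exponents d i R" "weight d m' = weight d m - 2"
proof -
  have s: "(\<Sum>j\<le>d. g j * int (m' j)) = 
     (\<Sum>j\<le>d. g j * int (m j)) - (if k + 1 \<le> d then g (k + 1) else 0) + (if k \<le> d then g k else 0)" for g
    unfolding m'_def using sum_fun_upd_move[of "{..d}" "k + 1" k m g] k by simp
  have "k < d \<or> k = d + 1" using k by linarith
  then show "weight d m' = weight d m - 2"
    unfolding weight_def s using k by (auto simp: m'_def of_nat_diff)
  have "int (\<Sum>j\<le>d. m' j) = int (\<Sum>j\<le>d. m j)"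
    using s[of "\<lambda>_. 1"] k by auto
  then have "(\<Sum>j\<le>d. m' j) = (\<Sum>j\<le>d. m j)" by linarith
  then show "m' \<in> exponents d i R" using m k by (auto simp: exponents_def m'_def)
qed

lemma raise_nonzeroD:
  assumes supp: "\<And>m. c m \<noteq> 0 \<Longrightarrow> m \<in> exponents d i R" and "raise d c m \<noteq> 0"
  obtains m' where "c m' \<noteq> 0" "m \<in> exponents d i R" "weight d m = weight d m' + 2"
proof -
  obtain k where k: "k < d + 2" "of_nat (raise_coef d k) * xder (k + 1) k c m \<noteq> 0"
    using assms(2) unfolding raise_def by (meson lessThan_iff sum.not_neutral_contains_not_neutral)
  let ?m = "m(k + 1 := m (k + 1) - 1, k := m k + 1)"
  have kd: "k \<noteq> d" and mk: "m (k + 1) > 0" and nz: "c ?m \<noteq> 0"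
    using k(2) by (auto simp: raise_coef_def xder_def split: if_splits)
  have "?m(k := ?m k - 1, k + 1 := ?m (k + 1) + 1) = m" using mk by auto
  then show ?thesis using move_up[of ?m d i R k] supp[OF nz] k(1) kd that[OF nz] by simp
qed

lemma raise_weight_space:
  assumes "c \<in> weight_space d i R w"
  shows "raise d c \<in> weight_space d i R (w + 2)"
proof -
  have supp: "m \<in> exponents d i R" "weight d m = w" if "c m \<noteq> 0" for m
    using assms that by (auto simp: weight_space_def)
  have "m \<in> exponents d i R \<and> weight d m = w + 2" if "raise d c m \<noteq> 0" for m
    by (rule raise_nonzeroD[OF supp(1) that]) (auto dest: supp(2))
  then show ?thesis by (auto simp: weight_space_def)
qed

lemma lower_nonzeroD:
  assumes supp: "\<And>m. c m \<noteq> 0 \<Longrightarrow> m \<in> exponents d i R" and "lower d c m \<noteq> 0"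
  obtains m' where "c m' \<noteq> 0" "m \<in> exponents d i R" "weight d m = weight d m' - 2"
proof -
  obtain k where k: "k < d + 2" "of_nat (lower_coef d k) * xder k (k + 1) c m \<noteq> 0"
    using assms(2) unfolding lower_def by (meson lessThan_iff sum.not_neutral_contains_not_neutral)
  let ?m = "m(k := m k - 1, k + 1 := m (k + 1) + 1)"
  have kd: "k \<noteq> d" and mk: "m k > 0" and nz: "c ?m \<noteq> 0"
    using k(2) by (auto simp: lower_coef_def xder_def split: if_splits)
  have "?m(k + 1 := ?m (k + 1) - 1, k := ?m k + 1) = m" using mk by auto
  then show ?thesis using move_down[of ?m d i R k] supp[OF nz] k(1) kd that[OF nz] by simp
qed

lemma lower_weight_space:
  assumes "c \<in> weight_space d i R w"
  shows "lower d c \<in> weight_space d i R (w - 2)"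
proof -
  have supp: "m \<in> exponents d i R" "weight d m = w" if "c m \<noteq> 0" for m
    using assms that by (auto simp: weight_space_def)
  have "m \<in> exponents d i R \<and> weight d m = w - 2" if "lower d c m \<noteq> 0" for m
    by (rule lower_nonzeroD[OF supp(1) that]) (auto dest: supp(2))
  then show ?thesis by (auto simp: weight_space_def)
qed

text \<open>
The squared length of a monomial for the inner product that is invariant under the unitary
subgroup. The factor \<open>d choose k\<close> compensates for writing the coefficients of a form without
binomial factors; it is what makes \<open>lower\<close> the adjoint of \<open>raise\<close>.
\<close>

definition mon_norm :: "nat \<Rightarrow> (nat \<Rightarrow> nat) \<Rightarrow> real" where
  "mon_norm d m = (\<Prod>k\<le>d+2. fact (m k) * (if k \<le> d then real (d choose k) else 1) ^ m k)"

definition herm :: "nat \<Rightarrow> nat \<Rightarrow> nat \<Rightarrow> ((nat \<Rightarrow> nat) \<Rightarrow> complex) \<Rightarrow> ((nat \<Rightarrow> nat) \<Rightarrow> complex) \<Rightarrow> complex" where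
  "herm d i R c c' = (\<Sum>m\<in>exponents d i R. of_real (mon_norm d m) * c m * cnj (c' m))"

lemma mon_norm_pos: "mon_norm d m > 0"
  unfolding mon_norm_def by (intro prod_pos) auto

lemma mon_norm_move:
  assumes k: "k < d + 2" "m k > 0"
  shows "raise_coef d k * mon_norm d (m(k := m k - 1, k + 1 := m (k + 1) + 1)) * m k
       = lower_coef d k * mon_norm d m * (m (k + 1) + 1)"
proof -
  let ?l = "\<lambda>k. if k \<le> d then real (d choose k) else 1"
  let ?f = "\<lambda>m k. fact (m k) * ?l k ^ m k"
  let ?m = "m(k := m k - 1, k + 1 := m (k + 1) + 1)"
  have split: "mon_norm d m = ?f m k * ?f m (k + 1) * (\<Prod>j\<in>{..d+2} - {k} - {k + 1}. ?f m j)" for m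
  proof -
    have "mon_norm d m = ?f m k * (\<Prod>j\<in>{..d+2} - {k}. ?f m j)"
      unfolding mon_norm_def by (rule prod.remove) (use k in auto)
    also have "(\<Prod>j\<in>{..d+2} - {k}. ?f m j) = ?f m (k + 1) * (\<Prod>j\<in>{..d+2} - {k} - {k + 1}. ?f m j)"
      by (rule prod.remove) (use k in auto)
    finally show ?thesis by (simp add: mult_ac)
  qed
  have rest: "(\<Prod>j\<in>{..d+2} - {k} - {k + 1}. ?f ?m j) = (\<Prod>j\<in>{..d+2} - {k} - {k + 1}. ?f m j)"
    by (intro prod.cong) auto
  have rel: "raise_coef d k * ?l (k + 1) = lower_coef d k * ?l k"
  proof -
    consider "k < d" | "k = d" | "k = d + 1" using k by linarith
    then show ?thesis
    proof cases
      case 1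
      then have "real (Suc k * (d choose Suc k)) = real ((d - k) * (d choose k))"
        by (metis Suc_leI Suc_times_binomial_add binomial_absorb_comp binomial_absorption diff_Suc_1 mult.commute)
      then show ?thesis using 1 by (simp add: raise_coef_def lower_coef_def distrib_right)
    qed (auto simp: raise_coef_def lower_coef_def)
  qed
  obtain n where n: "m k = Suc n" using k(2) gr0_implies_Suc by blast
  have 1: "?f m k = (real n + 1) * ?l k * (fact n * ?l k ^ n)" by (simp add: n)
  have 2: "?f ?m (k + 1) = (real (m (k + 1)) + 1) * ?l (k + 1) * ?f m (k + 1)" by simp
  have 3: "?f ?m k = fact n * ?l k ^ n" by (simp add: n)
  have 4: "real (m k) = real n + 1" "real (m (k + 1) + 1) = real (m (k + 1)) + 1" by (simp_all add: n)
  have "a * (x * (q * l' * f) * P) * p = b * (p * l * x * f * P) * q" if "a * l' = b * l"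
    for a b x q l l' f P p :: real
    using that by algebra
  from this[OF rel] show ?thesis
    unfolding split rest 1 2 3 4 .
qed

text \<open>
Monomial by monomial, adjointness is the identity \<open>mon_norm_move\<close> between the lengths of two monomials
that differ by one move.
\<close>

lemma herm_raise:
  "herm d i R (raise d c) c' = herm d i R c (lower d c')"
proof -
  let ?I = "exponents d i R" and ?w = "\<lambda>m. complex_of_real (mon_norm d m)"
  have fin: "finite ?I" by (rule finite_exponents)
  have "(\<Sum>m\<in>?I. of_nat (raise_coef d k) * (?w m * xder (k + 1) k c m * cnj (c' m)))
      = (\<Sum>m\<in>?I. of_nat (lower_coef d k) * (?w m * c m * cnj (xder k (k + 1) c' m)))" if k: "k < d + 2" for k
  proof (cases "k = d")
    case True
    then show ?thesis by (simp add: raise_coef_def lower_coef_def)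
  next
    case False
    let ?h = "\<lambda>m m'. of_nat (raise_coef d k) * (?w m * (of_nat (m k + 1) * c m') * cnj (c' m))"
    have "(\<Sum>m\<in>?I. of_nat (raise_coef d k) * (?w m * xder (k + 1) k c m * cnj (c' m)))
        = (\<Sum>m | m \<in> ?I \<and> m (k + 1) > 0. ?h m (m(k + 1 := m (k + 1) - 1, k := m k + 1)))"
      using fin by (intro sum.mono_neutral_cong_right) (auto simp: xder_def)
    also have "\<dots> = (\<Sum>m | m \<in> ?I \<and> m k > 0. ?h (m(k := m k - 1, k + 1 := m (k + 1) + 1)) m)"
      by (rule sum_move) (use move_up move_down k False in auto)
    also have "\<dots> = (\<Sum>m\<in>?I. of_nat (lower_coef d k) * (?w m * c m * cnj (xder k (k + 1) c' m)))"
    proof (rule sum.mono_neutral_cong_left)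
      fix m assume m: "m \<in> {m. m \<in> ?I \<and> m k > 0}"
      let ?m = "m(k := m k - 1, k + 1 := m (k + 1) + 1)"
      have "complex_of_real (raise_coef d k * mon_norm d ?m * m k)
          = complex_of_real (lower_coef d k * mon_norm d m * (m (k + 1) + 1))"
        using mon_norm_move[OF k, of m] m by simp
      then show "?h ?m m = of_nat (lower_coef d k) * (?w m * c m * cnj (xder k (k + 1) c' m))"
        using m by (simp add: xder_def mult_ac)
    qed (use fin in \<open>auto simp: xder_def\<close>)
    finally show ?thesis .
  qed
  then have "(\<Sum>k<d+2. \<Sum>m\<in>?I. of_nat (raise_coef d k) * (?w m * xder (k + 1) k c m * cnj (c' m)))
      = (\<Sum>k<d+2. \<Sum>m\<in>?I. of_nat (lower_coef d k) * (?w m * c m * cnj (xder k (k + 1) c' m)))"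
    by (rule sum.cong[OF refl]) (simp only: lessThan_iff)
  moreover have "herm d i R (raise d c) c' =
      (\<Sum>k<d+2. \<Sum>m\<in>?I. of_nat (raise_coef d k) * (?w m * xder (k + 1) k c m * cnj (c' m)))"
    unfolding herm_def raise_def by (subst sum.swap) (simp only: sum_distrib_left sum_distrib_right mult_ac)
  moreover have "herm d i R c (lower d c') =
      (\<Sum>k<d+2. \<Sum>m\<in>?I. of_nat (lower_coef d k) * (?w m * c m * cnj (xder k (k + 1) c' m)))"
    unfolding herm_def lower_def cnj_sum complex_cnj_mult complex_cnj_of_nat
    by (subst sum.swap) (simp only: sum_distrib_left sum_distrib_right mult_ac)
  ultimately show ?thesis by simp
qed

section \<open>The invariants of weight zero\<close>

definition weight_count :: "nat \<Rightarrow> nat \<Rightarrow> nat \<Rightarrow> int \<Rightarrow> nat" where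
  "weight_count d i R w = card {m \<in> exponents d i R. weight d m = w}"

lemma weight_space_eq: "weight_space d i R w = {c. \<forall>m. c m \<noteq> 0 \<longrightarrow> m \<in> {m \<in> exponents d i R. weight d m = w}}"
  by (simp add: weight_space_def)

lemma dim_weight_space: "cfun.dim (weight_space d i R w) = weight_count d i R w"
  unfolding weight_space_eq weight_count_def by (rule dim_functions_on) (simp add: finite_exponents)

lemma weight_space_finite_span: "\<exists>W. finite W \<and> weight_space d i R w \<subseteq> cfun.span W"
  unfolding weight_space_eq by (rule functions_on_finite_span) (simp add: finite_exponents)

lemma subspace_weight_space: "cfun.subspace (weight_space d i R w)"
  unfolding cfun.subspace_def weight_space_def by (auto simp: plus_fun_def) (metis add.right_neutral)+

definition norm_sq :: "nat \<Rightarrow> nat \<Rightarrow> nat \<Rightarrow> ((nat \<Rightarrow> nat) \<Rightarrow> complex) \<Rightarrow> real" where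
  "norm_sq d i R c = (\<Sum>m\<in>exponents d i R. mon_norm d m * (cmod (c m))\<^sup>2)"

lemma herm_self: "herm d i R c c = of_real (norm_sq d i R c)"
  unfolding herm_def norm_sq_def of_real_sum of_real_mult complex_norm_square by (simp only: mult.assoc)

lemma norm_sq_nonneg: "norm_sq d i R c \<ge> 0"
  unfolding norm_sq_def by (intro sum_nonneg) (simp add: mon_norm_pos less_imp_le)

lemma norm_sq_eq_0D:
  assumes "norm_sq d i R c = 0" and "c \<in> weight_space d i R w"
  shows "c = 0"
proof
  fix m
  have "mon_norm d m * (cmod (c m))\<^sup>2 = 0" if "m \<in> exponents d i R"
    using assms(1) that unfolding norm_sq_def
    by (subst (asm) sum_nonneg_eq_0_iff) (auto simp: finite_exponents mon_norm_pos less_imp_le)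
  then show "c m = 0 m"
    using assms(2) mon_norm_pos[of d m] by (force simp: weight_space_def)
qed

lemma norm_sq_zero: "norm_sq d i R 0 = 0"
  by (simp add: norm_sq_def)

lemma herm_lower: "herm d i R c (raise d c') = herm d i R (lower d c) c'"
proof -
  have "herm d i R c (raise d c') = cnj (herm d i R (raise d c') c)"
    by (simp add: herm_def cnj_sum mult_ac)
  also have "\<dots> = herm d i R (lower d c) c'"
    unfolding herm_raise by (simp add: herm_def cnj_sum mult_ac)
  finally show ?thesis .
qed

text \<open>
The commutator relation paired with \<open>c\<close> itself. Positivity of the two norms replaces the
representation theory of \<open>SL2\<close> in all that follows.
\<close>

lemma norm_sq_raise:
  assumes c: "c \<in> weight_space d i R w"
  shows "norm_sq d i R (raise d c) = norm_sq d i R (lower d c) - of_int w * norm_sq d i R c"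
proof -
  have "lower d (raise d c) = (\<lambda>m. raise d (lower d c) m - of_int w * c m)"
  proof
    fix m show "lower d (raise d c) m = raise d (lower d c) m - of_int w * c m"
    using raise_lower_commutator[of d c m] c by (cases "c m = 0") (auto simp: weight_space_def algebra_simps)
  qed
  then have "herm d i R c (lower d (raise d c)) = herm d i R c (raise d (lower d c)) - of_int w * herm d i R c c"
    unfolding herm_def by (simp add: algebra_simps sum_subtractf sum_distrib_left)
  then have "herm d i R (raise d c) (raise d c) = herm d i R (lower d c) (lower d c) - of_int w * herm d i R c c"
    by (simp add: herm_raise[of _ _ _ c] herm_lower[of _ _ _ c])
  then have "complex_of_real (norm_sq d i R (raise d c)) = 
      complex_of_real (norm_sq d i R (lower d c) - of_int w * norm_sq d i R c)"
    by (simp add: herm_self)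
  then show ?thesis unfolding of_real_eq_iff .
qed

text \<open>
At weight \<open>0\<close> the two norms in \<open>norm_sq_raise\<close> agree. This is what reduces invariance
under the whole group to a single linear condition.
\<close>

lemma raise_eq_0_iff_lower_eq_0:
  assumes "c \<in> weight_space d i R 0"
  shows "raise d c = 0 \<longleftrightarrow> lower d c = 0"
  using norm_sq_raise[OF assms] norm_sq_zero[of d i R]
    norm_sq_eq_0D[OF _ raise_weight_space[OF assms]] norm_sq_eq_0D[OF _ lower_weight_space[OF assms]]
  by auto

lemma raise_lower_inj:
  assumes c: "c \<in> weight_space d i R 2" and 0: "raise d (lower d c) = 0"
  shows "c = 0"
proof -
  have "herm d i R (lower d c) (lower d c) = herm d i R (raise d (lower d c)) c"
    by (simp add: herm_raise)
  then have "norm_sq d i R (lower d c) = 0"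
    by (simp add: 0 herm_self) (simp add: herm_def)
  then have "norm_sq d i R (raise d c) + 2 * norm_sq d i R c = 0"
    using norm_sq_raise[OF c] by simp
  then have "norm_sq d i R c = 0"
    using norm_sq_nonneg[of d i R c] norm_sq_nonneg[of d i R "raise d c"] by linarith
  then show ?thesis using norm_sq_eq_0D c by blast
qed

text \<open>
Coefficient functions of invariant polynomials; by \<open>raise_eq_0_iff_lower_eq_0\<close> they are
killed by \<open>lower\<close> as well.
\<close>

definition invariant_coeffs :: "nat \<Rightarrow> nat \<Rightarrow> nat \<Rightarrow> ((nat \<Rightarrow> nat) \<Rightarrow> complex) set" where
  "invariant_coeffs d i R = {c \<in> weight_space d i R 0. raise d c = 0}"

lemma subspace_invariant_coeffs: "cfun.subspace (invariant_coeffs d i R)"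
proof -
  have "invariant_coeffs d i R = weight_space d i R 0 \<inter> {c. raise d c = 0}"
    by (auto simp: invariant_coeffs_def)
  then show ?thesis
    by (simp add: cfun.subspace_inter subspace_weight_space
        module_hom.subspace_kernel[OF Vector_Spaces.linear.axioms(3)[OF linear_raise]])
qed

text \<open>
It is enough to hit weight \<open>2\<close> from the image of \<open>lower\<close>: there \<open>raise \<circ> lower\<close> is an injective
endomorphism of a finite-dimensional space, hence onto.
\<close>

lemma raise_image: "raise d ` weight_space d i R 0 = weight_space d i R 2"
proof -
  let ?T = "weight_space d i R 2" and ?f = "raise d \<circ> lower d"
  obtain W where W: "finite W" "?T \<subseteq> cfun.span W" using weight_space_finite_span by blast
  have f: "Vector_Spaces.linear (\<lambda>z c m. z * c m) (\<lambda>z c m. z * c m) ?f"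
    by (rule Vector_Spaces.linear_compose[OF linear_lower linear_raise])
  have up: "raise d ` weight_space d i R 0 \<subseteq> ?T"
    using raise_weight_space[of _ d i R 0] by auto
  have low: "lower d ` ?T \<subseteq> weight_space d i R 0"
    using lower_weight_space[of _ d i R 2] by auto
  have "?f 0 = 0"
    by (rule module_hom.zero[OF Vector_Spaces.linear.axioms(3)[OF f]])
  then have "{c \<in> ?T. ?f c = 0} = {0}"
    using raise_lower_inj[of _ d i R] cfun.subspace_0[OF subspace_weight_space] by auto
  then have "cfun.dim ?T = cfun.dim (?f ` ?T)"
    using vector_space_pair.rank_nullity[OF cfun_pair f subspace_weight_space W] dim_zero_space by simp
  then have "?f ` ?T = ?T"
    using up low W
    by (intro cfun.subspace_eq_if_dim_eq[where W=W] module_hom.subspace_image[OF Vector_Spaces.linear.axioms(3)[OF f]]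
          subspace_weight_space) (auto simp: image_subset_iff)
  then have "?T = raise d ` (lower d ` ?T)" by (simp only: image_comp)
  also have "\<dots> \<subseteq> raise d ` weight_space d i R 0" by (rule image_mono[OF low])
  finally show ?thesis using up by blast
qed

lemma dim_invariant_coeffs:
  "cfun.dim (invariant_coeffs d i R) + weight_count d i R 2 = weight_count d i R 0"
proof -
  obtain W where W: "finite W" "weight_space d i R 0 \<subseteq> cfun.span W" using weight_space_finite_span by blast
  show ?thesis
    using vector_space_pair.rank_nullity[OF cfun_pair linear_raise subspace_weight_space W, of d]
    by (simp add: raise_image dim_weight_space invariant_coeffs_def)
qed

section \<open>Counting the invariants\<close>

definition degree_exps :: "nat \<Rightarrow> nat \<Rightarrow> (nat \<Rightarrow> nat) set" where
  "degree_exps d i = {m. (\<forall>k>d. m k = 0) \<and> (\<Sum>k\<le>d. m k) = i}"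

text \<open>
If \<open>m\<close> has total degree \<open>i\<close>, then reading \<open>m k\<close> as the multiplicity of the part \<open>k\<close> makes it
a partition of this number into at most \<open>i\<close> parts of size at most \<open>d\<close>. So \<open>box_count d i\<close>
lists the coefficients of a Gaussian binomial coefficient.
\<close>

definition index_sum :: "nat \<Rightarrow> (nat \<Rightarrow> nat) \<Rightarrow> nat" where
  "index_sum d m = (\<Sum>k\<le>d. k * m k)"

definition box_count :: "nat \<Rightarrow> nat \<Rightarrow> nat \<Rightarrow> nat" where
  "box_count d i h = card {m \<in> degree_exps d i. index_sum d m = h}"

lemma finite_degree_exps: "finite (degree_exps d i)"
proof (rule finite_subset)
  show "degree_exps d i \<subseteq> {m. \<forall>k. (k \<in> {..d} \<longrightarrow> m k \<in> {..i}) \<and> (k \<notin> {..d} \<longrightarrow> m k = 0)}"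
  proof (intro subsetI CollectI allI conjI impI)
    fix m k assume m: "m \<in> degree_exps d i"
    show "m k = 0" if "k \<notin> {..d}" using m that by (auto simp: degree_exps_def)
    show "m k \<in> {..i}" if "k \<in> {..d}"
      using m that member_le_sum[of k "{..d}" m] by (auto simp: degree_exps_def)
  qed
  show "finite {m. \<forall>k. (k \<in> {..d} \<longrightarrow> m k \<in> {..i}) \<and> (k \<notin> {..d} \<longrightarrow> m k = 0)}"
    by (intro finite_set_of_finite_funs) auto
qed

lemma index_sum_le:
  assumes "m \<in> degree_exps d i"
  shows "index_sum d m \<le> d * i"
proof -
  have "index_sum d m \<le> (\<Sum>k\<le>d. d * m k)" unfolding index_sum_def by (intro sum_mono) auto
  then show ?thesis using assms by (simp add: degree_exps_def sum_distrib_left[symmetric])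
qed

text \<open>
The multiplicity of the torus weight \<open>j\<close> among the monomials of degree \<open>i\<close> in the coefficients of the \<open>d\<close>-form
alone.
\<close>

definition excess_count :: "nat \<Rightarrow> nat \<Rightarrow> int \<Rightarrow> nat" where
  "excess_count d i j = card {m \<in> degree_exps d i. 2 * int (index_sum d m) - int (d * i) = j}"

text \<open>
The monomials are sorted by their degree \<open>n\<close> in the coordinates of the linear form and by
the exponent \<open>e\<close> of its first coordinate.
\<close>

lemma weight_count_eq:
  "weight_count d i R w = (\<Sum>n\<le>R. \<Sum>e\<le>n. excess_count d i (w + 2 * int e - int n))"
proof -
  let ?Q = "\<lambda>j. {m \<in> degree_exps d i. 2 * int (index_sum d m) - int (d * i) = j}"
  let ?S = "SIGMA n:{..R}. SIGMA e:{..n}. ?Q (w + 2 * int e - int n)"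
  have weight: "weight d m = 2 * int (index_sum d m) - int (d * (\<Sum>k\<le>d. m k)) - int (m (d + 1)) + int (m (d + 2))" for m
    unfolding weight_def index_sum_def by (simp add: left_diff_distrib sum_subtractf sum_distrib_left mult.assoc)
  have cong: "index_sum d m = index_sum d m'" "sum m {..d} = sum m' {..d}" if "\<And>k. k \<le> d \<Longrightarrow> m k = m' k" for m m'
    using that unfolding index_sum_def by (auto intro!: sum.cong)
  define to where "to m = (m (d + 1) + m (d + 2), m (d + 1), \<lambda>k. if k \<le> d then m k else 0)" for m :: "nat \<Rightarrow> nat"
  define glue where "glue y = (case y of (n, e, m) \<Rightarrow> m(d + 1 := e, d + 2 := n - e))" for y :: "nat \<times> nat \<times> (nat \<Rightarrow> nat)"
  have "bij_betw to {m \<in> exponents d i R. weight d m = w} ?S"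
  proof (rule bij_betw_byWitness[where f' = "glue"])
    show "\<forall>m\<in>{m \<in> exponents d i R. weight d m = w}. glue (to m) = m"
    proof
      fix m assume "m \<in> {m \<in> exponents d i R. weight d m = w}"
      then have m: "m \<in> exponents d i R" by simp
      have "m k = 0" if "\<not> k \<le> d" "k \<noteq> d + 1" "k \<noteq> d + 2" for k
      proof -
        have "k > d + 2" using that by linarith
        then show ?thesis using m by (simp add: exponents_def)
      qed
      then show "glue (to m) = m" by (auto simp: fun_eq_iff glue_def to_def)
    qed
    show "\<forall>y\<in>?S. to (glue y) = y"
      by (auto simp: fun_eq_iff degree_exps_def glue_def to_def)
    show "to ` {m \<in> exponents d i R. weight d m = w} \<subseteq> ?S"
    proof (rule image_subsetI)
      fix m assume "m \<in> {m \<in> exponents d i R. weight d m = w}"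
      then have m: "m \<in> exponents d i R" "weight d m = w" by auto
      let ?m = "\<lambda>k. if k \<le> d then m k else 0"
      have "index_sum d ?m = index_sum d m" "sum ?m {..d} = sum m {..d}" by (rule cong; simp)+
      then show "to m \<in> ?S"
        using m weight[of m] by (auto simp: exponents_def degree_exps_def to_def)
    qed
    show "glue ` ?S \<subseteq> {m \<in> exponents d i R. weight d m = w}"
    proof (rule image_subsetI)
      fix y assume "y \<in> ?S"
      then obtain n e m where y: "y = (n, e, m)" and n: "n \<le> R" and e: "e \<le> n" and m: "m \<in> degree_exps d i"
        "2 * int (index_sum d m) - int (d * i) = w + 2 * int e - int n" by auto
      let ?m = "m(d + 1 := e, d + 2 := n - e)"
      have c: "index_sum d ?m = index_sum d m" "sum ?m {..d} = sum m {..d}" by (rule cong; simp)+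
      have "?m \<in> exponents d i R" using m(1) n e c(2) by (auto simp: exponents_def degree_exps_def)
      moreover have "weight d ?m = w" unfolding weight c using m e by (simp add: degree_exps_def of_nat_diff)
      ultimately show "glue y \<in> {m \<in> exponents d i R. weight d m = w}" by (simp add: y glue_def)
    qed
  qed
  then have "weight_count d i R w = card ?S"
    unfolding weight_count_def by (rule bij_betw_same_card)
  also have "\<dots> = (\<Sum>n\<le>R. \<Sum>e\<le>n. excess_count d i (w + 2 * int e - int n))"
    unfolding excess_count_def using finite_degree_exps by (simp add: card_SigmaI)
  finally show ?thesis .
qed

lemma sum_reflect: "(\<Sum>k\<le>d. g (d - k)) = (\<Sum>k\<le>d. g (k::nat))" for g :: "nat \<Rightarrow> 'a :: comm_monoid_add"
  by (rule sum.reindex_bij_witness[of _ "\<lambda>k. d - k" "\<lambda>k. d - k"]) auto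

text \<open>
Exchanging \<open>x\<close> and \<open>y\<close> in the form, that is, reading its coefficients backwards, negates the weight.
\<close>

lemma excess_count_minus: "excess_count d i (- j) = excess_count d i j"
proof -
  let ?r = "\<lambda>m k. if k \<le> d then m (d - k) else (0::nat)"
  have sum: "(\<Sum>k\<le>d. ?r m k) = (\<Sum>k\<le>d. m k)" for m
    using sum_reflect[of m d] by simp
  have "index_sum d (?r m) = (\<Sum>k\<le>d. (d - k) * m k)" for m
    unfolding index_sum_def using sum_reflect[of "\<lambda>k. (d - k) * m k" d] by simp
  then have "index_sum d (?r m) + index_sum d m = (\<Sum>k\<le>d. (d - k) * m k + k * m k)" for m
    by (simp add: index_sum_def sum.distrib)
  also have "(\<Sum>k\<le>d. (d - k) * m k + k * m k) = d * (\<Sum>k\<le>d. m k)" for m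
    by (simp add: sum_distrib_left flip: add_mult_distrib)
  finally have "index_sum d (?r m) + index_sum d m = d * i" if "m \<in> degree_exps d i" for m
    using that by (simp add: degree_exps_def)
  then have idx: "int (index_sum d (?r m)) = int (d * i) - int (index_sum d m)" if "m \<in> degree_exps d i" for m
    using that by (simp flip: of_nat_add add: eq_diff_eq)
  have deg: "?r m \<in> degree_exps d i" if "m \<in> degree_exps d i" for m
    using that sum[of m] by (simp add: degree_exps_def)
  show ?thesis unfolding excess_count_def
  proof (rule bij_betw_same_card[of ?r], rule bij_betw_byWitness[where f' = ?r])
    have "?r (?r m) = m" if "m \<in> degree_exps d i" for m
      using that by (auto simp: fun_eq_iff degree_exps_def)
    then show "\<forall>m\<in>{m \<in> degree_exps d i. 2 * int (index_sum d m) - int (d * i) = - j}. ?r (?r m) = m"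
      "\<forall>m\<in>{m \<in> degree_exps d i. 2 * int (index_sum d m) - int (d * i) = j}. ?r (?r m) = m" by blast+
    have "?r m \<in> {m \<in> degree_exps d i. 2 * int (index_sum d m) - int (d * i) = - l}"
      if "m \<in> {m \<in> degree_exps d i. 2 * int (index_sum d m) - int (d * i) = l}" for m l
      using that idx[of m] deg[of m] by simp
    from this[of _ j] this[of _ "- j"]
    show "?r ` {m \<in> degree_exps d i. 2 * int (index_sum d m) - int (d * i) = - j} \<subseteq> {m \<in> degree_exps d i. 2 * int (index_sum d m) - int (d * i) = j}"
      "?r ` {m \<in> degree_exps d i. 2 * int (index_sum d m) - int (d * i) = j} \<subseteq> {m \<in> degree_exps d i. 2 * int (index_sum d m) - int (d * i) = - j}"
      unfolding image_subset_iff minus_minus by blast+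
  qed
qed

text \<open>
For fixed degree \<open>n\<close> in the linear form the difference of the numbers of monomials of weights
\<open>0\<close> and \<open>2\<close> is \<open>excess_count d i n - excess_count d i (n + 2)\<close>; the sum over \<open>n \<le> R\<close> telescopes
once more. As a dimension is not negative, the equation also bounds the multiplicities for large
weights by those for the weights \<open>0\<close> and \<open>1\<close>.
\<close>

lemma invariant_coeffs_telescope:
  "cfun.dim (invariant_coeffs d i R) + (excess_count d i (int R + 1) + excess_count d i (int R + 2))
    = excess_count d i 0 + excess_count d i 1"
proof -
  let ?q = "\<lambda>n. excess_count d i (int n)"
  have "(\<Sum>e\<le>n. excess_count d i (0 + 2 * int e - int n)) + ?q (n + 2) =
        ?q n + (\<Sum>e\<le>n. excess_count d i (2 + 2 * int e - int n))" for n
  proof -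
    let ?f = "\<lambda>e. excess_count d i (2 * int e - int n)"
    have "sum ?f {..n} + ?f (Suc n) = ?f 0 + (\<Sum>e\<le>n. ?f (Suc e))"
      using sum.atMost_Suc_shift[of ?f n] by simp
    then show ?thesis by (simp add: excess_count_minus add_ac algebra_simps)
  qed
  then have "(\<Sum>n\<le>R. (\<Sum>e\<le>n. excess_count d i (0 + 2 * int e - int n)) + ?q (n + 2)) =
     (\<Sum>n\<le>R. ?q n + (\<Sum>e\<le>n. excess_count d i (2 + 2 * int e - int n)))"
    by (intro sum.cong) auto
  then have "weight_count d i R 0 + (\<Sum>n\<le>R. ?q (n + 2)) = (\<Sum>n\<le>R. ?q n) + weight_count d i R 2"
    unfolding weight_count_eq sum.distrib .
  moreover have "(\<Sum>n\<le>R. ?q n) + ?q (R + 1) + ?q (R + 2) = ?q 0 + ?q 1 + (\<Sum>n\<le>R. ?q (n + 2))"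
    by (induction R) simp_all
  ultimately show ?thesis using dim_invariant_coeffs[of d i R] by (simp add: add_ac)
qed

lemma excess_count_eq_0:
  assumes "j > int (d * i)"
  shows "excess_count d i j = 0"
proof -
  have "{m \<in> degree_exps d i. 2 * int (index_sum d m) - int (d * i) = j} = {}"
    using assms index_sum_le by (force simp flip: of_nat_le_iff[where 'a=int])
  then show ?thesis unfolding excess_count_def by (simp only: card.empty)
qed

lemma excess_count_box_count: "excess_count d i (2 * int h - int (d * i)) = box_count d i h"
  unfolding excess_count_def box_count_def by (rule arg_cong[of _ _ card]) auto

text \<open>
All weights have the parity of \<open>d * i\<close>, so only one of the two summands can be nonzero.
\<close>

lemma excess_count_middle: "excess_count d i 0 + excess_count d i 1 = box_count d i ((d * i + 1) div 2)"
proof -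
  let ?h = "(d * i + 1) div 2"
  have odd_empty: "excess_count d i j = 0" if "odd (j + int (d * i))" for j
  proof -
    have "{m \<in> degree_exps d i. 2 * int (index_sum d m) - int (d * i) = j} = {}" using that by auto
    then show ?thesis unfolding excess_count_def by (simp only: card.empty)
  qed
  show ?thesis
  proof (cases "even (d * i)")
    case True
    moreover have "2 * int ((x + 1) div 2) - int x = 0" if "even x" for x :: nat
      using that by (auto elim!: evenE)
    ultimately have "2 * int ?h - int (d * i) = 0" by blast
    then show ?thesis using excess_count_box_count[of d i ?h] odd_empty[of 1] True by simp
  next
    case False
    moreover have "2 * int ((x + 1) div 2) - int x = 1" if "odd x" for x :: nat
      using that by (auto elim!: oddE)
    ultimately have "2 * int ?h - int (d * i) = 1" by blast
    then show ?thesis using excess_count_box_count[of d i ?h] odd_empty[of 0] False by simp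
  qed
qed

lemma dim_invariant_coeffs_stable:
  assumes "R \<ge> d * i"
  shows "cfun.dim (invariant_coeffs d i R) = box_count d i ((d * i + 1) div 2)"
proof -
  have "int R \<ge> int (d * i)" using assms by (simp only: of_nat_le_iff)
  then show ?thesis
    using invariant_coeffs_telescope[of d i R] excess_count_eq_0[of d i] excess_count_middle[of d i] by simp
qed

text \<open>
If the weight that belongs to \<open>h\<close> is not \<open>0\<close>, it may by symmetry be taken positive, say \<open>R + 1\<close>, and then
\<open>invariant_coeffs_telescope\<close> bounds its multiplicity.
\<close>

lemma box_count_le_middle: "box_count d i h \<le> box_count d i ((d * i + 1) div 2)"
proof -
  define j where "j = \<bar>2 * int h - int (d * i)\<bar>"
  have "box_count d i h = excess_count d i j"
    using excess_count_box_count[of d i h] excess_count_minus[of d i "2 * int h - int (d * i)"] unfolding j_def by (auto simp: abs_if)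
  also have "\<dots> \<le> excess_count d i 0 + excess_count d i 1"
  proof (cases "j = 0")
    case False
    then have "j = int (nat (j - 1)) + 1" by (simp add: j_def)
    then show ?thesis using invariant_coeffs_telescope[of d i "nat (j - 1)"] by simp
  qed simp
  finally show ?thesis by (simp add: excess_count_middle)
qed

section \<open>Polynomials as functions of the coordinates\<close>

definition mon :: "nat \<Rightarrow> (nat \<Rightarrow> nat) \<Rightarrow> (nat \<Rightarrow> complex) \<Rightarrow> complex" where
  "mon d m x = (\<Prod>k\<le>d+2. x k ^ m k)"

definition peval :: "nat \<Rightarrow> nat \<Rightarrow> nat \<Rightarrow> ((nat \<Rightarrow> nat) \<Rightarrow> complex) \<Rightarrow> (nat \<Rightarrow> complex) \<Rightarrow> complex" where
  "peval d i R c x = (\<Sum>m\<in>exponents d i R. c m * mon d m x)"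

lemma digits_less:
  assumes "\<And>k. k < n \<Longrightarrow> m k < (B::nat)"
  shows "(\<Sum>k<n. m k * B ^ k) < B ^ n"
  using assms
proof (induction n)
  case (Suc n)
  then have "(\<Sum>k<n. m k * B ^ k) < B ^ n" by simp
  moreover have "(m n + 1) * B ^ n \<le> B * B ^ n" using Suc.prems[of n] by (intro mult_right_mono) auto
  ultimately show ?case by simp
qed simp

lemma digits_unique:
  assumes "\<And>k. k < n \<Longrightarrow> m k < (B::nat)" "\<And>k. k < n \<Longrightarrow> m' k < B"
    and "(\<Sum>k<n. m k * B ^ k) = (\<Sum>k<n. m' k * B ^ k)" "k < n"
  shows "m k = m' k"
  using assms
proof (induction n arbitrary: k)
  case (Suc n)
  let ?a = "\<Sum>k<n. m k * B ^ k" and ?b = "\<Sum>k<n. m' k * B ^ k"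
  have lt: "?a < B ^ n" "?b < B ^ n" using Suc.prems by (auto intro!: digits_less)
  have eq: "?a + m n * B ^ n = ?b + m' n * B ^ n" using Suc.prems(3) by simp
  have div: "(a + q * b) div b = q" if "a < b" for a q b :: nat using that by simp
  have "(?a + m n * B ^ n) div B ^ n = m n" by (rule div[OF lt(1)])
  moreover have "(?b + m' n * B ^ n) div B ^ n = m' n" by (rule div[OF lt(2)])
  ultimately have n: "m n = m' n" using eq by simp
  have "?a = ?b" using eq n by simp
  show ?case
  proof (cases "k = n")
    case False
    then have "k < n" using Suc.prems(4) by simp
    then show ?thesis using Suc.IH[OF _ _ \<open>?a = ?b\<close>] Suc.prems(1,2) less_SucI by blast
  qed (simp add: n)
qed simp

text \<open>
Substituting \<open>t ^ B ^ k\<close> for the variable of index \<open>k\<close>, with \<open>B\<close> larger than all exponents, separates the monomials: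
their images are powers of \<open>t\<close> whose exponents have the original exponents as digits in base \<open>B\<close>.
\<close>

lemma peval_eq_0D:
  assumes "\<And>x. peval d i R c x = 0" and "m \<in> exponents d i R"
  shows "c m = 0"
proof -
  define B where "B = i + R + 1"
  define code where "code m = (\<Sum>k<d+3. m k * B ^ k)" for m :: "nat \<Rightarrow> nat"
  have inj: "inj_on code (exponents d i R)"
  proof (rule inj_onI, rule ext)
    fix m m' k
    assume m: "m \<in> exponents d i R" "m' \<in> exponents d i R" and eq: "code m = code m'"
    show "m k = m' k"
    proof (cases "k < d + 3")
      case True
      then show ?thesis
        using eq digits_unique[of "d + 3" m B m' k] exponents_le[OF m(1)] exponents_le[OF m(2)]
        by (simp add: code_def B_def less_Suc_eq_le)
    qed (use m in \<open>simp add: exponents_def\<close>)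
  qed
  define p where "p = (\<Sum>m\<in>exponents d i R. monom (c m) (code m))"
  have "mon d m (\<lambda>k. t ^ (B ^ k)) = t ^ code m" for m t
  proof -
    have "{..d+2} = {..<d+3}" by auto
    then show ?thesis by (simp add: mon_def code_def power_sum mult.commute flip: power_mult)
  qed
  then have "poly p t = peval d i R c (\<lambda>k. t ^ (B ^ k))" for t
    by (simp add: p_def peval_def poly_sum poly_monom)
  then have "p = 0" using assms(1) poly_all_0_iff_0 by metis
  moreover have "coeff p (code m) = (\<Sum>m'\<in>exponents d i R. if m' = m then c m' else 0)"
    unfolding p_def coeff_sum coeff_monom
    by (intro sum.cong refl) (use assms(2) inj in \<open>auto simp: inj_on_eq_iff\<close>)
  ultimately show ?thesis using assms(2) finite_exponents by simp
qed

lemma peval_scale: "peval d i R (\<lambda>m. z * c m) x = z * peval d i R c x"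
  by (simp add: peval_def sum_distrib_left mult.assoc)

lemma peval_sum: "peval d i R (\<lambda>m. \<Sum>k\<in>A. f k m) x = (\<Sum>k\<in>A. peval d i R (f k) x)"
  unfolding peval_def sum_distrib_right by (rule sum.swap)

text \<open>
The row of coordinates on which \<open>raise_coef\<close> and \<open>lower_coef\<close> are based.
\<close>

definition joint_coords :: "nat \<Rightarrow> coords \<Rightarrow> nat \<Rightarrow> complex" where
  "joint_coords d = (\<lambda>(u, a) k. if k \<le> d then a k else if k = d + 1 then u 0 else if k = d + 2 then u 1 else 0)"

lemma joint_coords_simps:
  "k \<le> d \<Longrightarrow> joint_coords d (u, a) k = a k"
  "joint_coords d (u, a) (d + 1) = u 0" "joint_coords d (u, a) (Suc d) = u 0"
  "joint_coords d (u, a) (d + 2) = u 1" "joint_coords d (u, a) (Suc (Suc d)) = u 1"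
  by (auto simp: joint_coords_def)

lemma mon_joint_coords: "mon d m (joint_coords d (u, a)) = u 0 ^ m (d + 1) * u 1 ^ m (d + 2) * (\<Prod>k\<le>d. a k ^ m k)"
proof -
  have "mon d m (joint_coords d (u, a)) = (\<Prod>k\<le>d. joint_coords d (u, a) k ^ m k) * u 0 ^ m (d + 1) * u 1 ^ m (d + 2)"
    unfolding mon_def by (simp add: numeral_2_eq_2 joint_coords_simps)
  also have "(\<Prod>k\<le>d. joint_coords d (u, a) k ^ m k) = (\<Prod>k\<le>d. a k ^ m k)"
    by (intro prod.cong) (auto simp: joint_coords_simps)
  finally show ?thesis by (simp add: mult_ac)
qed

lemma mem_monomials_iff:
  "f \<in> monomials d i \<longleftrightarrow> (\<exists>R. \<exists>m\<in>exponents d i R. f = (\<lambda>p. mon d m (joint_coords d p)))"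
proof
  assume "f \<in> monomials d i"
  then obtain e m where f: "f = (\<lambda>(u, a). (\<Prod>k\<le>1. u k ^ e k) * (\<Prod>k\<le>d. a k ^ m k))" and m: "(\<Sum>k\<le>d. m k) = i"
    by (auto simp: monomials_def)
  let ?m = "\<lambda>k. if k \<le> d then m k else if k = d + 1 then e 0 else if k = d + 2 then e 1 else 0"
  have "sum ?m {..d} = sum m {..d}" by (intro sum.cong) auto
  then have "?m \<in> exponents d i (e 0 + e 1)" using m by (auto simp: exponents_def)
  moreover have "f = (\<lambda>p. mon d ?m (joint_coords d p))"
  proof
    fix p :: coords obtain u a where p: "p = (u, a)" by (cases p)
    have "(\<Prod>k\<le>d. a k ^ ?m k) = (\<Prod>k\<le>d. a k ^ m k)" by (intro prod.cong) auto
    then show "f p = mon d ?m (joint_coords d p)" unfolding f p mon_joint_coords by simp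
  qed
  ultimately show "\<exists>R. \<exists>m\<in>exponents d i R. f = (\<lambda>p. mon d m (joint_coords d p))" by blast
next
  assume "\<exists>R. \<exists>m\<in>exponents d i R. f = (\<lambda>p. mon d m (joint_coords d p))"
  then obtain R m where m: "m \<in> exponents d i R" and f: "f = (\<lambda>p. mon d m (joint_coords d p))" by blast
  have "f = (\<lambda>(u, a). (\<Prod>k\<le>1. u k ^ (if k = 0 then m (d + 1) else m (d + 2))) * (\<Prod>k\<le>d. a k ^ m k))"
    unfolding f by (auto simp: fun_eq_iff mon_joint_coords)
  moreover have "(\<Sum>k\<le>d. m k) = i" using m by (simp add: exponents_def)
  ultimately show "f \<in> monomials d i" unfolding monomials_def by (intro CollectI exI conjI)
qed

lemma exponents_mono: "R \<le> R' \<Longrightarrow> exponents d i R \<subseteq> exponents d i R'"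
  by (auto simp: exponents_def)

lemma peval_mono:
  assumes "R \<le> R'" "\<And>m. c m \<noteq> 0 \<Longrightarrow> m \<in> exponents d i R"
  shows "peval d i R' c x = peval d i R c x"
  unfolding peval_def
  by (rule sum.mono_neutral_right) (use assms exponents_mono finite_exponents in \<open>auto\<close>)

lemma span_monomialsE:
  assumes "P \<in> cfun.span (monomials d i)"
  obtains R c where "\<forall>m. c m \<noteq> 0 \<longrightarrow> m \<in> exponents d i R" "P = (\<lambda>p. peval d i R c (joint_coords d p))"
proof -
  let ?Z = "{P. \<exists>R c. (\<forall>m. c m \<noteq> 0 \<longrightarrow> m \<in> exponents d i R) \<and> P = (\<lambda>p. peval d i R c (joint_coords d p))}"
  have sub: "cfun.subspace ?Z"
  proof (rule cfun.subspaceI)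
    show "0 \<in> ?Z" by (auto simp: peval_def fun_eq_iff intro!: exI[of _ 0] exI[of _ "\<lambda>_. 0"])
  next
    fix P Q assume "P \<in> ?Z" "Q \<in> ?Z"
    then obtain R c R' c' where c: "\<And>m. c m \<noteq> 0 \<Longrightarrow> m \<in> exponents d i R" "P = (\<lambda>p. peval d i R c (joint_coords d p))"
      and c': "\<And>m. c' m \<noteq> 0 \<Longrightarrow> m \<in> exponents d i R'" "Q = (\<lambda>p. peval d i R' c' (joint_coords d p))" by blast
    let ?M = "max R R'"
    have "P + Q = (\<lambda>p. peval d i ?M c (joint_coords d p) + peval d i ?M c' (joint_coords d p))"
      unfolding c(2) c'(2) using peval_mono[of R ?M c] peval_mono[of R' ?M c'] c(1) c'(1) by (auto simp: fun_eq_iff)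
    also have "\<dots> = (\<lambda>p. peval d i ?M (\<lambda>m. c m + c' m) (joint_coords d p))"
      by (simp add: peval_def sum.distrib distrib_right)
    finally have "P + Q = (\<lambda>p. peval d i ?M (\<lambda>m. c m + c' m) (joint_coords d p))" .
    moreover have "\<forall>m. c m + c' m \<noteq> 0 \<longrightarrow> m \<in> exponents d i ?M"
    proof (intro allI impI)
      fix m assume "c m + c' m \<noteq> 0"
      then have "c m \<noteq> 0 \<or> c' m \<noteq> 0" by auto
      then show "m \<in> exponents d i ?M" using c(1) c'(1) exponents_mono[of R ?M d i] exponents_mono[of R' ?M d i] by auto
    qed
    ultimately show "P + Q \<in> ?Z" by (intro CollectI exI conjI)
  next
    fix z P assume "P \<in> ?Z"
    then obtain R c where c: "\<And>m. c m \<noteq> 0 \<Longrightarrow> m \<in> exponents d i R" "P = (\<lambda>p. peval d i R c (joint_coords d p))" by blast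
    have "(\<lambda>x. z * P x) = (\<lambda>p. peval d i R (\<lambda>m. z * c m) (joint_coords d p))" unfolding c(2) peval_scale ..
    moreover have "\<forall>m. z * c m \<noteq> 0 \<longrightarrow> m \<in> exponents d i R" using c(1) by auto
    ultimately show "(\<lambda>x. z * P x) \<in> ?Z" by (intro CollectI exI conjI)
  qed
  have "monomials d i \<subseteq> ?Z"
  proof
    fix f assume "f \<in> monomials d i"
    then obtain R m where m: "m \<in> exponents d i R" and f: "f = (\<lambda>p. mon d m (joint_coords d p))"
      unfolding mem_monomials_iff by blast
    have "f = (\<lambda>p. peval d i R (\<lambda>m'. if m' = m then 1 else 0) (joint_coords d p))"
      unfolding f peval_def using m finite_exponents by (simp add: if_distribR sum.delta if_distrib[of "\<lambda>x. x * _"] cong: if_cong)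
    moreover have "\<forall>m'. (if m' = m then 1 else 0) \<noteq> (0::complex) \<longrightarrow> m' \<in> exponents d i R" using m by auto
    ultimately show "f \<in> ?Z" by (intro CollectI exI conjI)
  qed
  then have "P \<in> ?Z" using assms cfun.span_minimal[OF _ sub] by blast
  then show ?thesis using that by blast
qed

lemma peval_in_span: "(\<lambda>p. peval d i R c (joint_coords d p)) \<in> cfun.span (monomials d i)"
proof -
  have "(\<lambda>p. peval d i R c (joint_coords d p)) = (\<Sum>m\<in>exponents d i R. (\<lambda>p. c m * mon d m (joint_coords d p)))"
    by (simp add: fun_eq_iff sum_fun_apply peval_def)
  also have "\<dots> \<in> cfun.span (monomials d i)"
    by (intro cfun.span_sum cfun.span_scale cfun.span_base) (auto simp: mem_monomials_iff)
  finally show ?thesis .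
qed

lemma binary_form_inj:
  assumes "binary_form n a = binary_form n b" "k \<le> n"
  shows "a k = b k"
proof -
  have "(\<Sum>k\<le>n. a k * t ^ k) = (\<Sum>k\<le>n. b k * t ^ k)" for t
    using fun_cong[OF assms(1), of "vector [1, t]"] by (simp add: binary_form_def)
  then show ?thesis using assms(2) polyfun_eq_coeffs[of a n b] by blast
qed

definition coef :: "nat \<Rightarrow> cform \<Rightarrow> nat \<Rightarrow> complex" where
  "coef n f = (SOME a. binary_form n a = f)"

lemma binary_form_coef: "f \<in> V n \<Longrightarrow> binary_form n (coef n f) = f"
  unfolding coef_def by (rule someI_ex[of "\<lambda>a. binary_form n a = f"]) (auto simp: V_def)

lemma coef_binary_form: "k \<le> n \<Longrightarrow> coef n (binary_form n a) k = a k"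
  by (rule binary_form_inj[OF binary_form_coef]) (auto simp: V_def)

lemma binary_form_in_V: "binary_form n a \<in> V n"
  by (simp add: V_def)

text \<open>
The function on pairs of forms that a coefficient function describes, extended by \<open>0\<close> as for
\<open>polyfuns\<close>. It depends on \<open>coef\<close> only through the coordinates that the forms determine.
\<close>

definition form_function :: "nat \<Rightarrow> nat \<Rightarrow> nat \<Rightarrow> ((nat \<Rightarrow> nat) \<Rightarrow> complex) \<Rightarrow> cform \<times> cform \<Rightarrow> complex" where
  "form_function d i R c = (\<lambda>(l, f). if l \<in> V 1 \<and> f \<in> V d then peval d i R c (joint_coords d (coef 1 l, coef d f)) else 0)"

lemma joint_coords_coef: "joint_coords d (coef 1 (binary_form 1 u), coef d (binary_form d a)) = joint_coords d (u, a)"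
  by (auto simp: joint_coords_def fun_eq_iff coef_binary_form)

lemma form_function_binary_form: "form_function d i R c (binary_form 1 u, binary_form d a) = peval d i R c (joint_coords d (u, a))"
  unfolding form_function_def by (simp add: binary_form_in_V joint_coords_coef del: One_nat_def)

lemma form_function_outside: "p \<notin> V 1 \<times> V d \<Longrightarrow> form_function d i R c p = 0"
  by (cases p) (auto simp: form_function_def simp del: One_nat_def)

lemma in_coords_form_function: "in_coords d (form_function d i R c) = (\<lambda>p. peval d i R c (joint_coords d p))"
  by (auto simp: in_coords_def form_function_binary_form simp del: One_nat_def)

lemma eq_form_function:
  assumes "\<And>p. p \<notin> V 1 \<times> V d \<Longrightarrow> F p = 0" and "in_coords d F = (\<lambda>p. peval d i R c (joint_coords d p))"
  shows "F = form_function d i R c"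
proof
  fix p
  show "F p = form_function d i R c p"
  proof (cases "p \<in> V 1 \<times> V d")
    case True
    then obtain u a where p: "p = (binary_form 1 u, binary_form d a)" by (auto simp: V_def)
    show ?thesis using fun_cong[OF assms(2), of "(u, a)"] unfolding p form_function_binary_form by (simp add: in_coords_def)
  qed (simp add: assms(1) form_function_outside)
qed

section \<open>One-parameter groups of shears\<close>

text \<open>
The left side is the derivative of the polynomial by the coordinate of index \<open>k\<close>, times the
coordinate of index \<open>l\<close>.
\<close>

lemma peval_partial:
  assumes "k \<noteq> l" "k \<le> d + 2" "l \<le> d + 2"
    and "\<And>m. m \<in> exponents d i R \<Longrightarrow> m l > 0 \<Longrightarrow> m(l := m l - 1, k := m k + 1) \<in> exponents d i R"
    and "\<And>m. m \<in> exponents d i R \<Longrightarrow> m k > 0 \<Longrightarrow> m(k := m k - 1, l := m l + 1) \<in> exponents d i R"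
  shows "(\<Sum>m\<in>exponents d i R. c m * (x l * (of_nat (m k) * x k ^ (m k - 1) * (\<Prod>j\<in>{..d+2} - {k}. x j ^ m j))))
    = peval d i R (xder l k c) x"
proof -
  let ?I = "exponents d i R"
  have step: "x l * (x k ^ (m k - 1) * (\<Prod>j\<in>{..d+2} - {k}. x j ^ m j)) = mon d (m(k := m k - 1, l := m l + 1)) x" for m
  proof -
    let ?m = "m(k := m k - 1, l := m l + 1)"
    have "mon d ?m x = x k ^ ?m k * (x l ^ ?m l * (\<Prod>j\<in>{..d+2} - {k} - {l}. x j ^ ?m j))"
      unfolding mon_def using assms(1-3) by (subst prod.remove[of _ k], simp, simp, subst prod.remove[of _ l]) auto
    also have "(\<Prod>j\<in>{..d+2} - {k} - {l}. x j ^ ?m j) = (\<Prod>j\<in>{..d+2} - {k} - {l}. x j ^ m j)"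
      by (intro prod.cong) auto
    also have "x k ^ ?m k * (x l ^ ?m l * (\<Prod>j\<in>{..d+2} - {k} - {l}. x j ^ m j)) =
        x l * (x k ^ (m k - 1) * (x l ^ m l * (\<Prod>j\<in>{..d+2} - {k} - {l}. x j ^ m j)))"
      using assms(1) by (simp add: mult_ac)
    also have "x l ^ m l * (\<Prod>j\<in>{..d+2} - {k} - {l}. x j ^ m j) = (\<Prod>j\<in>{..d+2} - {k}. x j ^ m j)"
      using assms(1-3) by (subst (2) prod.remove[of _ l]) auto
    finally show ?thesis by (rule sym)
  qed
  have "(\<Sum>m\<in>?I. c m * (x l * (of_nat (m k) * x k ^ (m k - 1) * (\<Prod>j\<in>{..d+2} - {k}. x j ^ m j))))
    = (\<Sum>m\<in>?I. of_nat (m k) * c m * mon d (m(k := m k - 1, l := m l + 1)) x)"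
    unfolding step[symmetric] by (intro sum.cong refl) (simp add: mult_ac)
  also have "\<dots> = (\<Sum>m | m \<in> ?I \<and> m k > 0. of_nat (m k) * c m * mon d (m(k := m k - 1, l := m l + 1)) x)"
    using finite_exponents by (intro sum.mono_neutral_right) auto
  also have "\<dots> = (\<Sum>m | m \<in> ?I \<and> m k > 0. (\<lambda>m m'. of_nat (m k + 1) * c m' * mon d m x) (m(k := m k - 1, l := m l + 1)) m)"
    using assms(1) by (intro sum.cong refl) (auto simp: of_nat_diff)
  also have "\<dots> = (\<Sum>m | m \<in> ?I \<and> m l > 0. of_nat (m k + 1) * c (m(l := m l - 1, k := m k + 1)) * mon d m x)"
    by (rule sum_move[symmetric]) (use assms in auto)
  also have "\<dots> = peval d i R (xder l k c) x"
    unfolding peval_def using finite_exponents by (intro sum.mono_neutral_cong_left) (auto simp: xder_def)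
  finally show ?thesis .
qed

lemma peval_has_derivative:
  assumes "\<And>k. k \<le> d + 2 \<Longrightarrow> ((\<lambda>s. x s k) has_field_derivative v k) (at s)"
  shows "((\<lambda>s. peval d i R c (x s)) has_field_derivative
    (\<Sum>k\<le>d+2. \<Sum>m\<in>exponents d i R. c m * (v k * (of_nat (m k) * x s k ^ (m k - 1) * (\<Prod>j\<in>{..d+2} - {k}. x s j ^ m j))))) (at s)"
proof -
  have "((\<lambda>s. mon d m (x s)) has_field_derivative
    (\<Sum>k\<le>d+2. v k * (of_nat (m k) * x s k ^ (m k - 1) * (\<Prod>j\<in>{..d+2} - {k}. x s j ^ m j)))) (at s)" for m
    unfolding mon_def
    by (rule DERIV_cong[OF has_field_derivative_prod[OF DERIV_power[OF assms]]]) (auto simp: mult_ac)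
  then have "((\<lambda>s. peval d i R c (x s)) has_field_derivative
    (\<Sum>m\<in>exponents d i R. c m * (\<Sum>k\<le>d+2. v k * (of_nat (m k) * x s k ^ (m k - 1) * (\<Prod>j\<in>{..d+2} - {k}. x s j ^ m j))))) (at s)"
    unfolding peval_def by (intro DERIV_sum DERIV_cmult)
  then show ?thesis by (subst sum.swap) (simp only: sum_distrib_left)
qed

text \<open>
Along a curve that moves with the speed prescribed by \<open>raise_coef\<close>, differentiating the value of
a polynomial amounts to applying \<open>raise\<close> to its coefficients.
\<close>

lemma peval_raise:
  assumes "\<And>k. k < d + 2 \<Longrightarrow> ((\<lambda>s. x s k) has_field_derivative of_nat (raise_coef d k) * x s (k + 1)) (at s)"
    and "((\<lambda>s. x s (d + 2)) has_field_derivative 0) (at s)"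
  shows "((\<lambda>s. peval d i R c (x s)) has_field_derivative peval d i R (raise d c) (x s)) (at s)"
proof -
  define v where "v k = (if k < d + 2 then of_nat (raise_coef d k) * x s (k + 1) else 0)" for k
  let ?t = "\<lambda>k w. \<Sum>m\<in>exponents d i R. c m * (w * (of_nat (m k) * x s k ^ (m k - 1) * (\<Prod>j\<in>{..d+2} - {k}. x s j ^ m j)))"
  have "((\<lambda>s. x s k) has_field_derivative v k) (at s)" if "k \<le> d + 2" for k
    using assms that by (cases "k = d + 2") (auto simp: v_def)
  then have "((\<lambda>s. peval d i R c (x s)) has_field_derivative (\<Sum>k\<le>d+2. ?t k (v k))) (at s)"
    by (rule peval_has_derivative)
  also have "(\<Sum>k\<le>d+2. ?t k (v k)) = (\<Sum>k<d+2. ?t k (v k))"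
    by (simp add: v_def flip: lessThan_Suc_atMost)
  also have "\<dots> = (\<Sum>k<d+2. of_nat (raise_coef d k) * peval d i R (xder (k + 1) k c) (x s))"
  proof (intro sum.cong refl)
    fix k assume "k \<in> {..<d+2}"
    then have k: "k < d + 2" by simp
    show "?t k (v k) = of_nat (raise_coef d k) * peval d i R (xder (k + 1) k c) (x s)"
    proof (cases "k = d")
      case True
      then show ?thesis by (simp add: v_def raise_coef_def)
    next
      case False
      have "?t k (v k) = of_nat (raise_coef d k) * ?t k (x s (k + 1))"
        using k by (simp add: v_def sum_distrib_left mult_ac)
      also have "?t k (x s (k + 1)) = peval d i R (xder (k + 1) k c) (x s)"
        by (rule peval_partial) (use k False move_up move_down in auto)
      finally show ?thesis .
    qed
  qed
  also have "\<dots> = peval d i R (raise d c) (x s)"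
    unfolding raise_def peval_sum peval_scale ..
  finally show ?thesis .
qed

lemma peval_lower:
  assumes "\<And>k. k < d + 2 \<Longrightarrow> ((\<lambda>s. x s (k + 1)) has_field_derivative of_nat (lower_coef d k) * x s k) (at s)"
    and "((\<lambda>s. x s 0) has_field_derivative 0) (at s)"
  shows "((\<lambda>s. peval d i R c (x s)) has_field_derivative peval d i R (lower d c) (x s)) (at s)"
proof -
  define v where "v k = (case k of 0 \<Rightarrow> 0 | Suc k \<Rightarrow> of_nat (lower_coef d k) * x s k)" for k
  let ?t = "\<lambda>k w. \<Sum>m\<in>exponents d i R. c m * (w * (of_nat (m k) * x s k ^ (m k - 1) * (\<Prod>j\<in>{..d+2} - {k}. x s j ^ m j)))"
  have "((\<lambda>s. x s k) has_field_derivative v k) (at s)" if "k \<le> d + 2" for k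
    using assms that by (cases k) (auto simp: v_def)
  then have "((\<lambda>s. peval d i R c (x s)) has_field_derivative (\<Sum>k\<le>d+2. ?t k (v k))) (at s)"
    by (rule peval_has_derivative)
  also have "(\<Sum>k\<le>d+2. ?t k (v k)) = (\<Sum>k<d+2. ?t (k + 1) (v (k + 1)))"
  proof -
    have "(\<Sum>k\<le>d+2. ?t k (v k)) = (\<Sum>k<Suc (d+2). ?t k (v k))" by (simp only: lessThan_Suc_atMost)
    also have "\<dots> = ?t 0 (v 0) + (\<Sum>k<d+2. ?t (Suc k) (v (Suc k)))" by (rule sum.lessThan_Suc_shift)
    finally show ?thesis by (simp add: v_def)
  qed
  also have "\<dots> = (\<Sum>k<d+2. of_nat (lower_coef d k) * peval d i R (xder k (k + 1) c) (x s))"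
  proof (intro sum.cong refl)
    fix k assume "k \<in> {..<d+2}"
    then have k: "k < d + 2" by simp
    show "?t (k + 1) (v (k + 1)) = of_nat (lower_coef d k) * peval d i R (xder k (k + 1) c) (x s)"
    proof (cases "k = d")
      case True
      then show ?thesis by (simp add: v_def lower_coef_def)
    next
      case False
      have "?t (k + 1) (v (k + 1)) = of_nat (lower_coef d k) * ?t (k + 1) (x s k)"
        using k by (simp add: v_def sum_distrib_left mult_ac)
      also have "?t (k + 1) (x s k) = peval d i R (xder k (k + 1) c) (x s)"
        by (rule peval_partial) (use k False move_up move_down in auto)
      finally show ?thesis .
    qed
  qed
  also have "\<dots> = peval d i R (lower d c) (x s)"
    unfolding lower_def peval_sum peval_scale ..
  finally show ?thesis .
qed

text \<open>
Coefficients of the form obtained by substituting \<open>y + s * x\<close> for \<open>y\<close> (\<open>binary_form_raise_flow\<close>).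
\<close>

definition raise_flow :: "nat \<Rightarrow> complex \<Rightarrow> (nat \<Rightarrow> complex) \<Rightarrow> nat \<Rightarrow> complex" where
  "raise_flow n s a k = (\<Sum>j\<in>{k..n}. of_nat (j choose k) * s ^ (j - k) * a j)"

text \<open>
Coefficients of the form obtained by substituting \<open>x + s * y\<close> for \<open>x\<close> (\<open>binary_form_lower_flow\<close>).
\<close>

definition lower_flow :: "nat \<Rightarrow> complex \<Rightarrow> (nat \<Rightarrow> complex) \<Rightarrow> nat \<Rightarrow> complex" where
  "lower_flow n s a k = (\<Sum>j\<le>k. of_nat ((n - j) choose (k - j)) * s ^ (k - j) * a j)"

lemma raise_flow_0: "k \<le> n \<Longrightarrow> raise_flow n 0 a k = a k"
proof -
  assume "k \<le> n"
  then have "raise_flow n 0 a k = (\<Sum>j\<in>{k}. of_nat (j choose k) * 0 ^ (j - k) * a j)"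
    unfolding raise_flow_def by (intro sum.mono_neutral_right) auto
  then show ?thesis by simp
qed

lemma lower_flow_0: "lower_flow n 0 a k = a k"
proof -
  have "lower_flow n 0 a k = (\<Sum>j\<in>{k}. of_nat ((n - j) choose (k - j)) * 0 ^ (k - j) * a j)"
    unfolding lower_flow_def by (intro sum.mono_neutral_right) auto
  then show ?thesis by simp
qed

lemma sum_triangle_swap:
  "(\<Sum>j\<le>n. \<Sum>k\<le>j. f j k) = (\<Sum>k\<le>n. \<Sum>j\<in>{k..n::nat}. f j k)"
proof -
  have "(\<Sum>j\<le>n. \<Sum>k\<le>j. f j k) = (\<Sum>j\<le>n. \<Sum>k | k \<in> {..n} \<and> k \<le> j. f j k)"
    by (intro sum.cong) auto
  also have "\<dots> = (\<Sum>k\<le>n. \<Sum>j | j \<in> {..n} \<and> k \<le> j. f j k)"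
    by (rule sum.swap_restrict) auto
  also have "\<dots> = (\<Sum>k\<le>n. \<Sum>j\<in>{k..n}. f j k)"
    by (intro sum.cong) auto
  finally show ?thesis .
qed

lemma binary_form_raise_flow:
  fixes v w :: "complex^2"
  assumes "w $ 1 = v $ 1" "w $ 2 = v $ 2 + s * v $ 1"
  shows "binary_form n (raise_flow n s a) v = binary_form n a w"
proof -
  let ?x = "v $ 1" and ?y = "v $ 2"
  have "binary_form n a w = (\<Sum>j\<le>n. a j * ?x ^ (n - j) * (\<Sum>k\<le>j. of_nat (j choose k) * ?y ^ k * (s * ?x) ^ (j - k)))"
    unfolding binary_form_def assms binomial_ring ..
  also have "\<dots> = (\<Sum>j\<le>n. \<Sum>k\<le>j. of_nat (j choose k) * s ^ (j - k) * a j * ?x ^ (n - k) * ?y ^ k)"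
    unfolding sum_distrib_left
  proof (intro sum.cong refl)
    fix j k assume "j \<in> {..n}" "k \<in> {..j}"
    then have "n - k = (n - j) + (j - k)" by auto
    then show "a j * ?x ^ (n - j) * (of_nat (j choose k) * ?y ^ k * (s * ?x) ^ (j - k)) =
      of_nat (j choose k) * s ^ (j - k) * a j * ?x ^ (n - k) * ?y ^ k"
      by (simp add: power_add power_mult_distrib mult_ac)
  qed
  also have "\<dots> = (\<Sum>k\<le>n. \<Sum>j\<in>{k..n}. of_nat (j choose k) * s ^ (j - k) * a j * ?x ^ (n - k) * ?y ^ k)"
    by (rule sum_triangle_swap)
  also have "\<dots> = binary_form n (raise_flow n s a) v"
    unfolding binary_form_def raise_flow_def sum_distrib_right ..
  finally show ?thesis by simp
qed

lemma binary_form_lower_flow: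
  fixes v w :: "complex^2"
  assumes "w $ 1 = v $ 1 + s * v $ 2" "w $ 2 = v $ 2"
  shows "binary_form n (lower_flow n s a) v = binary_form n a w"
proof -
  let ?x = "v $ 1" and ?y = "v $ 2"
  have "binary_form n a w = (\<Sum>j\<le>n. a j * (\<Sum>k\<le>n-j. of_nat ((n - j) choose k) * (s * ?y) ^ k * ?x ^ (n - j - k)) * ?y ^ j)"
    unfolding binary_form_def assms add.commute[of ?x] binomial_ring ..
  also have "\<dots> = (\<Sum>j\<le>n. \<Sum>k\<in>{j..n}. of_nat ((n - j) choose (k - j)) * s ^ (k - j) * a j * ?x ^ (n - k) * ?y ^ k)"
  proof (intro sum.cong refl)
    fix j assume "j \<in> {..n}"
    then have j: "j \<le> n" by simp
    have "(\<Sum>k\<in>{j..n}. of_nat ((n - j) choose (k - j)) * s ^ (k - j) * a j * ?x ^ (n - k) * ?y ^ k)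
       = (\<Sum>k\<le>n-j. of_nat ((n - j) choose k) * s ^ k * a j * ?x ^ (n - (k + j)) * ?y ^ (k + j))"
      by (rule sum.reindex_bij_witness[of _ "\<lambda>k. k + j" "\<lambda>k. k - j"]) (use j in auto)
    also have "\<dots> = a j * (\<Sum>k\<le>n-j. of_nat ((n - j) choose k) * (s * ?y) ^ k * ?x ^ (n - j - k)) * ?y ^ j"
      unfolding sum_distrib_left sum_distrib_right
      by (intro sum.cong refl) (simp add: power_add power_mult_distrib ac_simps)
    finally show "a j * (\<Sum>k\<le>n-j. of_nat ((n - j) choose k) * (s * ?y) ^ k * ?x ^ (n - j - k)) * ?y ^ j =
       (\<Sum>k\<in>{j..n}. of_nat ((n - j) choose (k - j)) * s ^ (k - j) * a j * ?x ^ (n - k) * ?y ^ k)" by simp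
  qed
  also have "\<dots> = (\<Sum>k\<le>n. \<Sum>j\<le>k. of_nat ((n - j) choose (k - j)) * s ^ (k - j) * a j * ?x ^ (n - k) * ?y ^ k)"
    by (rule sum_triangle_swap[symmetric])
  also have "\<dots> = binary_form n (lower_flow n s a) v"
    unfolding binary_form_def lower_flow_def sum_distrib_right ..
  finally show ?thesis by simp
qed

lemma DERIV_power_self: "((\<lambda>s. s ^ n) has_field_derivative of_nat n * s ^ (n - 1)) (at (s :: complex))"
  using DERIV_power[OF DERIV_ident, of n s UNIV] by simp

lemma DERIV_raise_flow:
  "((\<lambda>s. raise_flow n s a k) has_field_derivative of_nat (k + 1) * raise_flow n s a (k + 1)) (at s)"
proof -
  have "((\<lambda>s. raise_flow n s a k) has_field_derivative
     (\<Sum>j\<in>{k..n}. of_nat (j choose k) * (of_nat (j - k) * s ^ (j - k - 1)) * a j)) (at s)"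
    unfolding raise_flow_def by (intro DERIV_sum DERIV_cmult_right DERIV_cmult DERIV_power_self)
  also have "(\<Sum>j\<in>{k..n}. of_nat (j choose k) * (of_nat (j - k) * s ^ (j - k - 1)) * a j)
      = (\<Sum>j\<in>{k+1..n}. of_nat (k + 1) * (of_nat (j choose (k + 1)) * s ^ (j - (k + 1)) * a j))"
  proof (rule sum.mono_neutral_cong_right)
    fix j assume "j \<in> {k + 1..n}"
    have "(j choose k) * (j - k) = (k + 1) * (j choose (k + 1))"
      using binomial_absorb_comp[of j k] binomial_absorption[of k j] by (simp add: mult.commute)
    then have "of_nat (j choose k) * of_nat (j - k) = (of_nat (k + 1) * of_nat (j choose (k + 1)) :: complex)"
      by (metis of_nat_mult)
    then show "of_nat (j choose k) * (of_nat (j - k) * s ^ (j - k - 1)) * a j =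
       of_nat (k + 1) * (of_nat (j choose (k + 1)) * s ^ (j - (k + 1)) * a j)"
      by (simp only: mult.assoc[symmetric] diff_diff_left)
  qed (auto simp: Suc_le_eq)
  also have "\<dots> = of_nat (k + 1) * raise_flow n s a (k + 1)" by (simp only: raise_flow_def sum_distrib_left)
  finally show ?thesis .
qed

lemma DERIV_lower_flow:
  assumes "k < n"
  shows "((\<lambda>s. lower_flow n s a (k + 1)) has_field_derivative of_nat (n - k) * lower_flow n s a k) (at s)"
proof -
  have "((\<lambda>s. lower_flow n s a (k + 1)) has_field_derivative
     (\<Sum>j\<le>k+1. of_nat ((n - j) choose (k + 1 - j)) * (of_nat (k + 1 - j) * s ^ (k + 1 - j - 1)) * a j)) (at s)"
    unfolding lower_flow_def by (intro DERIV_sum DERIV_cmult_right DERIV_cmult DERIV_power_self)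
  also have "(\<Sum>j\<le>k+1. of_nat ((n - j) choose (k + 1 - j)) * (of_nat (k + 1 - j) * s ^ (k + 1 - j - 1)) * a j)
      = (\<Sum>j\<le>k. of_nat (n - k) * (of_nat ((n - j) choose (k - j)) * s ^ (k - j) * a j))"
  proof (rule sum.mono_neutral_cong_right)
    fix j assume "j \<in> {..k}"
    then have j: "j \<le> k" by simp
    have "((n - j) choose Suc (k - j)) * Suc (k - j) = (n - k) * ((n - j) choose (k - j))"
      using binomial_absorb_comp[of "n - j" "k - j"] binomial_absorption[of "k - j" "n - j"] j assms by (simp add: mult.commute)
    then have "of_nat ((n - j) choose Suc (k - j)) * of_nat (Suc (k - j)) = (of_nat (n - k) * of_nat ((n - j) choose (k - j)) :: complex)"
      by (metis of_nat_mult)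
    moreover have "k + 1 - j = Suc (k - j)" using j by simp
    ultimately show "of_nat ((n - j) choose (k + 1 - j)) * (of_nat (k + 1 - j) * s ^ (k + 1 - j - 1)) * a j =
       of_nat (n - k) * (of_nat ((n - j) choose (k - j)) * s ^ (k - j) * a j)"
      by (simp only: mult.assoc[symmetric] diff_Suc_1)
  qed auto
  also have "\<dots> = of_nat (n - k) * lower_flow n s a k" by (simp only: lower_flow_def sum_distrib_left)
  finally show ?thesis .
qed

section \<open>Covariants of a binary form\<close>

definition upper_unipotent :: "complex \<Rightarrow> complex^2^2" where "upper_unipotent s = vector [vector [1, s], vector [0, 1]]"
definition lower_unipotent :: "complex \<Rightarrow> complex^2^2" where "lower_unipotent s = vector [vector [1, 0], vector [s, 1]]"

lemma matrix_2_eq_iff: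
  "A = B \<longleftrightarrow> A $ 1 $ 1 = B $ 1 $ 1 \<and> A $ 1 $ 2 = B $ 1 $ 2 \<and> A $ 2 $ 1 = B $ 2 $ 1 \<and> A $ 2 $ 2 = B $ 2 $ (2::2)"
  for A B :: "complex^2^2"
  by (auto simp: vec_eq_iff forall_2)

lemma shear_nth [simp]:
  "upper_unipotent s $ 1 $ 1 = 1" "upper_unipotent s $ 1 $ 2 = s" "upper_unipotent s $ 2 $ 1 = 0" "upper_unipotent s $ 2 $ 2 = 1"
  "lower_unipotent s $ 1 $ 1 = 1" "lower_unipotent s $ 1 $ 2 = 0" "lower_unipotent s $ 2 $ 1 = s" "lower_unipotent s $ 2 $ 2 = 1"
  by (simp_all add: upper_unipotent_def lower_unipotent_def)

lemma matrix_mult_2: "(A ** B) $ i $ j = A $ i $ 1 * B $ 1 $ j + A $ i $ 2 * B $ 2 $ j" for A B :: "complex^2^2"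
  by (simp add: matrix_matrix_mult_def sum_2)

lemma matrix_vector_mult_2: "(A *v v) $ i = A $ i $ 1 * v $ 1 + A $ i $ 2 * v $ 2" for A :: "complex^2^2"
  by (simp add: matrix_vector_mult_def sum_2)

text \<open>
A matrix whose lower left entry is nonzero is a product of three shears. If that entry
vanishes, adding the first row to the second makes it nonzero.
\<close>

lemma SL2_induct:
  assumes "h \<in> SL2" and U: "\<And>s. P (upper_unipotent s)" and L: "\<And>s. P (lower_unipotent s)" and M: "\<And>A B. P A \<Longrightarrow> P B \<Longrightarrow> P (A ** B)"
  shows "P h"
proof -
  have main: "P h" if "h \<in> SL2" "h $ 2 $ 1 \<noteq> 0" for h
  proof -
    let ?a = "h $ 1 $ 1" and ?b = "h $ 1 $ 2" and ?c = "h $ 2 $ 1" and ?e = "h $ 2 $ 2"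
    have "?a * ?e - ?b * ?c = 1" using that(1) by (simp add: SL2_def det_2)
    then have "h = upper_unipotent ((?a - 1) / ?c) ** (lower_unipotent ?c ** upper_unipotent ((?e - 1) / ?c))"
      using that(2) by (simp add: matrix_2_eq_iff matrix_mult_2 field_simps)
    then show ?thesis using U L M by metis
  qed
  show ?thesis
  proof (cases "h $ 2 $ 1 = 0")
    case True
    then have det: "h $ 1 $ 1 * h $ 2 $ 2 = 1" using assms(1) by (simp add: SL2_def det_2)
    have "lower_unipotent 1 ** h \<in> SL2" using det True by (simp add: SL2_def det_2 matrix_mult_2 algebra_simps)
    moreover have "(lower_unipotent 1 ** h) $ 2 $ 1 \<noteq> 0" using det True by (auto simp: matrix_mult_2)
    ultimately have "P (lower_unipotent 1 ** h)" by (rule main)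
    then have "P (lower_unipotent (-1) ** (lower_unipotent 1 ** h))" by (rule M[OF L])
    moreover have "lower_unipotent (-1) ** (lower_unipotent 1 ** h) = h" by (simp add: matrix_2_eq_iff matrix_mult_2)
    ultimately show ?thesis by simp
  qed (rule main[OF assms(1)])
qed

lemma binary_form_upper_unipotent: "(\<lambda>v. binary_form n a (upper_unipotent s *v v)) = binary_form n (lower_flow n s a)"
  by (rule ext, rule binary_form_lower_flow[symmetric]) (simp_all add: matrix_vector_mult_2)

lemma binary_form_lower_unipotent: "(\<lambda>v. binary_form n a (lower_unipotent s *v v)) = binary_form n (raise_flow n s a)"
  by (rule ext, rule binary_form_raise_flow[symmetric]) (simp_all add: matrix_vector_mult_2)

lemma SL2_inv:
  assumes "h \<in> SL2"
  shows "matrix_inv h \<in> SL2" "matrix_inv (matrix_inv h) = h"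
proof -
  have "invertible h" using assms by (simp add: SL2_def invertible_det_nz)
  then have inv: "h ** matrix_inv h = mat 1 \<and> matrix_inv h ** h = mat 1"
    unfolding invertible_def matrix_inv_def by (rule someI_ex)
  have "invertible (matrix_inv h)" using inv unfolding invertible_def by blast
  then have inv': "matrix_inv h ** matrix_inv (matrix_inv h) = mat 1 \<and> matrix_inv (matrix_inv h) ** matrix_inv h = mat 1"
    unfolding invertible_def matrix_inv_def[of "matrix_inv h"] by (rule someI_ex)
  have "matrix_inv (matrix_inv h) = (h ** matrix_inv h) ** matrix_inv (matrix_inv h)" using inv by simp
  also have "\<dots> = h" using inv' by (simp only: matrix_mul_assoc[symmetric] matrix_mul_rid)
  finally show "matrix_inv (matrix_inv h) = h" .
  have "det h * det (matrix_inv h) = 1" using inv by (metis det_I det_mul)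
  then show "matrix_inv h \<in> SL2" using assms by (simp add: SL2_def)
qed

text \<open>
The action uses the inverse matrix; since inversion permutes \<open>SL2\<close>, substitution of
the matrix itself gives the same condition. The set of matrices for which the condition holds is closed under
products, so the generators decide.
\<close>

lemma invariant_iff_shears:
  "(\<forall>g\<in>SL2. \<forall>l\<in>V 1. \<forall>f\<in>V d. F (act g l, act g f) = F (l, f)) \<longleftrightarrow>
   (\<forall>s u a. F (binary_form 1 (raise_flow 1 s u), binary_form d (raise_flow d s a)) = F (binary_form 1 u, binary_form d a)) \<and>
   (\<forall>s u a. F (binary_form 1 (lower_flow 1 s u), binary_form d (lower_flow d s a)) = F (binary_form 1 u, binary_form d a))"
  (is "?lhs \<longleftrightarrow> ?rhs")
proof
  assume lhs: ?lhs
  have "F (\<lambda>v. l (h *v v), \<lambda>v. f (h *v v)) = F (l, f)" if "h \<in> SL2" "l \<in> V 1" "f \<in> V d" for h l f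
    using bspec[OF bspec[OF bspec[OF lhs SL2_inv(1)[OF that(1)]] that(2)] that(3)]
    by (simp add: act_def SL2_inv(2)[OF that(1)])
  then have inv: "F (\<lambda>v. binary_form 1 u (h *v v), \<lambda>v. binary_form d a (h *v v)) = F (binary_form 1 u, binary_form d a)"
    if "h \<in> SL2" for h u a using that binary_form_in_V by blast
  have "upper_unipotent s \<in> SL2" "lower_unipotent s \<in> SL2" for s by (simp_all add: SL2_def det_2)
  then show ?rhs using inv[of "upper_unipotent _"] inv[of "lower_unipotent _"] by (simp add: binary_form_upper_unipotent binary_form_lower_unipotent)
next
  assume rhs: ?rhs
  let ?P = "\<lambda>h. \<forall>l\<in>V 1. \<forall>f\<in>V d. (\<lambda>v. l (h *v v)) \<in> V 1 \<and> (\<lambda>v. f (h *v v)) \<in> V d \<and>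
      F (\<lambda>v. l (h *v v), \<lambda>v. f (h *v v)) = F (l, f)"
  have "?P h" if "h \<in> SL2" for h
    using that
  proof (rule SL2_induct)
    show "?P (upper_unipotent s)" for s
    proof (intro ballI)
      fix l f assume "l \<in> V 1" "f \<in> V d"
      then obtain u a where "l = binary_form 1 u" "f = binary_form d a" by (auto simp: V_def)
      then show "(\<lambda>v. l (upper_unipotent s *v v)) \<in> V 1 \<and> (\<lambda>v. f (upper_unipotent s *v v)) \<in> V d \<and>
        F (\<lambda>v. l (upper_unipotent s *v v), \<lambda>v. f (upper_unipotent s *v v)) = F (l, f)"
        using rhs by (simp only: binary_form_upper_unipotent binary_form_in_V simp_thms)
    qed
    show "?P (lower_unipotent s)" for s
    proof (intro ballI)
      fix l f assume "l \<in> V 1" "f \<in> V d"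
      then obtain u a where "l = binary_form 1 u" "f = binary_form d a" by (auto simp: V_def)
      then show "(\<lambda>v. l (lower_unipotent s *v v)) \<in> V 1 \<and> (\<lambda>v. f (lower_unipotent s *v v)) \<in> V d \<and>
        F (\<lambda>v. l (lower_unipotent s *v v), \<lambda>v. f (lower_unipotent s *v v)) = F (l, f)"
        using rhs by (simp only: binary_form_lower_unipotent binary_form_in_V simp_thms)
    qed
    show "?P (A ** B)" if A: "?P A" and B: "?P B" for A B
    proof (intro ballI)
      fix l f assume lf: "l \<in> V 1" "f \<in> V d"
      let ?l = "\<lambda>v. l (A *v v)" and ?f = "\<lambda>v. f (A *v v)"
      have 1: "?l \<in> V 1" "?f \<in> V d" "F (?l, ?f) = F (l, f)" using A lf by blast+
      have "(\<lambda>v. ?l (B *v v)) \<in> V 1 \<and> (\<lambda>v. ?f (B *v v)) \<in> V d \<and> F (\<lambda>v. ?l (B *v v), \<lambda>v. ?f (B *v v)) = F (?l, ?f)"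
        by (rule B[THEN bspec, OF 1(1), THEN bspec, OF 1(2)])
      then show "(\<lambda>v. l ((A ** B) *v v)) \<in> V 1 \<and> (\<lambda>v. f ((A ** B) *v v)) \<in> V d \<and>
        F (\<lambda>v. l ((A ** B) *v v), \<lambda>v. f ((A ** B) *v v)) = F (l, f)"
        by (simp only: 1(3) matrix_vector_mul_assoc)
    qed
  qed
  then show ?lhs using SL2_inv(1) unfolding act_def by blast
qed

lemma DERIV_peval_raise_flow:
  "((\<lambda>s. peval d i R c (joint_coords d (raise_flow 1 s u, raise_flow d s a))) has_field_derivative
     peval d i R (raise d c) (joint_coords d (raise_flow 1 s u, raise_flow d s a))) (at s)"
proof (rule peval_raise)
  have above: "raise_flow n s a (Suc n) = 0" for n s a by (simp add: raise_flow_def)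
  show "((\<lambda>s. joint_coords d (raise_flow 1 s u, raise_flow d s a) k) has_field_derivative
      of_nat (raise_coef d k) * joint_coords d (raise_flow 1 s u, raise_flow d s a) (k + 1)) (at s)" if "k < d + 2" for k
  proof -
    consider "k < d" | "k = d" | "k = d + 1" using \<open>k < d + 2\<close> by linarith
    then show ?thesis
    proof cases
      case 1
      then show ?thesis using DERIV_raise_flow[of d a k s] by (simp add: joint_coords_simps raise_coef_def)
    next
      case 2
      then show ?thesis using DERIV_raise_flow[of d a d s] by (simp add: joint_coords_simps raise_coef_def above)
    next
      case 3
      then show ?thesis using DERIV_raise_flow[of 1 u 0 s] by (simp add: joint_coords_simps raise_coef_def)
    qed
  qed
  show "((\<lambda>s. joint_coords d (raise_flow 1 s u, raise_flow d s a) (d + 2)) has_field_derivative 0) (at s)"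
    using DERIV_raise_flow[of 1 u 1 s] above[of 1 s u] by (simp add: joint_coords_simps numeral_2_eq_2)
qed

lemma DERIV_peval_lower_flow:
  "((\<lambda>s. peval d i R c (joint_coords d (lower_flow 1 s u, lower_flow d s a))) has_field_derivative
     peval d i R (lower d c) (joint_coords d (lower_flow 1 s u, lower_flow d s a))) (at s)"
proof (rule peval_lower)
  have zero: "lower_flow n s a 0 = a 0" for n s a by (simp add: lower_flow_def)
  show "((\<lambda>s. joint_coords d (lower_flow 1 s u, lower_flow d s a) (k + 1)) has_field_derivative
      of_nat (lower_coef d k) * joint_coords d (lower_flow 1 s u, lower_flow d s a) k) (at s)" if "k < d + 2" for k
  proof -
    consider "k < d" | "k = d" | "k = d + 1" using \<open>k < d + 2\<close> by linarith
    then show ?thesis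
    proof cases
      case 1
      then show ?thesis using DERIV_lower_flow[of k d a s] by (simp add: joint_coords_simps lower_coef_def)
    next
      case 2
      then show ?thesis by (simp add: joint_coords_simps lower_coef_def zero)
    next
      case 3
      then show ?thesis using DERIV_lower_flow[of 0 1 u s] by (simp add: joint_coords_simps lower_coef_def)
    qed
  qed
  show "((\<lambda>s. joint_coords d (lower_flow 1 s u, lower_flow d s a) 0) has_field_derivative 0) (at s)"
    by (simp add: joint_coords_simps zero)
qed

lemma peval_joint_coords_eq_0D:
  assumes "\<And>u a. peval d i R c (joint_coords d (u, a)) = 0" and "\<And>m. c m \<noteq> 0 \<Longrightarrow> m \<in> exponents d i R"
  shows "c = 0"
proof
  fix m
  have "peval d i R c x = 0" for x
  proof -
    have "joint_coords d (\<lambda>k. x (d + 1 + k), x) k = x k" if "k \<le> d + 2" for k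
    proof -
      consider "k \<le> d" | "k = d + 1" | "k = d + 2" using \<open>k \<le> d + 2\<close> by linarith
      then show ?thesis by cases (simp_all add: joint_coords_simps)
    qed
    then have "peval d i R c x = peval d i R c (joint_coords d (\<lambda>k. x (d + 1 + k), x))"
      unfolding peval_def mon_def by (intro sum.cong prod.cong arg_cong2[of _ _ _ _ "(*)"]) auto
    then show ?thesis using assms(1) by simp
  qed
  then show "c m = 0 m" using peval_eq_0D[of d i R c m] assms(2)[of m] by auto
qed

lemma constant_iff_derivative_0:
  fixes f :: "complex \<Rightarrow> complex"
  assumes "\<And>s. (f has_field_derivative f' s) (at s)"
  shows "(\<forall>s. f s = f 0) \<longleftrightarrow> (\<forall>s. f' s = 0)"
proof
  assume "\<forall>s. f s = f 0"
  then have "f = (\<lambda>_. f 0)" by auto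
  then have "(f has_field_derivative 0) (at s)" for s by (metis DERIV_const)
  then show "\<forall>s. f' s = 0" using assms DERIV_unique by blast
next
  assume "\<forall>s. f' s = 0"
  then show "\<forall>s. f s = f 0"
    using has_field_derivative_zero_constant[of UNIV f] assms by auto
qed

text \<open>
An entire function is constant iff its derivative vanishes; the derivative along the flow is
again a polynomial on the flow, so it vanishes identically iff its coefficients do.
\<close>

lemma raise_flow_invariant_iff:
  assumes supp: "\<forall>m. c m \<noteq> 0 \<longrightarrow> m \<in> exponents d i R"
  shows "(\<forall>s u a. peval d i R c (joint_coords d (raise_flow 1 s u, raise_flow d s a)) = peval d i R c (joint_coords d (u, a))) \<longleftrightarrow> raise d c = 0"
proof -
  have 0: "joint_coords d (raise_flow 1 0 u, raise_flow d 0 a) = joint_coords d (u, a)" for u a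
    by (auto simp: joint_coords_def fun_eq_iff raise_flow_0)
  have "(\<forall>s u a. peval d i R c (joint_coords d (raise_flow 1 s u, raise_flow d s a)) = peval d i R c (joint_coords d (u, a)))
    \<longleftrightarrow> (\<forall>u a s. peval d i R (raise d c) (joint_coords d (raise_flow 1 s u, raise_flow d s a)) = 0)"
    using constant_iff_derivative_0[OF DERIV_peval_raise_flow, of d i R c] unfolding 0 by blast
  also have "\<dots> \<longleftrightarrow> raise d c = 0"
  proof
    assume *: "\<forall>u a s. peval d i R (raise d c) (joint_coords d (raise_flow 1 s u, raise_flow d s a)) = 0"
    show "raise d c = 0"
    proof (rule peval_joint_coords_eq_0D)
      show "peval d i R (raise d c) (joint_coords d (u, a)) = 0" for u a using *[rule_format, where s = 0] unfolding 0 .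
      show "m \<in> exponents d i R" if "raise d c m \<noteq> 0" for m using raise_nonzeroD[OF supp[rule_format] that] by metis
    qed
  qed (simp add: peval_def)
  finally show ?thesis .
qed

lemma lower_flow_invariant_iff:
  assumes supp: "\<forall>m. c m \<noteq> 0 \<longrightarrow> m \<in> exponents d i R"
  shows "(\<forall>s u a. peval d i R c (joint_coords d (lower_flow 1 s u, lower_flow d s a)) = peval d i R c (joint_coords d (u, a))) \<longleftrightarrow> lower d c = 0"
proof -
  have 0: "joint_coords d (lower_flow 1 0 u, lower_flow d 0 a) = joint_coords d (u, a)" for u a
    by (auto simp: joint_coords_def fun_eq_iff lower_flow_0)
  have "(\<forall>s u a. peval d i R c (joint_coords d (lower_flow 1 s u, lower_flow d s a)) = peval d i R c (joint_coords d (u, a)))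
    \<longleftrightarrow> (\<forall>u a s. peval d i R (lower d c) (joint_coords d (lower_flow 1 s u, lower_flow d s a)) = 0)"
    using constant_iff_derivative_0[OF DERIV_peval_lower_flow, of d i R c] unfolding 0 by blast
  also have "\<dots> \<longleftrightarrow> lower d c = 0"
  proof
    assume *: "\<forall>u a s. peval d i R (lower d c) (joint_coords d (lower_flow 1 s u, lower_flow d s a)) = 0"
    show "lower d c = 0"
    proof (rule peval_joint_coords_eq_0D)
      show "peval d i R (lower d c) (joint_coords d (u, a)) = 0" for u a using *[rule_format, where s = 0] unfolding 0 .
      show "m \<in> exponents d i R" if "lower d c m \<noteq> 0" for m using lower_nonzeroD[OF supp[rule_format] that] by metis
    qed
  qed (simp add: peval_def)
  finally show ?thesis .
qed

text \<open>
Weight \<open>0\<close> comes for free: a function killed by both operators is killed by their commutator.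
\<close>

lemma invariant_coeffs_iff:
  "c \<in> invariant_coeffs d i R \<longleftrightarrow> (\<forall>m. c m \<noteq> 0 \<longrightarrow> m \<in> exponents d i R) \<and> raise d c = 0 \<and> lower d c = 0"
proof
  assume "c \<in> invariant_coeffs d i R"
  then show "(\<forall>m. c m \<noteq> 0 \<longrightarrow> m \<in> exponents d i R) \<and> raise d c = 0 \<and> lower d c = 0"
    using raise_eq_0_iff_lower_eq_0[of c d i R] by (auto simp: invariant_coeffs_def weight_space_def)
next
  assume c: "(\<forall>m. c m \<noteq> 0 \<longrightarrow> m \<in> exponents d i R) \<and> raise d c = 0 \<and> lower d c = 0"
  have "raise d 0 = 0" "lower d 0 = 0" 
    by (rule module_hom.zero[OF Vector_Spaces.linear.axioms(3)[OF linear_raise]]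
             module_hom.zero[OF Vector_Spaces.linear.axioms(3)[OF linear_lower]])+
  then have "weight d m = 0" if "c m \<noteq> 0" for m
    using raise_lower_commutator[of d c m] c that by simp
  then show "c \<in> invariant_coeffs d i R" using c by (auto simp: invariant_coeffs_def weight_space_def)
qed

lemma form_function_invariant_iff:
  assumes "\<forall>m. c m \<noteq> 0 \<longrightarrow> m \<in> exponents d i R"
  shows "(\<forall>g\<in>SL2. \<forall>l\<in>V 1. \<forall>f\<in>V d. form_function d i R c (act g l, act g f) = form_function d i R c (l, f)) \<longleftrightarrow> c \<in> invariant_coeffs d i R"
  unfolding invariant_iff_shears form_function_binary_form raise_flow_invariant_iff[OF assms] lower_flow_invariant_iff[OF assms] invariant_coeffs_iff
  using assms by blast

text \<open>
The spaces increase with \<open>R\<close> and from \<open>d * i\<close> on have the same dimension.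
\<close>

lemma invariant_coeffs_stable:
  assumes "R \<ge> d * i"
  shows "invariant_coeffs d i R = invariant_coeffs d i (d * i)"
proof -
  obtain W where W: "finite W" "weight_space d i R 0 \<subseteq> cfun.span W" using weight_space_finite_span by blast
  have "invariant_coeffs d i (d * i) = invariant_coeffs d i R"
  proof (rule cfun.subspace_eq_if_dim_eq)
    show "invariant_coeffs d i (d * i) \<subseteq> invariant_coeffs d i R"
      using exponents_mono[OF assms, of d i] by (simp add: subset_iff invariant_coeffs_iff)
    show "cfun.subspace (invariant_coeffs d i (d * i))" by (rule subspace_invariant_coeffs)
    show "finite W" "invariant_coeffs d i R \<subseteq> cfun.span W" using W by (auto simp: invariant_coeffs_def)
    show "cfun.dim (invariant_coeffs d i R) \<le> cfun.dim (invariant_coeffs d i (d * i))"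
      using dim_invariant_coeffs_stable[OF assms] dim_invariant_coeffs_stable[of d i "d * i"] by simp
  qed
  then show ?thesis ..
qed

text \<open>
A covariant has some finite degree \<open>R\<close> in the coordinates of the linear form; by
\<open>invariant_coeffs_stable\<close> its coefficients already live in degree at most \<open>d * i\<close>.
\<close>

lemma covariants_deg_eq: "covariants_deg d i = form_function d i (d * i) ` invariant_coeffs d i (d * i)"
proof (intro subset_antisym subsetI)
  fix F assume F: "F \<in> covariants_deg d i"
  then have "in_coords d F \<in> cfun.span (monomials d i)" by (simp add: covariants_deg_def)
  then obtain R c where c: "\<forall>m. c m \<noteq> 0 \<longrightarrow> m \<in> exponents d i R" and Fc: "in_coords d F = (\<lambda>p. peval d i R c (joint_coords d p))"
    by (rule span_monomialsE)
  define R' where "R' = max R (d * i)"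
  have c': "m \<in> exponents d i R'" if "c m \<noteq> 0" for m
    using c that exponents_mono[of R R' d i] by (auto simp: R'_def)
  have "in_coords d F = (\<lambda>p. peval d i R' c (joint_coords d p))"
    unfolding Fc using peval_mono[of R R' c d i] c by (auto simp: R'_def)
  then have form_function: "F = form_function d i R' c"
    using F by (intro eq_form_function) (auto simp: covariants_deg_def covariants_def polyfuns_def)
  then have "c \<in> invariant_coeffs d i R'"
    using F form_function_invariant_iff[of c d i R'] c' by (simp add: covariants_deg_def covariants_def)
  then have hz: "c \<in> invariant_coeffs d i (d * i)" using invariant_coeffs_stable[of d i R'] by (simp add: R'_def)
  then have "peval d i R' c x = peval d i (d * i) c x" for x
    by (intro peval_mono) (auto simp: R'_def invariant_coeffs_iff)
  then have "F = form_function d i (d * i) c" unfolding form_function form_function_def by (simp only:)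
  then show "F \<in> form_function d i (d * i) ` invariant_coeffs d i (d * i)" using hz by blast
next
  fix F assume "F \<in> form_function d i (d * i) ` invariant_coeffs d i (d * i)"
  then obtain c where c: "c \<in> invariant_coeffs d i (d * i)" and F: "F = form_function d i (d * i) c" by blast
  have span: "in_coords d F \<in> cfun.span (monomials d i)"
    unfolding F in_coords_form_function by (rule peval_in_span)
  moreover have "in_coords d F \<in> cfun.span (\<Union>i. monomials d i)"
    using span cfun.span_mono[of "monomials d i" "\<Union>i. monomials d i"] by blast
  moreover have "\<forall>g\<in>SL2. \<forall>l\<in>V 1. \<forall>f\<in>V d. F (act g l, act g f) = F (l, f)"
    using form_function_invariant_iff[of c d i "d * i"] c unfolding F by (auto simp: invariant_coeffs_iff)
  ultimately show "F \<in> covariants_deg d i"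
    using form_function_outside[of _ d i "d * i" c] by (auto simp: covariants_deg_def covariants_def polyfuns_def F)
qed

lemma dim_covariants_deg: "cfun.dim (covariants_deg d i) = box_count d i ((d * i + 1) div 2)"
proof -
  let ?K = "invariant_coeffs d i (d * i)"
  have lin: "Vector_Spaces.linear (\<lambda>z c m. z * c m) (\<lambda>z F p. z * F p) (form_function d i (d * i))"
  proof (unfold_locales, goal_cases)
    case (1 c c')
    have "peval d i R (c + c') x = peval d i R c x + peval d i R c' x" for R x
      by (simp add: peval_def distrib_right sum.distrib)
    then show ?case by (simp add: form_function_def fun_eq_iff)
  next
    case (2 z c)
    show ?case by (simp add: form_function_def fun_eq_iff peval_scale)
  qed
  have sub: "cfun.subspace ?K" by (rule subspace_invariant_coeffs)
  obtain W where W: "finite W" "weight_space d i (d * i) 0 \<subseteq> cfun.span W" using weight_space_finite_span by blast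
  then have KW: "?K \<subseteq> cfun.span W" by (auto simp: invariant_coeffs_def)
  have "c = 0" if c: "c \<in> ?K" "form_function d i (d * i) c = 0" for c
  proof (rule peval_joint_coords_eq_0D)
    show "peval d i (d * i) c (joint_coords d (u, a)) = 0" for u a
      using form_function_binary_form[of d i "d * i" c u a] c(2) by simp
  qed (use c(1) in \<open>simp add: invariant_coeffs_iff\<close>)
  then have ker: "{c \<in> ?K. form_function d i (d * i) c = 0} = {0}"
    using cfun.subspace_0[OF sub] module_hom.zero[OF Vector_Spaces.linear.axioms(3)[OF lin]] by auto
  have "cfun.dim ?K = cfun.dim (form_function d i (d * i) ` ?K)"
    using vector_space_pair.rank_nullity[OF cfun_pair lin sub W(1) KW] ker dim_zero_space by simp
  then show ?thesis by (simp add: covariants_deg_eq dim_invariant_coeffs_stable)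
qed

section \<open>The middle coefficient of the Gaussian binomial\<close>

lemma box_count_0_right: "box_count d 0 h = of_bool (h = 0)"
proof -
  have "degree_exps d 0 = {\<lambda>_. 0}"
    by (auto simp: degree_exps_def fun_eq_iff) (metis atMost_iff linorder_not_le)
  then have "{m \<in> degree_exps d 0. index_sum d m = h} = (if h = 0 then {\<lambda>_. 0} else {})"
    by (auto simp: index_sum_def)
  then show ?thesis by (simp add: box_count_def)
qed

lemma box_count_0_left: "box_count 0 i h = of_bool (h = 0)"
proof -
  have "degree_exps 0 i = {\<lambda>k. if k = 0 then i else 0}"
    by (auto simp: degree_exps_def fun_eq_iff)
  then have "{m \<in> degree_exps 0 i. index_sum 0 m = h} = (if h = 0 then {\<lambda>k. if k = 0 then i else 0} else {})"
    by (auto simp: index_sum_def)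
  then show ?thesis by (simp add: box_count_def)
qed

text \<open>
The \<open>q\<close>-Pascal rule: either the exponent of index \<open>0\<close> is positive and can be decreased, or it
is \<open>0\<close> and all indices can be shifted down by one, which takes \<open>Suc i\<close> from their sum.
\<close>

lemma box_count_Suc_Suc:
  "box_count (Suc d) (Suc i) h =
     box_count (Suc d) i h + (if h < Suc i then 0 else box_count d (Suc i) (h - Suc i))"
proof -
  let ?M = "{m \<in> degree_exps (Suc d) (Suc i). index_sum (Suc d) m = h}"
  have fin: "finite ?M" using finite_degree_exps by simp
  have "card ?M = card {m \<in> ?M. m 0 > 0} + card {m \<in> ?M. m 0 = 0}"
  proof -
    have "card ?M = card ({m \<in> ?M. m 0 > 0} \<union> {m \<in> ?M. m 0 = 0})"
      by (rule arg_cong[of _ _ card]) auto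
    also have "\<dots> = card {m \<in> ?M. m 0 > 0} + card {m \<in> ?M. m 0 = 0}"
      by (rule card_Un_disjoint) (auto intro: finite_subset[OF _ fin])
    finally show ?thesis .
  qed
  moreover have "card {m \<in> ?M. m 0 > 0} = box_count (Suc d) i h"
    unfolding box_count_def
  proof (rule bij_betw_same_card, rule bij_betw_byWitness[where f' = "\<lambda>m. m(0 := m 0 + 1)"])
    show "(\<lambda>m. m(0 := m 0 - 1)) ` {m \<in> ?M. m 0 > 0} \<subseteq> {m \<in> degree_exps (Suc d) i. index_sum (Suc d) m = h}"
      by (auto simp: degree_exps_def index_sum_def sum.atMost_Suc_shift simp del: sum.atMost_Suc)
  qed (auto simp: degree_exps_def index_sum_def sum.atMost_Suc_shift simp del: sum.atMost_Suc)
  moreover have "card {m \<in> ?M. m 0 = 0} = (if h < Suc i then 0 else box_count d (Suc i) (h - Suc i))"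
  proof -
    have shift: "index_sum (Suc d) m = index_sum d (\<lambda>k. m (Suc k)) + (\<Sum>k\<le>d. m (Suc k))" for m
      unfolding index_sum_def by (subst sum.atMost_Suc_shift) (simp add: sum.distrib add.commute)
    show ?thesis
    proof (cases "h < Suc i")
      case True
      have "{m \<in> ?M. m 0 = 0} = {}"
        using True by (auto simp: shift degree_exps_def sum.atMost_Suc_shift simp del: sum.atMost_Suc)
      then have "card {m \<in> ?M. m 0 = 0} = 0" by (simp only: card.empty)
      then show ?thesis using True by (simp only: if_True)
    next
      case False
      have "card {m \<in> ?M. m 0 = 0} = box_count d (Suc i) (h - Suc i)"
        unfolding box_count_def
      proof (rule bij_betw_same_card, rule bij_betw_byWitness[where f' = "\<lambda>m k. case k of 0 \<Rightarrow> 0 | Suc k \<Rightarrow> m k"])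
        show "(\<lambda>m k. m (Suc k)) ` {m \<in> ?M. m 0 = 0} \<subseteq> {m \<in> degree_exps d (Suc i). index_sum d m = h - Suc i}"
          using False by (auto simp: shift degree_exps_def sum.atMost_Suc_shift simp del: sum.atMost_Suc)
        show "(\<lambda>m k. case k of 0 \<Rightarrow> 0 | Suc k \<Rightarrow> m k) ` {m \<in> degree_exps d (Suc i). index_sum d m = h - Suc i} \<subseteq> {m \<in> ?M. m 0 = 0}"
          using False by (auto simp: shift degree_exps_def sum.atMost_Suc_shift simp del: sum.atMost_Suc split: nat.splits)
      qed (auto split: nat.splits simp: fun_eq_iff)
      then show ?thesis using False by simp
    qed
  qed
  ultimately show ?thesis by (simp add: box_count_def)
qed

definition box_fps :: "nat \<Rightarrow> nat \<Rightarrow> real fps" where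
  "box_fps d i = Abs_fps (\<lambda>h. real (box_count d i h))"

lemma box_fps_Suc_Suc: "box_fps (Suc d) (Suc i) = box_fps (Suc d) i + fps_X ^ Suc i * box_fps d (Suc i)"
  by (rule fps_ext) (auto simp: box_fps_def box_count_Suc_Suc fps_X_power_mult_nth simp del: power_Suc)

text \<open>
The product formula for Gaussian binomial coefficients, cleared of denominators. It follows from the
Pascal rule by induction on \<open>d\<close> and, inside, on \<open>i\<close>.
\<close>

lemma box_fps_product:
  "box_fps d i * (\<Prod>j=1..d. 1 - fps_X ^ j) = (\<Prod>j=1..d. 1 - fps_X ^ (i + j))"
proof (induction d arbitrary: i)
  case 0
  have "box_fps 0 i = 1" by (rule fps_ext) (simp add: box_fps_def box_count_0_left)
  then show ?case by simp
next
  case (Suc d)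
  note IHd = Suc.IH
  show ?case
  proof (induction i)
    case 0
    have "box_fps (Suc d) 0 = 1" by (rule fps_ext) (simp add: box_fps_def box_count_0_right)
    then show ?case by simp
  next
    case (Suc i)
    have shift: "(\<Prod>j=1..Suc d. 1 - fps_X ^ (i + j) :: real fps) = (1 - fps_X ^ Suc i) * (\<Prod>j=1..d. 1 - fps_X ^ (Suc i + j))"
      by (subst prod.atLeast_Suc_atMost, simp, subst prod.shift_bounds_cl_Suc_ivl) simp
    have "box_fps (Suc d) (Suc i) * (\<Prod>j=1..Suc d. 1 - fps_X ^ j) =
        box_fps (Suc d) i * (\<Prod>j=1..Suc d. 1 - fps_X ^ j)
        + fps_X ^ Suc i * (box_fps d (Suc i) * (\<Prod>j=1..d. 1 - fps_X ^ j)) * (1 - fps_X ^ Suc d)"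
      unfolding box_fps_Suc_Suc by (simp add: algebra_simps)
    also have "\<dots> = (\<Prod>j=1..d. 1 - fps_X ^ (Suc i + j)) * ((1 - fps_X ^ Suc i) + fps_X ^ Suc i * (1 - fps_X ^ Suc d))"
      unfolding Suc.IH IHd shift by (simp only: distrib_left mult_ac)
    also have "(1 - fps_X ^ Suc i) + fps_X ^ Suc i * (1 - fps_X ^ Suc d) = (1 - fps_X ^ (Suc i + Suc d) :: real fps)"
      by (simp only: power_add) (simp add: algebra_simps)
    finally show ?case by simp
  qed
qed

text \<open>
The generating function of partitions into parts of size at most \<open>d\<close>.
\<close>

definition partition_fps :: "nat \<Rightarrow> real fps" where
  "partition_fps d = inverse (\<Prod>j=1..d. 1 - fps_X ^ j)"

lemma partition_fps_inverse: "partition_fps d * (\<Prod>j=1..d. 1 - fps_X ^ j) = 1"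
proof -
  have "fps_nth (\<Prod>j=1..d. 1 - fps_X ^ j :: real fps) 0 = 1"
    by (induction d) simp_all
  then show ?thesis unfolding partition_fps_def by (intro inverse_mult_eq_1) simp
qed

lemma partition_fps_Suc_nth:
  "fps_nth (partition_fps (Suc d)) n = fps_nth (partition_fps d) n + (if n < Suc d then 0 else fps_nth (partition_fps (Suc d)) (n - Suc d))"
proof -
  have "partition_fps (Suc d) * (1 - fps_X ^ Suc d) * ((\<Prod>j=1..d. 1 - fps_X ^ j) * partition_fps d)
      = (partition_fps (Suc d) * (\<Prod>j=1..Suc d. 1 - fps_X ^ j)) * partition_fps d"
    by (simp add: mult_ac)
  then have "partition_fps (Suc d) * (1 - fps_X ^ Suc d) = partition_fps d"
    by (simp only: partition_fps_inverse mult.commute[of _ "partition_fps d"] mult_1 mult_1_right)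
  then have "partition_fps (Suc d) = partition_fps d + fps_X ^ Suc d * partition_fps (Suc d)"
    by (simp add: algebra_simps)
  then have "fps_nth (partition_fps (Suc d)) n = fps_nth (partition_fps d + fps_X ^ Suc d * partition_fps (Suc d)) n"
    by simp
  then show ?thesis by (simp add: fps_X_power_mult_nth del: power_Suc)
qed

lemma power_Suc_diff_bounds:
  fixes x y :: real
  assumes "0 \<le> x" "x \<le> y"
  shows "real (Suc k) * (y - x) * x ^ k \<le> y ^ Suc k - x ^ Suc k"
    and "y ^ Suc k - x ^ Suc k \<le> real (Suc k) * (y - x) * y ^ k"
proof (induction k)
  case (Suc k)
  have split: "y ^ Suc (Suc k) - x ^ Suc (Suc k) = y * (y ^ Suc k - x ^ Suc k) + (y - x) * x ^ Suc k"
    by (simp add: algebra_simps)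
  {
    case 1
    have "x * (real (Suc k) * (y - x) * x ^ k) \<le> y * (y ^ Suc k - x ^ Suc k)"
      using assms Suc by (intro mult_mono) auto
    then show ?case unfolding split by (simp add: algebra_simps)
  next
    case 2
    have "y * (y ^ Suc k - x ^ Suc k) \<le> y * (real (Suc k) * (y - x) * y ^ k)"
      using assms Suc by (intro mult_left_mono) auto
    moreover have "(y - x) * x ^ Suc k \<le> (y - x) * y ^ Suc k"
      using assms by (intro mult_left_mono power_mono) auto
    ultimately show ?case unfolding split by (simp add: algebra_simps)
  }
qed auto

lemma partition_fps_0: "partition_fps 0 = 1" by (simp add: partition_fps_def)

lemma partition_fps_1_nth: "fps_nth (partition_fps (Suc 0)) n = 1"
  by (induction n) (subst partition_fps_Suc_nth, simp add: partition_fps_0)+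

text \<open>
Both bounds satisfy, as inequalities, the recursion of \<open>partition_fps_Suc_nth\<close>: the increment
of a power over a step of length \<open>Suc d\<close> lies between the values of its derivative at the two ends.
The shift \<open>real (Suc d * (d + 2)) / 2\<close> is the sum of the numbers \<open>1, \<dots>, Suc d\<close>; passing to one
more part adds just the length of the new step.
\<close>

lemma partition_fps_bounds:
  "real n ^ d / (fact (Suc d) * fact d) \<le> fps_nth (partition_fps (Suc d)) n"
  "fps_nth (partition_fps (Suc d)) n \<le> (real n + real (Suc d * (d + 2)) / 2) ^ d / (fact (Suc d) * fact d)"
proof (induction d arbitrary: n)
  case 0
  { case 1 then show ?case by (simp add: partition_fps_1_nth)
  next case 2 then show ?case by (simp add: partition_fps_1_nth) }
next
  case (Suc d)
  let ?D = "Suc (Suc d)" and ?C = "fact (Suc d) * fact d :: real"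
  have C: "fact ?D * fact (Suc d) = real ?D * real (Suc d) * ?C" by (simp add: mult_ac)
  have C0: "?C > 0" by simp
  define s where "s = real (?D * (Suc d + 2)) / 2"
  have s: "s = real (Suc d * (d + 2)) / 2 + real ?D" by (simp add: s_def field_simps)
  {
    case 1
    show ?case
    proof (induction n rule: less_induct)
      case (less n)
      have IH: "real n ^ d / ?C \<le> fps_nth (partition_fps (Suc d)) n" by (rule Suc.IH)
      show ?case
      proof (cases "n < ?D")
        case True
        have "real n * real n ^ d \<le> (real ?D * real (Suc d)) * real n ^ d"
        proof (intro mult_right_mono)
          have "real n * 1 \<le> real ?D * real (Suc d)" using True by (intro mult_mono) auto
          then show "real n \<le> real ?D * real (Suc d)" by simp
        qed auto
        then have "real n ^ Suc d / (real ?D * real (Suc d) * ?C) \<le> real n ^ d / ?C"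
          using C0 by (simp add: divide_simps del: of_nat_Suc fact_Suc) (simp add: mult_ac)
        then show ?thesis using IH True unfolding C by (simp add: partition_fps_Suc_nth[of "Suc d"] del: of_nat_Suc fact_Suc)
      next
        case False
        have "real n ^ Suc d - (real n - real ?D) ^ Suc d \<le> real (Suc d) * real ?D * real n ^ d"
          using power_Suc_diff_bounds(2)[of "real n - real ?D" "real n" d] False by simp
        then have "(real n ^ Suc d - (real n - real ?D) ^ Suc d) / (real ?D * real (Suc d) * ?C) \<le> (real (Suc d) * real ?D * real n ^ d) / (real ?D * real (Suc d) * ?C)"
          by (intro divide_right_mono) auto
        also have "\<dots> = real n ^ d / ?C" by (simp del: of_nat_Suc fact_Suc)
        finally have "real n ^ Suc d / (fact ?D * fact (Suc d)) \<le> real n ^ d / ?C + (real n - real ?D) ^ Suc d / (fact ?D * fact (Suc d))"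
          unfolding C by (simp add: diff_divide_distrib del: of_nat_Suc fact_Suc)
        also have "(real n - real ?D) ^ Suc d / (fact ?D * fact (Suc d)) \<le> fps_nth (partition_fps ?D) (n - ?D)"
          using less[of "n - ?D"] False by (simp add: of_nat_diff del: of_nat_Suc fact_Suc)
        finally show ?thesis using IH False by (subst partition_fps_Suc_nth) simp
      qed
    qed
  next
    case 2
    show ?case unfolding s_def[symmetric]
    proof (induction n rule: less_induct)
      case (less n)
      have IH: "fps_nth (partition_fps (Suc d)) n \<le> (real n + s - real ?D) ^ d / ?C"
        using Suc.IH(2)[of n] unfolding s by simp
      have sD: "s \<ge> real ?D" by (simp add: s)
      have "real (Suc d) * real ?D * (real n + s - real ?D) ^ d \<le> (real n + s) ^ Suc d - (real n + s - real ?D) ^ Suc d"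
        using power_Suc_diff_bounds(1)[of "real n + s - real ?D" "real n + s" d] sD by simp
      then have "(real (Suc d) * real ?D * (real n + s - real ?D) ^ d) / (real ?D * real (Suc d) * ?C) \<le>
          ((real n + s) ^ Suc d - (real n + s - real ?D) ^ Suc d) / (real ?D * real (Suc d) * ?C)"
        by (intro divide_right_mono) auto
      also have "(real (Suc d) * real ?D * (real n + s - real ?D) ^ d) / (real ?D * real (Suc d) * ?C) = (real n + s - real ?D) ^ d / ?C"
        by (simp del: of_nat_Suc fact_Suc)
      finally have main: "fps_nth (partition_fps (Suc d)) n + (real n + s - real ?D) ^ Suc d / (fact ?D * fact (Suc d)) \<le> (real n + s) ^ Suc d / (fact ?D * fact (Suc d))"
        using IH unfolding C by (simp add: diff_divide_distrib del: of_nat_Suc fact_Suc)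
      show ?case
      proof (cases "n < ?D")
        case True
        have "0 \<le> (real n + s - real ?D) ^ Suc d / (fact ?D * fact (Suc d))"
          using sD by (intro divide_nonneg_nonneg zero_le_power) auto
        then show ?thesis using main True by (subst partition_fps_Suc_nth) (simp del: of_nat_Suc fact_Suc power_Suc)
      next
        case False
        have "fps_nth (partition_fps ?D) (n - ?D) \<le> (real n + s - real ?D) ^ Suc d / (fact ?D * fact (Suc d))"
          using less[of "n - ?D"] False by (simp add: of_nat_diff algebra_simps del: of_nat_Suc fact_Suc power_Suc)
        then show ?thesis using main False by (subst partition_fps_Suc_nth) (simp del: of_nat_Suc fact_Suc power_Suc)
      qed
    qed
  }
qed

section \<open>Asymptotics of the middle coefficient\<close>

lemma partition_fps_asymptotics:
  assumes "(\<lambda>i. real (n i) / real i) \<longlonglongrightarrow> a"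
  shows "(\<lambda>i. fps_nth (partition_fps (Suc d)) (n i) / real i ^ d) \<longlonglongrightarrow> a ^ d / (fact (Suc d) * fact d)"
proof (rule real_tendsto_sandwich)
  define s where "s = real (Suc d * (d + 2)) / 2"
  let ?C = "fact (Suc d) * fact d :: real"
  show "\<forall>\<^sub>F i in sequentially. (real (n i) / real i) ^ d / ?C \<le> fps_nth (partition_fps (Suc d)) (n i) / real i ^ d"
  proof (rule always_eventually, rule allI)
    fix i
    have "real (n i) ^ d / ?C / real i ^ d \<le> fps_nth (partition_fps (Suc d)) (n i) / real i ^ d"
      by (intro divide_right_mono partition_fps_bounds) auto
    then show "(real (n i) / real i) ^ d / ?C \<le> fps_nth (partition_fps (Suc d)) (n i) / real i ^ d"
      by (simp only: power_divide divide_divide_eq_left mult.commute)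
  qed
  show "\<forall>\<^sub>F i in sequentially. fps_nth (partition_fps (Suc d)) (n i) / real i ^ d \<le> (real (n i) / real i + s * (1 / real i)) ^ d / ?C"
  proof (rule always_eventually, rule allI)
    fix i
    have "fps_nth (partition_fps (Suc d)) (n i) / real i ^ d \<le> (real (n i) + s) ^ d / ?C / real i ^ d"
      unfolding s_def by (intro divide_right_mono partition_fps_bounds) auto
    also have "\<dots> = ((real (n i) + s) / real i) ^ d / ?C"
      by (simp only: power_divide divide_divide_eq_left mult.commute)
    also have "(real (n i) + s) / real i = real (n i) / real i + s * (1 / real i)" by (simp add: add_divide_distrib)
    finally show "fps_nth (partition_fps (Suc d)) (n i) / real i ^ d \<le> (real (n i) / real i + s * (1 / real i)) ^ d / ?C" .
  qed
  show "(\<lambda>i. (real (n i) / real i) ^ d / ?C) \<longlonglongrightarrow> a ^ d / ?C"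
    by (intro tendsto_divide tendsto_power assms tendsto_const) simp
  have "(\<lambda>i. (real (n i) / real i + s * (1 / real i)) ^ d / ?C) \<longlonglongrightarrow> (a + s * 0) ^ d / ?C"
    by (intro tendsto_divide tendsto_power tendsto_add tendsto_mult assms tendsto_const lim_1_over_n) simp
  then show "(\<lambda>i. (real (n i) / real i + s * (1 / real i)) ^ d / ?C) \<longlonglongrightarrow> a ^ d / ?C" by simp
qed

text \<open>
The set \<open>A\<close> records from which factors of the numerator in \<open>box_fps_product\<close> the power of \<open>q\<close>
is taken.
\<close>

lemma box_count_inclusion_exclusion:
  "real (box_count d i h) = (\<Sum>A\<in>Pow {1..d}. (-1) ^ card A *
     (if h < (\<Sum>j\<in>A. i + j) then 0 else fps_nth (partition_fps d) (h - (\<Sum>j\<in>A. i + j))))"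
proof -
  have "box_fps d i = box_fps d i * (\<Prod>j=1..d. 1 - fps_X ^ j) * partition_fps d"
    using partition_fps_inverse[of d] by (simp add: mult.assoc mult.commute[of _ "partition_fps d"])
  also have "\<dots> = (\<Sum>A\<in>Pow {1..d}. (-1) ^ card A * (fps_X ^ (\<Sum>j\<in>A. i + j) * partition_fps d))"
    unfolding box_fps_product by (subst prod_diff_conv_sum) (simp_all add: power_sum sum_distrib_right mult.assoc)
  finally have "fps_nth (box_fps d i) h = (\<Sum>A\<in>Pow {1..d}. fps_nth ((-1) ^ card A * (fps_X ^ (\<Sum>j\<in>A. i + j) * partition_fps d)) h)"
    by (simp add: fps_sum_nth)
  moreover have "fps_nth ((-1) ^ k * F) h = (-1) ^ k * fps_nth F h" for k and F :: "real fps"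
    by (cases "even k") simp_all
  ultimately show ?thesis
    unfolding box_fps_def by (simp add: fps_X_power_mult_nth)
qed

text \<open>
In \<open>box_count_inclusion_exclusion\<close> a set of \<open>j\<close> elements shifts the middle index \<open>h\<close> by
about \<open>i * j\<close>. For \<open>j < Suc d / 2\<close> the rest grows linearly with slope \<open>Suc d / 2 - j\<close>; for
\<open>j \<ge> Suc d / 2\<close> it is negative and the term vanishes.
\<close>

lemma middle_box_count_asymptotics:
  "(\<lambda>i. real (box_count (Suc d) i ((Suc d * i + 1) div 2)) / real i ^ d) \<longlonglongrightarrow>
     (\<Sum>j | real j < real (Suc d) / 2. (-1) ^ j * real (Suc d choose j) * (real (Suc d) / 2 - real j) ^ d)
       / (fact (Suc d) * fact d)"
proof -
  let ?D = "Suc d" and ?C = "fact (Suc d) * fact d :: real"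
  define h where "h i = (?D * i + 1) div 2" for i
  define f where "f j = (if real j < real ?D / 2 then (real ?D / 2 - real j) ^ d else 0)" for j
  have lim: "(\<lambda>i. (if h i < (\<Sum>j\<in>A. i + j) then 0 else fps_nth (partition_fps ?D) (h i - (\<Sum>j\<in>A. i + j))) / real i ^ d)
      \<longlonglongrightarrow> f (card A) / ?C" if A: "A \<subseteq> {1..?D}" for A
  proof -
    have finA: "finite A" using A finite_subset by blast
    define s where "s = \<Sum>A"
    have sumA: "(\<Sum>j\<in>A. i + j) = card A * i + s" for i by (simp add: sum.distrib s_def)
    show ?thesis
    proof (cases "2 * card A < ?D")
      case True
      have ev: "\<forall>\<^sub>F i in sequentially. card A * i + s \<le> h i"
        using eventually_ge_at_top[of "2 * s"]
      proof eventually_elim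
        case (elim i)
        have "(2 * card A + 1) * i \<le> ?D * i" using True by (intro mult_right_mono) auto
        then have "2 * (card A * i + s) \<le> ?D * i"
          using elim by (simp only: add_mult_distrib2 add_mult_distrib mult.assoc mult_1)
        moreover have "x \<le> (y + 1) div 2" if "2 * x \<le> y" for x y :: nat using that by linarith
        ultimately show ?case unfolding h_def by blast
      qed
      have "(\<lambda>i. real (h i - (card A * i + s)) / real i) \<longlonglongrightarrow> real ?D / 2 - real (card A)"
      proof (rule Lim_transform_eventually)
        have half: "\<bar>real (h i) - real ?D * real i / 2\<bar> \<le> 1 / 2" for i
        proof -
          have "2 * h i = ?D * i \<or> 2 * h i = ?D * i + 1" unfolding h_def by presburger
          then have "real (2 * h i) = real (?D * i) \<or> real (2 * h i) = real (?D * i + 1)" by metis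
          then have "2 * real (h i) = real ?D * real i \<or> 2 * real (h i) = real ?D * real i + 1"
            by (simp only: of_nat_mult of_nat_add of_nat_1 of_nat_numeral)
          then show ?thesis by (auto simp: abs_if simp del: of_nat_Suc)
        qed
        have "(\<lambda>i. (real (h i) - real ?D * real i / 2) * (1 / real i)) \<longlonglongrightarrow> 0"
          by (rule lim_null_mult_left_bounded[OF _ lim_1_over_n, of _ "1/2"]) (use half in auto)
        then have "(\<lambda>i. real ?D / 2 - real (card A) + (real (h i) - real ?D * real i / 2) * (1 / real i) - real s * (1 / real i))
          \<longlonglongrightarrow> real ?D / 2 - real (card A) + 0 - real s * 0"
          by (intro tendsto_add tendsto_diff tendsto_mult tendsto_const lim_1_over_n)
        then show "(\<lambda>i. real ?D / 2 - real (card A) + (real (h i) - real ?D * real i / 2) * (1 / real i) - real s * (1 / real i))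
          \<longlonglongrightarrow> real ?D / 2 - real (card A)" by simp
        show "\<forall>\<^sub>F i in sequentially. real ?D / 2 - real (card A) + (real (h i) - real ?D * real i / 2) * (1 / real i) - real s * (1 / real i)
          = real (h i - (card A * i + s)) / real i"
          using ev eventually_gt_at_top[of 0]
          by eventually_elim (simp add: of_nat_diff field_simps del: of_nat_Suc)
      qed
      from partition_fps_asymptotics[OF this, of d]
      have "(\<lambda>i. fps_nth (partition_fps ?D) (h i - (card A * i + s)) / real i ^ d) \<longlonglongrightarrow> f (card A) / ?C"
        using True by (simp add: f_def del: of_nat_Suc fact_Suc)
      then show ?thesis unfolding sumA
        by (rule Lim_transform_eventually) (use ev in eventually_elim, simp)
    next
      case False
      \<comment> \<open>Since \<open>A\<close> is not empty, \<open>s\<close> is positive; this settles the boundary case \<open>2 * card A = ?D\<close>.\<close>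
      then have "A \<noteq> {}" by auto
      then obtain x where x: "x \<in> A" by blast
      then have "1 \<le> x" using A by auto
      also have "x \<le> s" unfolding s_def using member_le_sum[of x A "\<lambda>x. x"] x finA by simp
      finally have "1 \<le> s" .
      moreover have "?D * i \<le> 2 * (card A * i)" for i
        unfolding mult.assoc[symmetric] using False by (intro mult_right_mono) auto
      moreover have "(y + 1) div 2 < x + t" if "1 \<le> t" "y \<le> 2 * x" for x y t :: nat
        using that by linarith
      ultimately have "h i < card A * i + s" for i unfolding h_def by blast
      moreover have "f (card A) = 0" using False by (auto simp: f_def)
      ultimately show ?thesis unfolding sumA by simp
    qed
  qed
  have "(\<lambda>i. \<Sum>A\<in>Pow {1..?D}. (-1) ^ card A * ((if h i < (\<Sum>j\<in>A. i + j) then 0 else fps_nth (partition_fps ?D) (h i - (\<Sum>j\<in>A. i + j))) / real i ^ d))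
     \<longlonglongrightarrow> (\<Sum>A\<in>Pow {1..?D}. (-1) ^ card A * (f (card A) / ?C))"
    by (intro tendsto_sum tendsto_mult tendsto_const lim) auto
  moreover have "(\<Sum>A\<in>Pow {1..?D}. (-1) ^ card A * ((if h i < (\<Sum>j\<in>A. i + j) then 0 else fps_nth (partition_fps ?D) (h i - (\<Sum>j\<in>A. i + j))) / real i ^ d))
     = real (box_count ?D i (h i)) / real i ^ d" for i
    unfolding box_count_inclusion_exclusion sum_divide_distrib times_divide_eq_right by (rule refl)
  ultimately have "(\<lambda>i. real (box_count ?D i (h i)) / real i ^ d) \<longlonglongrightarrow> (\<Sum>A\<in>Pow {1..?D}. (-1) ^ card A * (f (card A) / ?C))"
    by (simp only:)
  also have "(\<Sum>A\<in>Pow {1..?D}. (-1) ^ card A * (f (card A) / ?C)) = (\<Sum>j\<le>?D. real (?D choose j) * ((-1) ^ j * (f j / ?C)))"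
  proof -
    have "(\<Sum>A\<in>Pow {1..?D}. (-1) ^ card A * (f (card A) / ?C)) = (\<Sum>j\<le>?D. \<Sum>A | A \<in> Pow {1..?D} \<and> card A = j. (-1) ^ card A * (f (card A) / ?C))"
    proof (rule sum.group[symmetric])
      have "card A \<le> ?D" if "A \<subseteq> {1..?D}" for A
        using card_mono[OF _ that] by simp
      then show "card ` Pow {1..?D} \<subseteq> {..?D}" by (simp add: image_subset_iff)
    qed simp_all
    also have "\<dots> = (\<Sum>j\<le>?D. real (?D choose j) * ((-1) ^ j * (f j / ?C)))"
      using n_subsets[of "{1..?D}"] by (intro sum.cong refl) (simp del: of_nat_Suc fact_Suc binomial_Suc_Suc)
    finally show ?thesis .
  qed
  also have "\<dots> = (\<Sum>j | real j < real ?D / 2. (-1) ^ j * real (?D choose j) * (real ?D / 2 - real j) ^ d) / ?C"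
    unfolding sum_divide_distrib
    by (rule sum.mono_neutral_cong_right) (auto simp: f_def mult_ac)
  finally show ?thesis unfolding h_def .
qed

lemma card_degree_exps_le: "card (degree_exps d i) \<le> (d * i + 1) * box_count d i ((d * i + 1) div 2)"
proof -
  have "degree_exps d i = (\<Union>h\<in>{..d * i}. {m \<in> degree_exps d i. index_sum d m = h})"
    using index_sum_le by auto
  then have "card (degree_exps d i) \<le> (\<Sum>h\<le>d * i. card {m \<in> degree_exps d i. index_sum d m = h})"
    by (metis card_UN_le finite_atMost)
  also have "\<dots> \<le> (\<Sum>h\<le>d * i. box_count d i ((d * i + 1) div 2))"
    by (intro sum_mono) (use box_count_le_middle in \<open>simp add: box_count_def\<close>)
  finally show ?thesis by simp
qed

text \<open>
The exponents of the indices \<open>1, \<dots>, d\<close> may be chosen freely up to \<open>i div d\<close>; that of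
index \<open>0\<close> fills up the degree.
\<close>

lemma card_degree_exps_ge:
  assumes "d \<ge> 1"
  shows "(i div d + 1) ^ d \<le> card (degree_exps d i)"
proof -
  let ?P = "PiE {1..d} (\<lambda>_. {..i div d})"
  let ?g = "\<lambda>f k. if k = 0 then i - (\<Sum>k=1..d. f k) else if k \<le> d then f k else 0"
  have sum_split: "(\<Sum>k\<le>d. m k) = m 0 + (\<Sum>k=1..d. m k)" for m :: "nat \<Rightarrow> nat"
    by (simp add: sum.atLeast_Suc_atMost atMost_atLeast0)
  have "inj_on ?g ?P"
  proof (rule inj_onI)
    fix f f' assume f: "f \<in> ?P" "f' \<in> ?P" and eq: "?g f = ?g f'"
    show "f = f'"
    proof
      fix k
      show "f k = f' k"
      proof (cases "k \<in> {1..d}")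
        case True
        then have "k \<noteq> 0" "k \<le> d" by auto
        then show ?thesis using fun_cong[OF eq, of k] by (simp only: if_False if_True)
      next
        case False
        then show ?thesis using f(1)[THEN PiE_arb] f(2)[THEN PiE_arb] by metis
      qed
    qed
  qed
  moreover have "?g ` ?P \<subseteq> degree_exps d i"
  proof (rule image_subsetI)
    fix f assume "f \<in> ?P"
    then have "(\<Sum>k=1..d. f k) \<le> (\<Sum>k=1..d. i div d)" by (intro sum_mono) (auto simp: PiE_iff)
    also have "\<dots> \<le> i" by (simp add: mult.commute)
    finally have "(\<Sum>k=1..d. f k) \<le> i" .
    moreover have "(\<Sum>k=1..d. ?g f k) = (\<Sum>k=1..d. f k)" by (intro sum.cong) auto
    ultimately have "(\<Sum>k\<le>d. ?g f k) = i" unfolding sum_split by simp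
    then show "?g f \<in> degree_exps d i" by (auto simp: degree_exps_def)
  qed
  ultimately have "card ?P \<le> card (degree_exps d i)" by (intro card_inj_on_le finite_degree_exps)
  then show ?thesis by (simp add: card_PiE)
qed

text \<open>
The largest of the \<open>d * i + 1\<close> coefficients is at least their mean.
\<close>

lemma middle_box_count_ge:
  assumes "d \<ge> 1" "i \<ge> 1"
  shows "real (box_count d i ((d * i + 1) div 2)) / real i ^ (d - 1) \<ge> 1 / (real d ^ d * (real d + 1))"
proof -
  let ?N = "real (box_count d i ((d * i + 1) div 2))"
  have "i \<le> d * (i div d + 1)"
    using dividend_less_times_div[of d i] assms(1) by (simp add: add.commute)
  then have "real i \<le> real (d * (i div d + 1))" by (simp only: of_nat_le_iff)
  then have "real i / real d \<le> real (i div d) + 1"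
    using assms(1) by (simp add: divide_le_eq algebra_simps)
  then have "(real i / real d) ^ d \<le> (real (i div d) + 1) ^ d" by (intro power_mono) auto
  also have "\<dots> = real ((i div d + 1) ^ d)" by (simp add: add.commute)
  also have "\<dots> \<le> real ((d * i + 1) * box_count d i ((d * i + 1) div 2))"
    using card_degree_exps_ge[OF assms(1), of i] card_degree_exps_le[of d i] by (simp only: of_nat_le_iff)
  also have "\<dots> \<le> ((real d + 1) * real i) * ?N"
    unfolding of_nat_mult using assms(2) by (intro mult_right_mono) (auto simp: algebra_simps)
  finally have "real i ^ d \<le> real d ^ d * (real d + 1) * real i * ?N"
    using assms by (simp add: power_divide divide_le_eq mult_ac)
  moreover have "real i ^ d = real i * real i ^ (d - 1)" using assms by (cases d) auto
  ultimately have "real i ^ (d - 1) \<le> real d ^ d * (real d + 1) * ?N" using assms by (simp add: mult_ac)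
  then have "real i ^ (d - 1) / (real d ^ d * (real d + 1)) \<le> ?N"
    using assms by (subst pos_divide_le_eq) (auto simp: mult_ac)
  then have "real i ^ (d - 1) / (real d ^ d * (real d + 1)) / real i ^ (d - 1) \<le> ?N / real i ^ (d - 1)"
    by (intro divide_right_mono) auto
  then show ?thesis using assms(2) by simp
qed

section \<open>An Abelian theorem\<close>

lemma sums_choose:
  fixes z :: real
  assumes "\<bar>z\<bar> < 1"
  shows "(\<lambda>n. real (n + k choose k) * z ^ n) sums (1 / (1 - z) ^ Suc k)"
proof -
  have "(\<lambda>n. ((- (real k + 1)) gchoose n) * (- z) ^ n) sums (1 + - z) powr (- (real k + 1))"
    by (rule gen_binomial_real) (use assms in auto)
  moreover have "((- (real k + 1)) gchoose n) * (- z) ^ n = real (n + k choose k) * z ^ n" for n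
  proof -
    have "((- (real k + 1)) gchoose n) = (-1) ^ n * (real (n + k) gchoose n)"
      by (subst gbinomial_minus) (simp add: add_ac)
    also have "real (n + k) gchoose n = real (n + k choose k)"
      unfolding binomial_gbinomial[symmetric] by (subst binomial_symmetric) simp_all
    finally show ?thesis by (subst power_minus) (simp add: mult_ac flip: power_add power_mult_distrib)
  qed
  moreover have "(1 + - z) powr (- (real k + 1)) = 1 / (1 - z) ^ Suc k"
  proof -
    have e: "- (real k + 1) = - real (Suc k)" by simp
    show ?thesis unfolding e powr_minus_divide
      using assms by (simp add: powr_realpow del: of_nat_Suc power_Suc)
  qed
  ultimately show ?thesis by simp
qed

lemma binomial_asymptotics: "(\<lambda>n. real (n + k choose k) / real n ^ k) \<longlonglongrightarrow> 1 / fact k"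
proof (induction k)
  case (Suc k)
  have step: "real (n + Suc k choose Suc k) / real n ^ Suc k = (real (n + k choose k) / real n ^ k) * ((1 + real (Suc k) * (1 / real n)) / real (Suc k))"
    if "n > 0" for n
  proof -
    have "Suc k * (Suc (n + k) choose Suc k) = Suc (n + k) * (n + k choose k)"
      by (rule Suc_times_binomial)
    then have "real (Suc k) * real (n + Suc k choose Suc k) = real (Suc (n + k)) * real (n + k choose k)"
      by (simp only: add_Suc_right flip: of_nat_mult)
    then have eq: "real (n + Suc k choose Suc k) = real (Suc (n + k)) * real (n + k choose k) / real (Suc k)"
      by (simp add: eq_divide_eq mult.commute del: of_nat_Suc binomial_Suc_Suc)
    have alg: "s * c / K / x ^ Suc k = c / x ^ k * ((1 + K * (1 / x)) / K)"
      if "s = x + K" "x > 0" "K > 0" for s c K x :: real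
      using that by (simp add: field_simps)
    show ?thesis unfolding eq by (rule alg) (use that in auto)
  qed
  have ev: "\<forall>\<^sub>F n in sequentially. (real (n + k choose k) / real n ^ k) * ((1 + real (Suc k) * (1 / real n)) / real (Suc k)) 
      = real (n + Suc k choose Suc k) / real n ^ Suc k"
    using eventually_gt_at_top[of 0] by eventually_elim (rule step[symmetric])
  have "(\<lambda>n. (real (n + k choose k) / real n ^ k) * ((1 + real (Suc k) * (1 / real n)) / real (Suc k))) \<longlonglongrightarrow>
     1 / fact k * ((1 + real (Suc k) * 0) / real (Suc k))"
    by (intro tendsto_mult Suc.IH tendsto_divide tendsto_add tendsto_const lim_1_over_n) simp
  then have "(\<lambda>n. (real (n + k choose k) / real n ^ k) * ((1 + real (Suc k) * (1 / real n)) / real (Suc k))) \<longlonglongrightarrow> 1 / fact (Suc k)"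
    by (simp add: mult.commute)
  then show ?case using ev by (rule Lim_transform_eventually)
qed simp

text \<open>
The coefficients are compared with \<open>n + k choose k\<close>, whose generating function is exactly
\<open>1 / (1 - z) ^ Suc k\<close>. Finitely many terms do not matter, as \<open>(1 - z) ^ Suc k\<close> tends to \<open>0\<close>.
\<close>

lemma abelian_limit:
  fixes a :: "nat \<Rightarrow> real"
  assumes a: "(\<lambda>n. a n / real n ^ k) \<longlonglongrightarrow> L"
  shows "((\<lambda>z. (1 - z) ^ Suc k * (\<Sum>n. a n * z ^ n)) \<longlongrightarrow> fact k * L) (at_left 1)"
proof -
  define b where "b n = real (n + k choose k)" for n
  have bpos: "b n > 0" for n by (simp add: b_def)
  have ratio: "(\<lambda>n. a n / b n) \<longlonglongrightarrow> fact k * L"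
  proof (rule Lim_transform_eventually)
    have "(\<lambda>n. (a n / real n ^ k) / (b n / real n ^ k)) \<longlonglongrightarrow> L / (1 / fact k)"
      unfolding b_def by (intro tendsto_divide a binomial_asymptotics) simp
    then show "(\<lambda>n. (a n / real n ^ k) / (b n / real n ^ k)) \<longlonglongrightarrow> fact k * L" by (simp add: mult.commute)
    show "\<forall>\<^sub>F n in sequentially. (a n / real n ^ k) / (b n / real n ^ k) = a n / b n"
      using eventually_gt_at_top[of 0] by eventually_elim simp
  qed
  define M where "M = fact k * L"
  show ?thesis unfolding M_def[symmetric]
  proof (rule tendstoI)
    fix e :: real assume e: "e > 0"
    obtain K where K: "\<And>n. n \<ge> K \<Longrightarrow> \<bar>a n / b n - M\<bar> < e / 2"
      using LIMSEQ_D[OF ratio, of "e / 2"] e unfolding M_def by auto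
    define C where "C = (\<Sum>n<K. \<bar>a n - M * b n\<bar>)"
    have bd: "\<bar>a n - M * b n\<bar> \<le> e / 2 * b n" if "n \<ge> K" for n
    proof -
      have "\<bar>a n / b n - M\<bar> * b n \<le> e / 2 * b n" using K[OF that] bpos[of n] by (intro mult_right_mono) auto
      moreover have "\<bar>a n / b n - M\<bar> * b n = \<bar>a n - M * b n\<bar>"
      proof -
        have "\<bar>a n / b n - M\<bar> * b n = \<bar>(a n / b n - M) * b n\<bar>" using bpos[of n] by (simp add: abs_mult)
        also have "(a n / b n - M) * b n = a n - M * b n" using bpos[of n] by (simp add: left_diff_distrib)
        finally show ?thesis .
      qed
      ultimately show ?thesis by simp
    qed
    have main: "\<bar>(1 - z) ^ Suc k * (\<Sum>n. a n * z ^ n) - M\<bar> \<le> (1 - z) ^ Suc k * C + e / 2" if z: "0 < z" "z < 1" for z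
    proof -
      have sb: "(\<lambda>n. b n * z ^ n) sums (1 / (1 - z) ^ Suc k)" unfolding b_def using z by (intro sums_choose) auto
      \<comment> \<open>A summable majorant: the first \<open>K\<close> terms are bounded crudely, the others by the asymptotic ratio.\<close>
      define t where "t n = (if n < K then \<bar>a n - M * b n\<bar> else 0) + e / 2 * (b n * z ^ n)" for n
      have st: "t sums (C + e / 2 * (1 / (1 - z) ^ Suc k))"
        unfolding t_def C_def
        by (intro sums_add sums_mult sb) (use sums_If_finite_set[of "{..<K}" "\<lambda>n. \<bar>a n - M * b n\<bar>"] in simp)
      have le: "\<bar>(a n - M * b n) * z ^ n\<bar> \<le> t n" for n
      proof (cases "n < K")
        case True
        have "\<bar>(a n - M * b n) * z ^ n\<bar> \<le> \<bar>a n - M * b n\<bar>"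
          using z by (simp add: abs_mult mult_left_le power_le_one)
        moreover have "0 \<le> e / 2 * (b n * z ^ n)" using e bpos[of n] z by (intro mult_nonneg_nonneg) auto
        ultimately show ?thesis using True by (simp add: t_def)
      next
        case False
        have "\<bar>(a n - M * b n) * z ^ n\<bar> = \<bar>a n - M * b n\<bar> * z ^ n" using z by (simp add: abs_mult)
        also have "\<dots> \<le> (e / 2 * b n) * z ^ n" using False bd[of n] z by (intro mult_right_mono) auto
        finally show ?thesis using False by (simp add: t_def mult.assoc)
      qed
      have sm: "summable (\<lambda>n. (a n - M * b n) * z ^ n)"
        by (rule summable_comparison_test'[OF sums_summable[OF st], of 0]) (use le in auto)
      have "\<bar>\<Sum>n. (a n - M * b n) * z ^ n\<bar> \<le> C + e / 2 * (1 / (1 - z) ^ Suc k)"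
      proof -
        have sabs: "summable (\<lambda>n. \<bar>(a n - M * b n) * z ^ n\<bar>)"
          by (rule summable_comparison_test'[OF sums_summable[OF st], of 0]) (use le in auto)
        have "\<bar>\<Sum>n. (a n - M * b n) * z ^ n\<bar> \<le> (\<Sum>n. \<bar>(a n - M * b n) * z ^ n\<bar>)" by (rule summable_rabs[OF sabs])
        also have "\<dots> \<le> (\<Sum>n. t n)" by (rule suminf_le[OF le sabs sums_summable[OF st]])
        finally show ?thesis using sums_unique[OF st] by simp
      qed
      moreover have "(\<Sum>n. a n * z ^ n) = (\<Sum>n. (a n - M * b n) * z ^ n) + M * (1 / (1 - z) ^ Suc k)"
      proof -
        have "(\<lambda>n. (a n - M * b n) * z ^ n + M * (b n * z ^ n)) sums ((\<Sum>n. (a n - M * b n) * z ^ n) + M * (1 / (1 - z) ^ Suc k))"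
          by (intro sums_add sums_mult sb summable_sums sm)
        then show ?thesis by (simp add: algebra_simps sums_iff)
      qed
      moreover have p: "(1 - z) ^ Suc k > 0" using z by (intro zero_less_power) simp
      ultimately have "\<bar>(1 - z) ^ Suc k * (\<Sum>n. a n * z ^ n) - M\<bar> = (1 - z) ^ Suc k * \<bar>\<Sum>n. (a n - M * b n) * z ^ n\<bar>"
        using z by (simp add: distrib_left abs_mult del: power_Suc)
      also have "\<dots> \<le> (1 - z) ^ Suc k * (C + e / 2 * (1 / (1 - z) ^ Suc k))"
        using p \<open>\<bar>\<Sum>n. (a n - M * b n) * z ^ n\<bar> \<le> _\<close> by (intro mult_left_mono) auto
      also have "\<dots> = (1 - z) ^ Suc k * C + e / 2" using p z by (simp add: distrib_left del: power_Suc)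
      finally show ?thesis .
    qed
    have "((\<lambda>z. (1 - z) ^ Suc k * C) \<longlongrightarrow> (1 - 1) ^ Suc k * C) (at_left (1::real))"
      by (intro tendsto_intros)
    then have "\<forall>\<^sub>F z in at_left (1::real). (1 - z) ^ Suc k * C < e / 2"
      using e by (intro order_tendstoD(2)[where y = 0]) auto
    moreover have "\<forall>\<^sub>F z in at_left (1::real). z \<in> {0<..<1}"
      by (rule eventually_at_left_real) simp
    ultimately show "\<forall>\<^sub>F z in at_left 1. dist ((1 - z) ^ Suc k * (\<Sum>n. a n * z ^ n)) M < e"
    proof eventually_elim
      case (elim z)
      then show ?case using main[of z] by (auto simp: dist_real_def)
    qed
  qed
qed

section \<open>The integral of a power of the sinc function\<close>

text \<open>
The sum is a \<open>d\<close>-fold difference, and each difference lowers the degree.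
\<close>

lemma alternating_binomial_sum_poly:
  fixes p :: "'a::{idom,ring_char_0} poly"
  assumes "degree p < d"
  shows "(\<Sum>j\<le>d. (-1) ^ j * of_nat (d choose j) * poly p (of_nat j)) = 0"
  using assms
proof (induction d arbitrary: p)
  case (Suc d)
  define q where "q = p - pcompose p [:1, 1:]"
  have split: "(\<Sum>j\<le>Suc d. (-1) ^ j * of_nat (Suc d choose j) * f j) =
      (\<Sum>j\<le>d. (-1) ^ j * of_nat (d choose j) * (f j - f (Suc j)))" for f :: "nat \<Rightarrow> 'a"
  proof -
    have "(\<Sum>j\<le>Suc d. (-1) ^ j * of_nat (Suc d choose j) * f j) =
        f 0 + (\<Sum>j\<le>d. (-1) ^ Suc j * of_nat (Suc d choose Suc j) * f (Suc j))"
      by (subst sum.atMost_Suc_shift) simp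
    also have "(\<Sum>j\<le>d. (-1) ^ Suc j * of_nat (Suc d choose Suc j) * f (Suc j)) =
       (\<Sum>j\<le>d. (-1) ^ Suc j * of_nat (d choose Suc j) * f (Suc j)) - (\<Sum>j\<le>d. (-1) ^ j * of_nat (d choose j) * f (Suc j))"
      by (simp add: algebra_simps sum.distrib sum_subtractf sum_negf)
    also have "f 0 + ((\<Sum>j\<le>d. (-1) ^ Suc j * of_nat (d choose Suc j) * f (Suc j)) - (\<Sum>j\<le>d. (-1) ^ j * of_nat (d choose j) * f (Suc j)))
        = (\<Sum>j\<le>Suc d. (-1) ^ j * of_nat (d choose j) * f j) - (\<Sum>j\<le>d. (-1) ^ j * of_nat (d choose j) * f (Suc j))"
      by (subst sum.atMost_Suc_shift) simp
    also have "\<dots> = (\<Sum>j\<le>d. (-1) ^ j * of_nat (d choose j) * (f j - f (Suc j)))"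
      by (simp add: right_diff_distrib sum_subtractf)
    finally show ?thesis .
  qed
  have q: "poly q (of_nat j) = poly p (of_nat j) - poly p (of_nat (Suc j))" for j
    by (simp add: q_def poly_pcompose add.commute)
  show ?case
  proof (cases "degree p = 0")
    case True
    then obtain a where "p = [:a:]" by (auto elim: degree_eq_zeroE)
    then show ?thesis unfolding split by simp
  next
    case False
    have "degree q < degree p"
    proof -
      have deg: "degree (pcompose p [:1, 1:]) = degree p" by (simp add: degree_pcompose)
      have "lead_coeff (pcompose p [:1, 1:]) = lead_coeff p * lead_coeff [:1, 1::'a:] ^ degree p"
        by (rule lead_coeff_comp) simp
      then have "coeff q (degree p) = 0" unfolding q_def using deg by simp
      moreover have "degree q \<le> degree p" unfolding q_def using deg by (intro degree_diff_le) auto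
      ultimately show ?thesis using False by (metis coeff_0_degree_minus_1 diff_less less_eq_Suc_le le_neq_implies_less leading_coeff_0_iff neq0_conv degree_0)
    qed
    then have "(\<Sum>j\<le>d. (-1) ^ j * of_nat (d choose j) * poly q (of_nat j)) = 0"
      using Suc by (intro Suc.IH) auto
    then show ?thesis unfolding split q .
  qed
qed simp

text \<open>
The \<open>k\<close>-th derivative of \<open>sin x ^ d\<close>, through the expansion of the power into exponentials; the
phase grows by \<open>pi / 2\<close> with each differentiation of the cosine.
\<close>

definition sin_power_deriv :: "nat \<Rightarrow> nat \<Rightarrow> real \<Rightarrow> real" where
  "sin_power_deriv d k x = (\<Sum>j\<le>d. (-1) ^ j * real (d choose j) * (real d - 2 * real j) ^ k
      * cos ((real d - 2 * real j) * x + (real k - real d) * (pi / 2))) / 2 ^ d"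

lemma sin_power_deriv_0: "sin_power_deriv d 0 x = sin x ^ d"
proof -
  let ?y = "x - pi / 2"
  \<comment> \<open>Shifting the argument makes both exponentials enter with the sign \<open>+\<close>, so that no powers of \<open>\<i>\<close> occur.\<close>
  have "complex_of_real (2 * sin x) = cis (- ?y) + cis ?y"
  proof -
    have "cis (- y) + cis y = complex_of_real (2 * cos y)" for y
      by (simp add: complex_eq_iff)
    from this[of ?y] show ?thesis by (simp add: cos_diff)
  qed
  then have "complex_of_real ((2 * sin x) ^ d) = (cis (- ?y) + cis ?y) ^ d"
    by (simp only: of_real_power)
  also have "\<dots> = (\<Sum>j\<le>d. of_nat (d choose j) * cis (- ?y) ^ j * cis ?y ^ (d - j))"
    by (rule binomial_ring)
  also have "\<dots> = (\<Sum>j\<le>d. of_nat (d choose j) * cis ((real d - 2 * real j) * ?y))"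
  proof (intro sum.cong refl)
    fix j assume j: "j \<in> {..d}"
    have "cis (- ?y) ^ j * cis ?y ^ (d - j) = cis (real j * (- ?y) + real (d - j) * ?y)"
      by (simp only: Complex.DeMoivre cis_mult)
    also have "real j * (- y) + real (d - j) * y = (real d - 2 * real j) * y" for y
      using j by (simp add: of_nat_diff algebra_simps)
    finally show "of_nat (d choose j) * cis (- ?y) ^ j * cis ?y ^ (d - j) = of_nat (d choose j) * cis ((real d - 2 * real j) * ?y)"
      by (simp add: mult.assoc)
  qed
  finally have "(2 * sin x) ^ d = Re (\<Sum>j\<le>d. of_nat (d choose j) * cis ((real d - 2 * real j) * ?y))"
    by (metis Re_complex_of_real)
  also have "\<dots> = (\<Sum>j\<le>d. real (d choose j) * cos ((real d - 2 * real j) * ?y))"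
    by simp
  also have "\<dots> = (\<Sum>j\<le>d. (-1) ^ j * real (d choose j) * (real d - 2 * real j) ^ 0
      * cos ((real d - 2 * real j) * x + (real 0 - real d) * (pi / 2)))"
  proof (intro sum.cong refl)
    fix j
    have "cos ((real d - 2 * real j) * ?y) = cos (((real d - 2 * real j) * x + (real 0 - real d) * (pi / 2)) + real j * pi)"
      by (rule arg_cong[of _ _ cos]) (simp add: field_simps)
    also have "\<dots> = (-1) ^ j * cos ((real d - 2 * real j) * x + (real 0 - real d) * (pi / 2))"
      by (simp add: cos_add[of _ "real j * pi"] cos_npi sin_npi)
    finally show "real (d choose j) * cos ((real d - 2 * real j) * ?y) = (-1) ^ j * real (d choose j) * (real d - 2 * real j) ^ 0
      * cos ((real d - 2 * real j) * x + (real 0 - real d) * (pi / 2))" by simp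
  qed
  finally have "(2 * sin x) ^ d = 2 ^ d * sin_power_deriv d 0 x" by (simp add: sin_power_deriv_def)
  then show ?thesis by (simp add: power_mult_distrib)
qed

lemma DERIV_sin_power_deriv:
  "(sin_power_deriv d k has_real_derivative sin_power_deriv d (Suc k) x) (at x within S)"
proof -
  have "cos (a * x + (real (Suc k) - real d) * (pi / 2)) = - sin (a * x + (real k - real d) * (pi / 2))" for a
  proof -
    have "cos (a * x + (real (Suc k) - real d) * (pi / 2)) = cos ((a * x + (real k - real d) * (pi / 2)) + pi / 2)"
      by (rule arg_cong[of _ _ cos]) (simp add: field_simps)
    then show ?thesis by (simp add: cos_add)
  qed
  moreover have "((\<lambda>x. C * a ^ k * cos (a * x + \<theta>)) has_real_derivative C * a ^ Suc k * - sin (a * x + \<theta>)) (at x within S)"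
    for C a \<theta> :: real
    by (auto intro!: derivative_eq_intros)
  ultimately show ?thesis
    unfolding sin_power_deriv_def by (intro DERIV_cdivide DERIV_sum) metis
qed

lemma sin_power_deriv_at_0:
  assumes "k < d"
  shows "sin_power_deriv d k 0 = 0"
proof -
  have "degree ([:real d, -2:] ^ k) \<le> degree [:real d, -2:] * k" by (rule degree_power_le)
  then have "degree ([:real d, -2:] ^ k) < d" using assms by simp
  from alternating_binomial_sum_poly[OF this]
  have "(\<Sum>j\<le>d. (-1) ^ j * real (d choose j) * (real d - 2 * real j) ^ k) = 0"
    by (simp add: poly_power mult.commute)
  then show ?thesis
    by (simp add: sin_power_deriv_def flip: sum_distrib_right)
qed

lemma sin_power_deriv_bounded:
  obtains B where "B > 0" "\<And>k x. k \<le> d \<Longrightarrow> \<bar>sin_power_deriv d k x\<bar> \<le> B"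
proof -
  let ?b = "\<lambda>k. \<Sum>j\<le>d. \<bar>(-1) ^ j * real (d choose j) * (real d - 2 * real j) ^ k\<bar>"
  have "\<bar>sin_power_deriv d k x\<bar> \<le> ?b k" for k x
  proof -
    have "\<bar>sin_power_deriv d k x\<bar> \<le> \<bar>\<Sum>j\<le>d. (-1) ^ j * real (d choose j) * (real d - 2 * real j) ^ k
      * cos ((real d - 2 * real j) * x + (real k - real d) * (pi / 2))\<bar>"
      (is "_ \<le> \<bar>?s\<bar>")
    proof -
      have "\<bar>?s\<bar> * 1 \<le> \<bar>?s\<bar> * 2 ^ d" by (intro mult_left_mono) auto
      then show ?thesis unfolding sin_power_deriv_def abs_divide by (simp add: divide_le_eq)
    qed
    also have "\<dots> \<le> ?b k"
      by (rule sum_abs[THEN order_trans], rule sum_mono) (simp add: abs_mult mult_left_le)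
    finally show ?thesis .
  qed
  moreover have "?b k \<le> (\<Sum>k\<le>d. ?b k)" if "k \<le> d" for k
    using that by (intro member_le_sum) (auto intro!: sum_nonneg)
  ultimately have bound: "\<bar>sin_power_deriv d k x\<bar> \<le> (\<Sum>k\<le>d. ?b k) + 1" if "k \<le> d" for k x
    using that by (meson add_increasing2 order_trans zero_le_one)
  have "(\<Sum>k\<le>d. ?b k) + 1 > 0" by (intro add_nonneg_pos sum_nonneg) auto
  then show ?thesis using bound by (rule that)
qed

text \<open>
\<open>sin x ^ d\<close> vanishes to order \<open>d\<close> at \<open>0\<close>, so its derivative of order \<open>d - n\<close> vanishes to
order \<open>n\<close>.
\<close>

lemma sin_power_deriv_near_0:
  assumes B: "\<And>x. \<bar>sin_power_deriv d d x\<bar> \<le> B" and "n \<le> d" "x \<ge> 0"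
  shows "\<bar>sin_power_deriv d (d - n) x\<bar> \<le> B * x ^ n"
  using assms(2,3)
proof (induction n arbitrary: x)
  case (Suc n)
  show ?case
  proof (cases "x = 0")
    case True
    then show ?thesis using Suc.prems by (simp add: sin_power_deriv_at_0)
  next
    case False
    have S: "Suc (d - Suc n) = d - n" using Suc.prems by simp
    obtain z where z: "0 < z" "z < x"
      "sin_power_deriv d (d - Suc n) x - sin_power_deriv d (d - Suc n) 0 = (x - 0) * sin_power_deriv d (d - n) z"
      using MVT2[of 0 x "sin_power_deriv d (d - Suc n)" "sin_power_deriv d (d - n)"]
        DERIV_sin_power_deriv[of d "d - Suc n", unfolded S] False Suc.prems by auto
    then have "\<bar>sin_power_deriv d (d - Suc n) x\<bar> = x * \<bar>sin_power_deriv d (d - n) z\<bar>"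
      using Suc.prems by (simp add: sin_power_deriv_at_0 abs_mult)
    also have "\<dots> \<le> x * (B * z ^ n)"
      using Suc.IH[of z] z Suc.prems by (intro mult_left_mono) auto
    also have "\<dots> \<le> x * (B * x ^ n)"
      using z B[of 0] Suc.prems by (intro mult_left_mono power_mono) auto
    finally show ?thesis by (simp add: mult_ac)
  qed
qed (use B in simp)

lemma integral_sin_divide:
  assumes "b \<ge> 0"
  shows "((\<lambda>x. sin (a * x) / x) has_integral sgn a * Si (b * \<bar>a\<bar>)) {0..b}"
proof -
  have "set_integrable lborel {0<..<b} (\<lambda>x. sin (a * x) / x)"
    using integrable_sinc'[of b a] assms
    by (simp add: interval_lebesgue_integrable_def mult.commute)
  then have "((\<lambda>x. sin (a * x) / x) has_integral (LINT x:{0<..<b}|lborel. sin (a * x) / x)) {0<..<b}"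
    by (metis has_integral_iff set_borel_integral_eq_integral)
  also have "(LINT x:{0<..<b}|lborel. sin (a * x) / x) = sgn a * Si (b * \<bar>a\<bar>)"
    using LBINT_I0c_sin_scale_divide[OF assms, of a] assms
    by (simp add: interval_lebesgue_integral_def mult.commute zero_ereal_def)
  finally show ?thesis
    by (simp add: has_integral_Icc_iff_Ioo)
qed

text \<open>
All \<open>d - 1\<close> integrations by parts at once. The derivative of the sum \<open>A\<close> telescopes, and \<open>A\<close> is
continuous with value \<open>0\<close> at \<open>0\<close>, because each numerator vanishes there to one order more than its denominator.
\<close>

lemma integral_by_parts_sin_power:
  assumes d: "d \<ge> 1" and b: "b \<ge> 0"
  defines "A \<equiv> \<lambda>x. \<Sum>k<d-1. fact (d - 2 - k) * sin_power_deriv d k x / x ^ (d - 1 - k)"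
  shows "((\<lambda>x. sin_power_deriv d (d - 1) x / x - fact (d - 1) * (sin x ^ d / x ^ d)) has_integral A b) {0..b}"
proof -
  \<comment> \<open>The summand of index \<open>k\<close> of \<open>A\<close> has derivative \<open>T x (Suc k) - T x k\<close>.\<close>
  define T where "T x k = fact (d - 1 - k) * sin_power_deriv d k x / x ^ (d - k)" for x k
  have deriv: "(A has_real_derivative (T x (d - 1) - T x 0)) (at x)" if "x > 0" for x
  proof -
    have "((\<lambda>x. fact (d - 2 - k) * sin_power_deriv d k x / x ^ (d - 1 - k)) has_real_derivative T x (Suc k) - T x k) (at x)"
      if "k < d - 1" for k
    proof -
      define n where "n = d - 2 - k"
      have n: "d = k + n + 2" using that by (simp add: n_def)
      have e: "d - 2 - k = n" "d - 1 - k = Suc n" "d - k = Suc (Suc n)" "d - Suc k = Suc n" "d - 1 - Suc k = n" using n by auto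
      have p: "((\<lambda>x. x ^ Suc n) has_real_derivative real (Suc n) * x ^ n) (at x)"
        using DERIV_pow[of "Suc n" x] by simp
      show ?thesis
        unfolding T_def e using \<open>x > 0\<close>
        by (intro DERIV_cong[OF DERIV_divide[OF DERIV_cmult[OF DERIV_sin_power_deriv] p]])
           (simp_all add: field_simps)
    qed
    then have "(A has_real_derivative (\<Sum>k<d-1. T x (Suc k) - T x k)) (at x)"
      unfolding A_def by (intro DERIV_sum) auto
    then show ?thesis by (simp only: sum_lessThan_telescope)
  qed
  have cont: "continuous_on {0..b} A"
  proof -
    obtain B where B: "B > 0" "\<And>k x. k \<le> d \<Longrightarrow> \<bar>sin_power_deriv d k x\<bar> \<le> B"
      using sin_power_deriv_bounded[of d] by blast
    have "continuous_on {0..b} (\<lambda>x. sin_power_deriv d k x / x ^ (d - 1 - k))" if k: "k < d - 1" for k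
    proof -
      let ?q = "\<lambda>x. sin_power_deriv d k x / x ^ (d - 1 - k)"
      have "continuous (at x within {0..b}) ?q" if "x \<in> {0..b}" for x
      proof (cases "x = 0")
        case True
        have "(?q \<longlongrightarrow> 0) (at 0 within {0..b})"
        proof (rule Lim_null_comparison)
          show "\<forall>\<^sub>F x in at 0 within {0..b}. norm (?q x) \<le> B * x"
          proof (unfold eventually_at_filter, intro always_eventually allI impI)
            fix x assume x: "x \<noteq> 0" "x \<in> {0..b}"
            have "\<bar>sin_power_deriv d (d - (d - k)) x\<bar> \<le> B * x ^ (d - k)"
              using x B(2)[of d] by (intro sin_power_deriv_near_0) auto
            also have "d - k = Suc (d - 1 - k)" using k by simp
            finally show "norm (?q x) \<le> B * x" using x k by (simp add: divide_le_eq abs_divide mult_ac)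
          qed
          show "((\<lambda>x. B * x) \<longlongrightarrow> 0) (at 0 within {0..b})" by (auto intro!: tendsto_eq_intros)
        qed
        then show ?thesis using True k by (simp add: continuous_within sin_power_deriv_at_0)
      next
        case False
        then show ?thesis
          by (intro continuous_intros DERIV_continuous[OF DERIV_sin_power_deriv]) auto
      qed
      then show ?thesis by (simp add: continuous_on_eq_continuous_within)
    qed
    then show ?thesis unfolding A_def times_divide_eq_right[symmetric]
      by (intro continuous_on_sum continuous_on_mult continuous_on_const) auto
  qed
  have "((\<lambda>x. T x (d - 1) - T x 0) has_integral (A b - A 0)) {0..b}"
    using deriv by (intro fundamental_theorem_of_calculus_interior[OF b cont])
      (auto simp: has_real_derivative_iff_has_vector_derivative)
  moreover have "T x (d - 1) - T x 0 = sin_power_deriv d (d - 1) x / x - fact (d - 1) * (sin x ^ d / x ^ d)" for x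
    using d by (simp add: T_def sin_power_deriv_0)
  moreover have "A 0 = 0" by (simp add: A_def sin_power_deriv_at_0)
  ultimately show ?thesis by simp
qed

lemma integral_sin_power_deriv_divide:
  assumes d: "d \<ge> 1" and b: "b \<ge> 0"
  shows "((\<lambda>x. sin_power_deriv d (d - 1) x / x) has_integral
     (\<Sum>j\<le>d. (-1) ^ j * real (d choose j) * (real d - 2 * real j) ^ (d - 1)
        * (sgn (real d - 2 * real j) * Si (b * \<bar>real d - 2 * real j\<bar>))) / 2 ^ d) {0..b}"
proof -
  have c: "cos (y + (real (d - 1) - real d) * (pi / 2)) = sin y" for y
    using d by (simp add: of_nat_diff cos_diff flip: minus_divide_left)
  have eq: "sin_power_deriv d (d - 1) x / x = (\<Sum>j\<le>d. (-1) ^ j * real (d choose j) * (real d - 2 * real j) ^ (d - 1)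
        * (sin ((real d - 2 * real j) * x) / x)) / 2 ^ d" for x
    unfolding sin_power_deriv_def c
    unfolding times_divide_eq_right sum_divide_distrib[symmetric] by (simp add: mult.commute)
  show ?thesis unfolding eq
    by (intro has_integral_divide has_integral_sum has_integral_mult_right integral_sin_divide b) auto
qed

text \<open>
The boundary terms tend to \<open>0\<close>, and by \<open>Si_at_top\<close> each Dirichlet integral tends to
\<open>pi / 2\<close> with the sign of \<open>real d - 2 * real j\<close>. The terms for \<open>j\<close> and \<open>d - j\<close> agree, so that the sum folds
to those with \<open>j < d / 2\<close>.
\<close>

lemma tendsto_integral_sin_power:
  assumes d: "d \<ge> 1"
  shows "((\<lambda>b. integral {0..b} (\<lambda>x. sin x ^ d / x ^ d)) \<longlongrightarrow> pi / (2 * fact (d - 1)) *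
    (\<Sum>j | real j < real d / 2. (-1) ^ j * real (d choose j) * (real d / 2 - real j) ^ (d - 1))) at_top"
proof -
  \<comment> \<open>\<open>A\<close> collects the boundary terms and \<open>Q\<close> the Dirichlet integrals up to \<open>b\<close>.\<close>
  define A where "A x = (\<Sum>k<d-1. fact (d - 2 - k) * sin_power_deriv d k x / x ^ (d - 1 - k))" for x
  define Q where "Q b = (\<Sum>j\<le>d. (-1) ^ j * real (d choose j) * (real d - 2 * real j) ^ (d - 1)
        * (sgn (real d - 2 * real j) * Si (b * \<bar>real d - 2 * real j\<bar>))) / 2 ^ d" for b
  define t where "t j = (-1) ^ j * real (d choose j) * (real d - 2 * real j) ^ (d - 1) * (sgn (real d - 2 * real j))" for j
  let ?S = "\<Sum>j | real j < real d / 2. (-1) ^ j * real (d choose j) * (real d / 2 - real j) ^ (d - 1)"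
  have int: "integral {0..b} (\<lambda>x. sin x ^ d / x ^ d) = (Q b - A b) / fact (d - 1)" if "b \<ge> 0" for b
  proof -
    have 1: "((\<lambda>x. sin_power_deriv d (d - 1) x / x) has_integral Q b) {0..b}"
      unfolding Q_def by (rule integral_sin_power_deriv_divide[OF d that])
    have 2: "((\<lambda>x. sin_power_deriv d (d - 1) x / x - fact (d - 1) * (sin x ^ d / x ^ d)) has_integral A b) {0..b}"
      unfolding A_def by (rule integral_by_parts_sin_power[OF d that])
    have "((\<lambda>x. (sin_power_deriv d (d - 1) x / x - (sin_power_deriv d (d - 1) x / x - fact (d - 1) * (sin x ^ d / x ^ d))) / fact (d - 1))
       has_integral (Q b - A b) / fact (d - 1)) {0..b}"
      by (rule has_integral_divide[OF has_integral_diff[OF 1 2]])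
    moreover have "(g - (g - fact (d - 1) * s)) / fact (d - 1) = s" for g s :: real by simp
    ultimately show ?thesis by (simp only: integral_unique)
  qed
  have A0: "(A \<longlongrightarrow> 0) at_top"
  proof -
    obtain B where B: "B > 0" "\<And>k x. k \<le> d \<Longrightarrow> \<bar>sin_power_deriv d k x\<bar> \<le> B"
      using sin_power_deriv_bounded[of d] by blast
    have "((\<lambda>x. fact (d - 2 - k) * sin_power_deriv d k x / x ^ (d - 1 - k)) \<longlongrightarrow> 0) at_top" if k: "k < d - 1" for k
    proof (rule Lim_null_comparison)
      show "\<forall>\<^sub>F x in at_top. norm (fact (d - 2 - k) * sin_power_deriv d k x / x ^ (d - 1 - k)) \<le> fact (d - 2 - k) * B / x ^ (d - 1 - k)"
        using eventually_gt_at_top[of 0]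
        by eventually_elim (use B k in \<open>auto simp: abs_mult abs_divide intro!: divide_right_mono\<close>)
      have "filterlim (\<lambda>x::real. x ^ (d - 1 - k)) at_top at_top"
        using k by (intro filterlim_pow_at_top filterlim_ident) auto
      then show "((\<lambda>x. fact (d - 2 - k) * B / x ^ (d - 1 - k)) \<longlongrightarrow> 0) at_top"
        by (intro tendsto_divide_0[OF tendsto_const] filterlim_at_top_imp_at_infinity)
    qed
    then show ?thesis unfolding A_def by (rule tendsto_null_sum) simp
  qed
  have Si: "((\<lambda>b. sgn a * Si (b * \<bar>a\<bar>)) \<longlongrightarrow> sgn a * (pi / 2)) at_top" for a :: real
  proof (cases "a = 0")
    case False
    have "filterlim (\<lambda>b. \<bar>a\<bar> * b) at_top at_top"
      using False by (intro filterlim_tendsto_pos_mult_at_top[OF tendsto_const] filterlim_ident) auto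
    then have "filterlim (\<lambda>b. b * \<bar>a\<bar>) at_top at_top" by (simp only: mult.commute)
    from filterlim_compose[OF Si_at_top this] show ?thesis by (intro tendsto_mult_left)
  qed simp
  have "(Q \<longlongrightarrow> (\<Sum>j\<le>d. t j * (pi / 2)) / 2 ^ d) at_top"
    unfolding Q_def t_def mult.assoc[of _ "sgn _"] by (intro tendsto_intros Si) auto
  also have "(\<Sum>j\<le>d. t j * (pi / 2)) / 2 ^ d = pi / 2 * ?S"
  proof -
    let ?L = "{j. real j < real d / 2}"
    have fin: "finite ?L" by (rule finite_subset[of _ "{..d}"]) auto
    have sym: "(\<Sum>j | j \<le> d \<and> real j > real d / 2. t j) = (\<Sum>j\<in>?L. t j)"
    proof (rule sum.reindex_bij_witness[of _ "\<lambda>j. d - j" "\<lambda>j. d - j"])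
      fix j assume "j \<in> {j. j \<le> d \<and> real j > real d / 2}"
      then have j: "j \<le> d" "real j > real d / 2" by auto
      obtain n where n: "d = Suc n" using d by (metis Suc_le_D One_nat_def)
      have r: "real d - 2 * real (d - j) = - (real d - 2 * real j)" using j by (simp add: of_nat_diff)
      have "(-1::real) ^ (d - j) * (-1) ^ j = (-1) ^ d" using j by (simp flip: power_add)
      then have "(-1::real) ^ (d - j) = (-1) ^ d * (-1) ^ j"
        by (metis left_minus_one_mult_self mult.assoc mult.commute)
      then have "t (d - j) = (-1) ^ d * (-1) ^ j * real (d choose j) * ((-1) ^ (d - 1) * (real d - 2 * real j) ^ (d - 1)) * (- sgn (real d - 2 * real j))"
        unfolding t_def r using j by (simp add: binomial_symmetric[symmetric] sgn_minus power_minus[of "real d - 2 * real j"] del: minus_diff_eq)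
      also have "\<dots> = t j" unfolding t_def n by (simp add: mult_ac)
      finally show "t (d - j) = t j" .
    qed (auto simp: of_nat_diff)
    have "(\<Sum>j\<le>d. t j) = (\<Sum>j\<in>?L. t j) + (\<Sum>j | j \<le> d \<and> real j > real d / 2. t j)"
    proof (subst sum.union_disjoint[symmetric])
      show "(\<Sum>j\<le>d. t j) = sum t (?L \<union> {j. j \<le> d \<and> real j > real d / 2})"
      proof (rule sum.mono_neutral_right)
        show "\<forall>i\<in>{..d} - (?L \<union> {j. j \<le> d \<and> real d / 2 < real j}). t i = 0"
          by (auto simp: t_def sgn_if)
      qed (use fin in auto)
    qed (use fin in auto)
    also have "\<dots> = 2 * (\<Sum>j\<in>?L. t j)" unfolding sym by (rule mult_2[symmetric])
    also have "(\<Sum>j\<in>?L. t j) = 2 ^ (d - 1) * ?S"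
      unfolding sum_distrib_left
    proof (intro sum.cong refl)
      fix j assume "j \<in> ?L"
      then have "t j = (-1) ^ j * real (d choose j) * (2 * (real d / 2 - real j)) ^ (d - 1)"
        by (simp add: t_def sgn_if)
      then show "t j = 2 ^ (d - 1) * ((-1) ^ j * real (d choose j) * (real d / 2 - real j) ^ (d - 1))"
        unfolding power_mult_distrib by (simp only: mult_ac)
    qed
    finally have "(\<Sum>j\<le>d. t j) = 2 ^ d * ?S" using d by (cases d) auto
    then show ?thesis unfolding sum_distrib_right[symmetric] by simp
  qed
  finally have limQ: "(Q \<longlongrightarrow> pi / 2 * ?S) at_top" .
  have "((\<lambda>b. (Q b - A b) / fact (d - 1)) \<longlongrightarrow> (pi / 2 * ?S - 0) / fact (d - 1)) at_top"
    by (rule tendsto_divide[OF tendsto_diff[OF limQ A0] tendsto_const]) simp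
  then have "((\<lambda>b. integral {0..b} (\<lambda>x. sin x ^ d / x ^ d)) \<longlongrightarrow> (pi / 2 * ?S - 0) / fact (d - 1)) at_top"
    by (rule Lim_transform_eventually) (use eventually_ge_at_top[of 0] in eventually_elim, simp only: int)
  moreover have "(pi / 2 * s - 0) / f = pi / (2 * f) * s" for s f :: real by simp
  ultimately show ?thesis by (simp only:)
qed

section \<open>The degree of the algebra of covariants\<close>

theorem lemma3p1:
  fixes d :: nat and c :: real
  assumes "d \<ge> 1"
    and "c = fact d * degree_covariants d"
  shows "c = (\<Sum>j | real j < real d / 2. (-1) ^ j * real (d choose j) * (real d / 2 - real j) ^ (d - 1))
    \<and> c = 2 * fact (d - 1) / pi * improper_integral (\<lambda>x. (sin x) ^ d / x ^ d)
    \<and> degree_covariants d > 0"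
proof -
  let ?S = "\<Sum>j | real j < real d / 2. (-1) ^ j * real (d choose j) * (real d / 2 - real j) ^ (d - 1)"
  let ?N = "\<lambda>i. real (box_count d i ((d * i + 1) div 2))"
  define L where "L = ?S / (fact d * fact (d - 1))"
  have d: "d = Suc (d - 1)" using assms(1) by simp
  have N: "(\<lambda>i. ?N i / real i ^ (d - 1)) \<longlonglongrightarrow> L"
    using middle_box_count_asymptotics[of "d - 1"] unfolding d[symmetric] L_def .
  have lim: "((\<lambda>z. (1 - z) ^ d * poincare_series d z) \<longlongrightarrow> fact (d - 1) * L) (at_left 1)"
    using abelian_limit[OF N] unfolding d[symmetric] poincare_series_def dim_covariants_deg .
  have deg: "degree_covariants d = fact (d - 1) * L"
    unfolding degree_covariants_def by (rule tendsto_Lim[OF trivial_limit_at_left_real lim])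
  have cancel: "f * (g * (s / (f * g))) = s" "s = 2 * g / pi * (pi / (2 * g) * s)" if "f > 0" "g > 0" for f g s :: real
    using that by simp_all
  have sum: "c = ?S"
    unfolding assms(2) deg L_def by (rule cancel(1)) (rule fact_gt_zero)+
  have int_eq: "improper_integral (\<lambda>x. (sin x) ^ d / x ^ d) = pi / (2 * fact (d - 1)) * ?S"
    unfolding improper_integral_def
    by (rule tendsto_Lim[OF trivial_limit_at_top_linorder tendsto_integral_sin_power[OF assms(1)]])
  have int: "c = 2 * fact (d - 1) / pi * improper_integral (\<lambda>x. (sin x) ^ d / x ^ d)"
    unfolding sum int_eq by (rule cancel(2)[OF zero_less_one]) (rule fact_gt_zero)
  have "1 / (real d ^ d * (real d + 1)) \<le> L"
    by (rule LIMSEQ_le_const[OF N]) (use middle_box_count_ge[OF assms(1)] in blast)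
  moreover have "0 < 1 / (real d ^ d * (real d + 1))" using assms(1) by simp
  ultimately have "L > 0" by linarith
  then have "degree_covariants d > 0" unfolding deg by simp
  with sum int show ?thesis by blast
qed

end
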